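(* Let $s\in(0,1)$ and $r,r',p,p'\in[1,+\infty]$ with $\frac1r+\frac1{r'}=1$ and $\frac1p+\frac1{p'}=1$. There exists a constant $c>0$ depending only on $s,r,p$ (and on the fixed Littlewood-Paley family) such that the following holds for every $L>0$. Let $\xi=\xi(t,x)$ and $g=g(t,x)$ be smooth real-valued functions, $L$-periodic in $x$, and let $u=u(t,x)$ be a smooth real-valued solution, $L$-periodic in $x$, of the inhomogeneous Burgers equation $$\partial_t u+u\,\partial_x u=|\partial_x|g+|\partial_x|\xi .$$ (1) If $u,g,\xi$ are given on the time interval $[0,T]$, $T>0$, then $$\|u\|_{B^{1/3}_{3,\infty}}^3\le c\Big(\|u\|_{B^{1/3}_{3,\infty}}\|g\|_{B^{2/3}_{3/2,1}}+\|u\|_{B^{s}_{p,r}}\|\xi\|_{B^{1-s}_{p',r'}}+\|u(0,\cdot)\|_{L^2([0,L])}^2\Big).$$ (2) Therefore, taking the time-space average, if $u,g,\xi$ are given on $[0,\infty)$, then $$\|u\|_{\mathbb{B}^{1/3}_{3,\infty}}^3\le c\Big(\|u\|_{\mathbb{B}^{1/3}_{3,\infty}}\|g\|_{\mathbb{B}^{2/3}_{3/2,1}}+\|u\|_{\mathbb{B}^{s}_{p,r}}\|\xi\|_{\mathbb{B}^{1-s}_{p',r'}}\Big).$$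
   Context: The operator $|\partial_x|$ acts in $x$ on $L$-periodic functions by $|\partial_x|\sum_{n\in\mathbb{Z}}a_ne^{2i\pi nx/L}=\sum_{n\in\mathbb{Z}}a_n\frac{2\pi}{L}|n|e^{2i\pi nx/L}$. Littlewood-Paley family (fixed once and for all): Schwartz functions $(\phi_k)_{k\in\mathbb{Z}}$ on $\mathbb{R}$ with Fourier transforms $\mathcal{F}\phi(\xi)=\int_{\mathbb{R}}e^{-i\xi x}\phi(x)\,dx$ satisfying $\mathcal{F}\phi_0(\xi)=0$ for $|\xi|\notin(1/2,2)$, $\mathcal{F}\phi_k(\xi)=\mathcal{F}\phi_0(2^{-k}\xi)$ for all $k\in\mathbb{Z}$, $\xi\in\mathbb{R}$, and $\sum_{k\in\mathbb{Z}}\mathcal{F}\phi_k(\xi)=1$ for all $\xi\ne0$ (here $\xi$ denotes the frequency variable, not the function in the claim). For $u(t,x)$ $L$-periodic in $x$, set $u_k(t,x)=\int_{\mathbb{R}}\phi_k(y)u(t,x-y)\,dy$ (convolution in $x$ only). With $L^p=L^p([0,T]\times[0,L])$, the time-space Besov norm is $$\|u\|_{B^s_{p,r}}=\Big(\sum_{k\in\mathbb{Z}}2^{rsk}\|u_k\|_{L^p}^r\Big)^{1/r}\ (r<\infty),\qquad \|u\|_{B^s_{p,\infty}}=\sup_{k\in\mathbb{Z}}2^{sk}\|u_k\|_{L^p},$$ and the rescaled norm is $$\|u\|_{\mathbb{B}^s_{p,r}}=\limsup_{T\to+\infty}\frac{1}{(LT)^{1/p}}\|u\|_{B^s_{p,r}}\in[0,\infty].$$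 In (2), an indeterminate product $0\cdot\infty$ on the right-hand side is read as $+\infty$. *)

theory Defs
  imports
    "HOL-Analysis.Analysis"
    "HOL-Probability.Essential_Supremum"
    "HOL-Library.Periodic_Fun"
begin

section \<open>Extended nonnegative reals\<close>

text \<open>Real powers on \<open>[0,\<infinity>]\<close>; only meant (and only used) for exponents \<open>a > 0\<close>,
  for which \<open>0\<close> is mapped to \<open>0\<close> and \<open>\<infinity>\<close> to \<open>\<infinity>\<close>.\<close>

definition enn_powr :: "ennreal \<Rightarrow> real \<Rightarrow> ennreal" where
  "enn_powr x a = (if x = \<infinity> then \<infinity> else ennreal (enn2real x powr a))"

text \<open>Multiplication with the convention \<open>0 \<cdot> \<infinity> = \<infinity>\<close>
  (the library's product on \<^typ>\<open>ennreal\<close> has \<open>0 \<cdot> \<infinity> = 0\<close>).\<close>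

definition times_top :: "ennreal \<Rightarrow> ennreal \<Rightarrow> ennreal" where
  "times_top a b = (if a = \<infinity> \<or> b = \<infinity> then \<infinity> else a * b)"

text \<open>The exponent \<open>p\<close> ranges over \<open>[1,\<infinity>]\<close>; the value \<open>\<infinity>\<close> is allowed for the norm.\<close>

definition Lp_norm :: "ennreal \<Rightarrow> 'a measure \<Rightarrow> ('a \<Rightarrow> 'b::real_normed_vector) \<Rightarrow> ennreal" where
  "Lp_norm p M f =
     (if p = \<infinity> then esssup M (\<lambda>x. ennreal (norm (f x)))
      else enn_powr (\<integral>\<^sup>+x. ennreal (norm (f x) powr enn2real p) \<partial>M) (1 / enn2real p))"


section \<open>Smooth periodic functions and the operator \<open>|\<partial>\<^sub>x|\<close>\<close>

text \<open>\<open>D i j\<close> is the mixed partial derivative of order \<open>i\<close> in \<open>t\<close> and \<open>j\<close> in \<open>x\<close>. For a time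
  interval \<open>I\<close> containing an endpoint, smoothness is up to the boundary: the time
  derivatives there are one-sided, and all partial derivatives are continuous on the closed strip.
  Values of \<open>u\<close> at times outside \<open>I\<close> are irrelevant.\<close>

definition smooth_strip :: "real set \<Rightarrow> (real \<Rightarrow> real \<Rightarrow> real) \<Rightarrow> bool" where
  "smooth_strip I u \<longleftrightarrow>
     (\<exists>D :: nat \<Rightarrow> nat \<Rightarrow> real \<Rightarrow> real \<Rightarrow> real.
        (\<forall>t\<in>I. \<forall>x. D 0 0 t x = u t x) \<and>
        (\<forall>i j. continuous_on (I \<times> UNIV) (\<lambda>(t, x). D i j t x)) \<and>
        (\<forall>i j. \<forall>t\<in>I. \<forall>x.
           ((\<lambda>\<tau>. D i j \<tau> x) has_real_derivative D (Suc i) j t x) (at t within I) \<and>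
           ((\<lambda>y. D i j t y) has_real_derivative D i (Suc j) t x) (at x)))"

definition smooth_periodic :: "real \<Rightarrow> real set \<Rightarrow> (real \<Rightarrow> real \<Rightarrow> real) \<Rightarrow> bool" where
  "smooth_periodic L I u \<longleftrightarrow> smooth_strip I u \<and> (\<forall>t\<in>I. periodic_fun_simple (u t) L)"

definition fourier_coeff :: "real \<Rightarrow> (real \<Rightarrow> real) \<Rightarrow> int \<Rightarrow> complex" where
  "fourier_coeff L f n =
     (1 / L) *\<^sub>R (LINT x:{0..L}|lborel. f x *\<^sub>R exp (- 2 * \<i> * of_real pi * of_int n * of_real x / of_real L))"

definition abs_dx :: "real \<Rightarrow> (real \<Rightarrow> real) \<Rightarrow> real \<Rightarrow> complex" where
  "abs_dx L f x =
     (\<Sum>\<^sub>\<infinity>n::int. fourier_coeff L f n * of_real (2 * pi / L * \<bar>of_int n\<bar>)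
        * exp (2 * \<i> * of_real pi * of_int n * of_real x / of_real L))"

text \<open>The series \<^const>\<open>abs_dx\<close> is a priori complex-valued (its value is real for real data),
  so the equation is stated in \<^typ>\<open>complex\<close>.\<close>

definition burgers_solution ::
  "real \<Rightarrow> real set \<Rightarrow> (real \<Rightarrow> real \<Rightarrow> real) \<Rightarrow> (real \<Rightarrow> real \<Rightarrow> real) \<Rightarrow> (real \<Rightarrow> real \<Rightarrow> real) \<Rightarrow> bool"
where
  "burgers_solution L I u g \<xi> \<longleftrightarrow>
     (\<forall>t\<in>I. \<forall>x.
        complex_of_real
          (vector_derivative (\<lambda>\<tau>. u \<tau> x) (at t within I) + u t x * deriv (u t) x)
        = abs_dx L (g t) x + abs_dx L (\<xi> t) x)"


section \<open>Littlewood-Paley families\<close>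

definition schwartz :: "(real \<Rightarrow> complex) \<Rightarrow> bool" where
  "schwartz f \<longleftrightarrow>
     (\<exists>D :: nat \<Rightarrow> real \<Rightarrow> complex.
        D 0 = f \<and>
        (\<forall>n x. (D n has_vector_derivative D (Suc n) x) (at x)) \<and>
        (\<forall>m n. bounded (range (\<lambda>x. x ^ m *\<^sub>R D n x))))"

definition fourier_transform :: "(real \<Rightarrow> complex) \<Rightarrow> real \<Rightarrow> complex" where
  "fourier_transform f \<xi> = (LINT x|lborel. exp (- \<i> * of_real \<xi> * of_real x) * f x)"

definition littlewood_paley :: "(int \<Rightarrow> real \<Rightarrow> complex) \<Rightarrow> bool" where
  "littlewood_paley \<phi> \<longleftrightarrow>
     (\<forall>k. schwartz (\<phi> k)) \<and>
     (\<forall>\<xi>. \<bar>\<xi>\<bar> \<notin> {1/2<..<2} \<longrightarrow> fourier_transform (\<phi> 0) \<xi> = 0) \<and>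
     (\<forall>k \<xi>. fourier_transform (\<phi> k) \<xi> = fourier_transform (\<phi> 0) (2 powi (- k) * \<xi>)) \<and>
     (\<forall>\<xi>. \<xi> \<noteq> 0 \<longrightarrow> ((\<lambda>k. fourier_transform (\<phi> k) \<xi>) has_sum 1) UNIV)"

definition lp_piece ::
  "(int \<Rightarrow> real \<Rightarrow> complex) \<Rightarrow> int \<Rightarrow> (real \<Rightarrow> real \<Rightarrow> real) \<Rightarrow> real \<Rightarrow> real \<Rightarrow> complex" where
  "lp_piece \<phi> k u t x = (LINT y|lborel. \<phi> k y * of_real (u t (x - y)))"


section \<open>Time-space Besov norms\<close>

definition lp_piece_norm ::
  "(int \<Rightarrow> real \<Rightarrow> complex) \<Rightarrow> real \<Rightarrow> real \<Rightarrow> ennreal \<Rightarrow> int \<Rightarrow> (real \<Rightarrow> real \<Rightarrow> real) \<Rightarrow> ennreal" where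
  "lp_piece_norm \<phi> L T p k u =
     Lp_norm p (restrict_space lborel ({0..T} \<times> {0..L})) (\<lambda>(t, x). lp_piece \<phi> k u t x)"

definition besov_norm ::
  "(int \<Rightarrow> real \<Rightarrow> complex) \<Rightarrow> real \<Rightarrow> real \<Rightarrow> real \<Rightarrow> ennreal \<Rightarrow> ennreal \<Rightarrow> (real \<Rightarrow> real \<Rightarrow> real) \<Rightarrow> ennreal"
where
  "besov_norm \<phi> L T s p r u =
     (if r = \<infinity> then (SUP k::int. ennreal (2 powr (s * of_int k)) * lp_piece_norm \<phi> L T p k u)
      else enn_powr
        (\<Sum>\<^sub>\<infinity>k::int. ennreal (2 powr (enn2real r * s * of_int k))
                       * enn_powr (lp_piece_norm \<phi> L T p k u) (enn2real r))
        (1 / enn2real r))"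

text \<open>For \<open>p = \<infinity>\<close> we have \<^term>\<open>enn2real (1 / p) = 0\<close>, so that the
  normalising factor is \<open>1\<close>, as it should be.\<close>

definition besov_norm_avg ::
  "(int \<Rightarrow> real \<Rightarrow> complex) \<Rightarrow> real \<Rightarrow> real \<Rightarrow> ennreal \<Rightarrow> ennreal \<Rightarrow> (real \<Rightarrow> real \<Rightarrow> real) \<Rightarrow> ennreal"
where
  "besov_norm_avg \<phi> L s p r u =
     Limsup at_top (\<lambda>T::real. 1 / ennreal ((L * T) powr enn2real (1 / p)) * besov_norm \<phi> L T s p r u)"

end

theory Submission
  imports Defs "HOL-Probability.Sinc_Integral"
begin

text \<open>
The solution is tested with the absolute value of its own increment. Put \<open>w(t,x) = u(t,x + h) - u(t,x)\<close> and
\<open>\<eta> = \<partial>\<^sub>t u + u \<partial>\<^sub>x u\<close>, which equals \<open>|\<partial>\<^sub>x|g + |\<partial>\<^sub>x|\<xi>\<close>. Multiplying the difference of the equations at \<open>x + h\<close> and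
\<open>x\<close> by \<open>\<bar>w\<bar>\<close> and integrating over a period gives a variant of the Karman-Howarth-Monin identity:
\<open>\<partial>\<^sub>t \<integral> \<bar>w\<bar> w / 2 dx + \<partial>\<^sub>h \<integral> \<bar>w\<bar>\<^sup>3 / 6 dx = \<integral> \<bar>w\<bar> (\<eta>(x + h) - \<eta>(x)) dx\<close>.
Integrated over \<open>0 \<le> h \<le> H\<close> and \<open>0 \<le> t \<le> T\<close> it bounds \<open>\<integral>\<integral>\<bar>u(x + H) - u(x)\<bar>\<^sup>3 / H\<close> by the energies at times \<open>0\<close>
and \<open>T\<close> and by pairings of \<open>\<eta>\<close> with translates of \<open>\<bar>w\<bar>\<close> (\<open>Karman_Howarth_Monin_bound\<close>); the energy at time
\<open>T\<close> is in turn the initial one plus twice the pairing of \<open>\<eta>\<close> with \<open>u\<close> (\<open>energy_identity\<close>). As the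
Littlewood-Paley kernels have mean zero and live at scale \<open>2 powi (-k)\<close>, a linear bound in \<open>H\<close> for the cubic
increments is a bound for the cube of the Besov norm of order \<open>1/3\<close> (\<open>besov_le_cubic_increments\<close>).

It remains to bound the pairing of \<open>|\<partial>\<^sub>x|f\<close> with \<open>u\<close> and with \<open>\<bar>w\<bar>\<close> by the norm of \<open>u\<close> of order \<open>s\<close> times the norm
of \<open>f\<close> of order \<open>1 - s\<close> (\<open>abs_dx_bilinear\<close>). From \<open>\<integral>(1 - cos (l y)) / y\<^sup>2 dy = C0 \<bar>l\<bar>\<close> one obtains
\<open>\<integral> v |\<partial>\<^sub>x|f dx = (1 / (2 C0)) \<integral>\<integral> (v(x + y) - v(x)) (f(x + y) - f(x)) / y\<^sup>2 dx dy\<close>.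
Only increments of the test function occur, and those of \<open>\<bar>w\<bar>\<close> are bounded by those of two translates of \<open>u\<close>;
no norm of \<open>\<bar>w\<bar>\<close> itself has to be estimated. The increments of \<open>u\<close> and \<open>f\<close> are then decomposed into pieces.
Because a piece is reproduced by a smooth kernel at its own scale, its increment by \<open>y\<close> is smaller than the
piece by a factor of order \<open>min 1 (2 powi j \<bar>y\<bar>)\<close>. Integrating two such factors against \<open>dy / y\<^sup>2\<close> leaves an
interaction of the scales \<open>j\<close> and \<open>k\<close> that decays geometrically off the diagonal for \<open>0 < s < 1\<close>, and Hoelder in
time and space and Young in the scales conclude (\<open>bilinear_increments_le\<close>). This is used for \<open>g\<close> with
exponents \<open>3\<close>, \<open>\<infinity>\<close> and order \<open>1/3\<close>, and for \<open>\<xi>\<close> with the given ones.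

Periodic functions enter through absolutely convergent Fourier series (\<open>fourier_inversion\<close>,
\<open>smooth_periodic_fourier\<close>): convolutions, pieces and \<open>|\<partial>\<^sub>x|\<close> all act on the coefficients, and the convolution
with an integrable kernel depends only on its Fourier transform. Part (2) follows on dividing part (1) by \<open>L T\<close>:
by conjugacy of the exponents all products of norms carry the same normalisation, and the initial energy
disappears in the limit (\<open>Limsup_cubic_inequality\<close>).
\<close>

section \<open>Hoelder's inequality on the extended half-line\<close>

lemma enn_powr_ennreal: "0 \<le> x \<Longrightarrow> enn_powr (ennreal x) a = ennreal (x powr a)"
  by (simp add: enn_powr_def)

lemma enn_powr_top [simp]: "enn_powr \<infinity> a = \<infinity>" "enn_powr top a = top"
  by (simp_all add: enn_powr_def)

lemma enn_powr_0 [simp]: "enn_powr 0 a = 0"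
  by (simp add: enn_powr_def)

lemma enn_powr_eq_0_iff: "enn_powr x a = 0 \<longleftrightarrow> x = 0"
  by (cases x) (auto simp: enn_powr_def)

lemma enn_powr_mono: "x \<le> y \<Longrightarrow> 0 \<le> a \<Longrightarrow> enn_powr x a \<le> enn_powr y a"
  by (cases x; cases y) (auto simp: enn_powr_def powr_mono2 top_unique)

lemma enn_powr_powr: "enn_powr (enn_powr x a) b = enn_powr x (a * b)"
  by (cases x) (auto simp: enn_powr_def powr_powr)

lemma enn_powr_one [simp]: "enn_powr x 1 = x"
  by (cases x) (auto simp: enn_powr_def)

lemma enn_powr_mult: "a > 0 \<Longrightarrow> enn_powr (x * y) a = enn_powr x a * enn_powr y a"
  by (cases x; cases y)
     (auto simp: enn_powr_def powr_mult ennreal_mult[symmetric] ennreal_top_mult ennreal_mult_top)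

lemma enn_powr_numeral: "enn_powr x (numeral n) = x ^ numeral n"
  by (cases x) (auto simp: enn_powr_def powr_numeral ennreal_power[symmetric] ennreal_top_mult)

lemma enn_powr_eq_if:
  "enn_powr x a = (if x = top then top else ennreal (enn2real x powr a))"
  by (auto simp: enn_powr_def)

lemma measurable_enn_powr [measurable]:
  "f \<in> borel_measurable M \<Longrightarrow> (\<lambda>x. enn_powr (f x) a) \<in> borel_measurable M"
  unfolding enn_powr_eq_if
  by (intro measurable_If borel_measurable_const measurable_compose[OF _ measurable_ennreal] powr_real_measurable
      borel_measurable_enn2real)
     (simp_all add: pred_def[symmetric])

text \<open>The common form of the space-time norms and of the Besov sums, which are both norms of functions with
values in \<open>[0,\<infinity>]\<close>; a single Hoelder inequality then serves for functions and for sequences.\<close>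

definition Lp_ennreal :: "ennreal \<Rightarrow> 'a measure \<Rightarrow> ('a \<Rightarrow> ennreal) \<Rightarrow> ennreal" where
  "Lp_ennreal p M f = (if p = \<infinity> then esssup M f
     else enn_powr (\<integral>\<^sup>+x. enn_powr (f x) (enn2real p) \<partial>M) (1 / enn2real p))"

lemma Lp_norm_eq_Lp_ennreal: "Lp_norm p M f = Lp_ennreal p M (\<lambda>x. ennreal (norm (f x)))"
  by (simp add: Lp_norm_def Lp_ennreal_def enn_powr_ennreal)

lemma conjugate_exponents_cases:
  fixes p q :: ennreal
  assumes "1 \<le> p" "1 \<le> q" "1 / p + 1 / q = 1"
  obtains (inf1) "p = \<infinity>" "q = 1" | (inf2) "p = 1" "q = \<infinity>"
  | (fin) P Q where "p = ennreal P" "q = ennreal Q" "1 < P" "1 < Q" "1 / P + 1 / Q = 1"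
proof -
  have one: "q = 1" if "1 / q = 1" "1 \<le> q" for q :: ennreal
  proof (cases q)
    case (real Q)
    then have "1 \<le> Q" using that(2) by simp
    then have "ennreal (1 / Q) = 1" using that(1) real by (simp add: divide_ennreal flip: ennreal_1)
    then show ?thesis using real \<open>1 \<le> Q\<close> by simp
  qed (use that in simp)
  consider "p = \<infinity>" | "q = \<infinity>" "p \<noteq> \<infinity>" | "p \<noteq> \<infinity>" "q \<noteq> \<infinity>" by blast
  then show thesis
  proof cases
    case 1
    then have "1 / q = 1" using assms by simp
    then have "q = 1" using one assms by blast
    with 1 show thesis using inf1 by blast
  next
    case 2
    then have "1 / p = 1" using assms by simp
    then have "p = 1" using one assms by blast
    with 2 show thesis using inf2 by blast
  next
    case 3
    then obtain P Q where PQ: "p = ennreal P" "q = ennreal Q" "0 \<le> P" "0 \<le> Q"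
      by (cases p; cases q) auto
    have "1 \<le> P" "1 \<le> Q" using assms PQ by (auto simp flip: ennreal_1)
    then have "ennreal (1 / P + 1 / Q) = 1"
      using assms PQ by (simp add: divide_ennreal flip: ennreal_1)
    then have e: "1 / P + 1 / Q = 1"
      by simp
    have "0 < 1 / P" "0 < 1 / Q" using \<open>1 \<le> P\<close> \<open>1 \<le> Q\<close> by auto
    then have "1 / P < 1" "1 / Q < 1" using e by linarith+
    then have "1 < P" "1 < Q" using \<open>1 \<le> P\<close> \<open>1 \<le> Q\<close> by (auto simp: divide_simps)
    then show thesis using fin PQ e by blast
  qed
qed

text \<open>The real Young inequality applied to \<open>x / a\<close> and \<open>y / b\<close>. With \<open>a\<close> and \<open>b\<close> the two norms, integrating the
right-hand side gives exactly \<open>a * b\<close>, which is how Hoelder's inequality follows.\<close>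

lemma Young_ennreal:
  fixes x y :: ennreal
  assumes "1 < P" "1 < Q" "1 / P + 1 / Q = 1" "0 < a" "0 < b"
  shows "x * y \<le> ennreal (a * b / (P * a powr P)) * enn_powr x P
                + ennreal (a * b / (Q * b powr Q)) * enn_powr y Q"
proof (cases "x = \<infinity> \<or> y = \<infinity>")
  case True
  have "0 < a * b / (P * a powr P)" "0 < a * b / (Q * b powr Q)" using assms by auto
  then show ?thesis using True by (auto simp: ennreal_mult_top)
next
  case False
  then obtain c d where cd: "x = ennreal c" "0 \<le> c" "y = ennreal d" "0 \<le> d"
    by (cases x; cases y) auto
  have "(c / a) * (d / b) \<le> (c / a) powr P / P + (d / b) powr Q / Q"
    using assms cd by (intro Youngs_inequality) auto
  then have "c * d \<le> a * b * ((c / a) powr P / P + (d / b) powr Q / Q)"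
    using assms by (simp only: times_divide_times_eq) (simp add: pos_divide_le_eq mult.commute)
  also have "\<dots> = a * b / (P * a powr P) * c powr P + a * b / (Q * b powr Q) * d powr Q"
    using assms cd by (simp add: powr_divide distrib_left mult.commute)
  finally show ?thesis
    using cd assms
    by (simp add: enn_powr_ennreal ennreal_mult[symmetric] ennreal_plus[symmetric] ennreal_leI del: ennreal_plus)
qed

lemma Hoelder_finite_exponents:
  fixes f g :: "'a \<Rightarrow> ennreal"
  assumes [measurable]: "f \<in> borel_measurable M" "g \<in> borel_measurable M"
    and PQ: "1 < P" "1 < Q" "1 / P + 1 / Q = 1"
  shows "(\<integral>\<^sup>+x. f x * g x \<partial>M) \<le>
     enn_powr (\<integral>\<^sup>+x. enn_powr (f x) P \<partial>M) (1 / P) * enn_powr (\<integral>\<^sup>+x. enn_powr (g x) Q \<partial>M) (1 / Q)"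
proof -
  define A where "A = (\<integral>\<^sup>+x. enn_powr (f x) P \<partial>M)"
  define B where "B = (\<integral>\<^sup>+x. enn_powr (g x) Q \<partial>M)"
  have *: ?thesis if "A = 0 \<or> B = 0"
  proof -
    have "AE x in M. f x * g x = 0"
      using that unfolding A_def B_def
      by (auto simp: nn_integral_0_iff_AE enn_powr_eq_0_iff elim: AE_mp)
    then have "(\<integral>\<^sup>+x. f x * g x \<partial>M) = 0" by (subst nn_integral_0_iff_AE) auto
    then show ?thesis by simp
  qed
  show ?thesis
  proof (cases "A = 0 \<or> B = 0 \<or> A = \<infinity> \<or> B = \<infinity>")
    case True
    then show ?thesis
      using * by (cases "A = 0 \<or> B = 0")
        (auto simp flip: A_def B_def simp: ennreal_mult_top ennreal_top_mult enn_powr_eq_0_iff)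
  next
    case False
    define a where "a = enn2real A powr (1 / P)"
    define b where "b = enn2real B powr (1 / Q)"
    have AB: "0 < enn2real A" "0 < enn2real B"
      using False by (auto simp: enn2real_positive_iff less_top[symmetric] zero_less_iff_neq_zero)
    then have pos: "0 < a" "0 < b" by (auto simp: a_def b_def)
    have ap: "a powr P = enn2real A" "b powr Q = enn2real B"
      using PQ AB by (auto simp: a_def b_def powr_powr)
    have "(\<integral>\<^sup>+x. f x * g x \<partial>M) \<le> (\<integral>\<^sup>+x. ennreal (a * b / (P * a powr P)) * enn_powr (f x) P
                + ennreal (a * b / (Q * b powr Q)) * enn_powr (g x) Q \<partial>M)"
      by (intro nn_integral_mono Young_ennreal PQ pos)
    also have "\<dots> = ennreal (a * b / (P * a powr P)) * A + ennreal (a * b / (Q * b powr Q)) * B"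
      unfolding A_def B_def by (subst nn_integral_add) (auto simp: nn_integral_cmult)
    also have "A = ennreal (a powr P)" using False ap by (simp add: less_top)
    also have "B = ennreal (b powr Q)" using False ap by (simp add: less_top)
    also have "ennreal (a * b / (P * a powr P)) * ennreal (a powr P) + ennreal (a * b / (Q * b powr Q)) * ennreal (b powr Q)
      = ennreal (a * b / P + a * b / Q)"
      using pos PQ by (simp add: ennreal_mult[symmetric] ennreal_plus[symmetric] del: ennreal_plus)
    also have "a * b / P + a * b / Q = a * b * (1 / P + 1 / Q)" by (simp add: algebra_simps)
    also have "\<dots> = a * b" using PQ by simp
    also have "ennreal (a * b) = enn_powr A (1 / P) * enn_powr B (1 / Q)"
      using False by (simp add: enn_powr_def a_def b_def ennreal_mult)
    finally show ?thesis unfolding A_def B_def .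
  qed
qed

text \<open>If one norm vanishes then its function vanishes almost everywhere, so that the product \<open>0 * \<infinity>\<close> is rightly
read as \<open>0\<close> here. The products of norms on a finite time interval inherit this reading.\<close>

lemma Hoelder_ennreal:
  fixes f g :: "'a \<Rightarrow> ennreal"
  assumes [measurable]: "f \<in> borel_measurable M" "g \<in> borel_measurable M"
    and "1 \<le> p" "1 \<le> q" "1 / p + 1 / q = 1"
  shows "(\<integral>\<^sup>+x. f x * g x \<partial>M) \<le> Lp_ennreal p M f * Lp_ennreal q M g"
  using assms(3-5)
proof (cases rule: conjugate_exponents_cases)
  case inf1
  have "(\<integral>\<^sup>+x. f x * g x \<partial>M) \<le> (\<integral>\<^sup>+x. esssup M f * g x \<partial>M)"
    by (intro nn_integral_mono_AE eventually_mono[OF esssup_AE[of f M]] mult_right_mono) auto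
  then show ?thesis using inf1 by (simp add: Lp_ennreal_def nn_integral_cmult)
next
  case inf2
  have "(\<integral>\<^sup>+x. f x * g x \<partial>M) \<le> (\<integral>\<^sup>+x. f x * esssup M g \<partial>M)"
    by (intro nn_integral_mono_AE eventually_mono[OF esssup_AE[of g M]] mult_left_mono) auto
  then show ?thesis using inf2 by (simp add: Lp_ennreal_def nn_integral_multc)
next
  case (fin P Q)
  then show ?thesis using Hoelder_finite_exponents[of f M g P Q] by (simp add: Lp_ennreal_def)
qed

text \<open>Hoelder's inequality with exponents \<open>3/2\<close> and \<open>3\<close> for \<open>w = w powr (2/3) * w powr (1/3)\<close>; it moves the cube
inside a convolution with the weight \<open>w\<close>.\<close>

lemma Jensen_cube:
  fixes w f :: "'a \<Rightarrow> ennreal"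
  assumes [measurable]: "w \<in> borel_measurable M" "f \<in> borel_measurable M"
  shows "(\<integral>\<^sup>+x. w x * f x \<partial>M) ^ 3 \<le> (\<integral>\<^sup>+x. w x \<partial>M) ^ 2 * (\<integral>\<^sup>+x. w x * f x ^ 3 \<partial>M)"
proof -
  have w: "w x = enn_powr (w x) (2/3) * enn_powr (w x) (1/3)" for x
    by (cases "w x") (auto simp: enn_powr_def ennreal_mult[symmetric] powr_add[symmetric] ennreal_top_mult)
  have "(\<integral>\<^sup>+x. w x * f x \<partial>M) = (\<integral>\<^sup>+x. enn_powr (w x) (2/3) * (enn_powr (w x) (1/3) * f x) \<partial>M)"
    by (subst w) (simp add: mult.assoc)
  also have "\<dots> \<le> enn_powr (\<integral>\<^sup>+x. enn_powr (enn_powr (w x) (2/3)) (3/2) \<partial>M) (1 / (3/2)) *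
     enn_powr (\<integral>\<^sup>+x. enn_powr (enn_powr (w x) (1/3) * f x) 3 \<partial>M) (1 / 3)"
    by (rule Hoelder_finite_exponents) auto
  also have "\<dots> = enn_powr (\<integral>\<^sup>+x. w x \<partial>M) (2/3) * enn_powr (\<integral>\<^sup>+x. w x * f x ^ 3 \<partial>M) (1 / 3)"
    by (simp add: enn_powr_powr enn_powr_mult) (simp add: enn_powr_numeral)
  finally have "(\<integral>\<^sup>+x. w x * f x \<partial>M) ^ 3 \<le> \<dots> ^ 3" by (rule power_mono) simp
  also have "\<dots> = (\<integral>\<^sup>+x. w x \<partial>M) ^ 2 * (\<integral>\<^sup>+x. w x * f x ^ 3 \<partial>M)"
    by (simp only: enn_powr_numeral[symmetric] enn_powr_mult enn_powr_powr) simp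
  finally show ?thesis .
qed

section \<open>Sums over the integers as integrals\<close>

text \<open>Frequencies and dyadic scales are summed as integrals over counting measure, so that the theorems of
Tonelli and Fubini exchange these sums with integrals in time and space.\<close>

abbreviation "CS \<equiv> count_space (UNIV :: int set)"

lemma infsum_ennreal_eq_nn_integral:
  fixes f :: "int \<Rightarrow> ennreal"
  shows "(\<Sum>\<^sub>\<infinity>k. f k) = (\<integral>\<^sup>+k. f k \<partial>CS)"
proof -
  have "(\<Sum>\<^sub>\<infinity>k. f k) = (\<Sum>\<^sub>\<infinity>n. f (int_decode n))"
    by (rule infsum_reindex_bij_betw[symmetric]) (rule bij_int_decode)
  also have "\<dots> = (\<Sum>n. f (int_decode n))"
    by (intro sums_unique has_sum_imp_sums has_sum_infsum nonneg_summable_on_complete) simp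
  also have "\<dots> = (\<integral>\<^sup>+n. f (int_decode n) \<partial>count_space UNIV)"
    by (rule nn_integral_count_space_nat[symmetric])
  also have "\<dots> = (\<integral>\<^sup>+k. f k \<partial>CS)"
    by (rule nn_integral_bij_count_space) (rule bij_int_decode)
  finally show ?thesis .
qed

lemma esssup_count_space:
  fixes f :: "'a \<Rightarrow> ennreal"
  shows "esssup (count_space UNIV) f = (SUP k. f k)"
  by (intro antisym esssup_I SUP_least) (use esssup_AE[of f "count_space UNIV"] in \<open>auto simp: AE_count_space intro: SUP_upper\<close>)

lemma besov_norm_eq_Lp_ennreal:
  assumes "1 \<le> r"
  shows "besov_norm \<phi> L T s p r u =
     Lp_ennreal r CS (\<lambda>k. ennreal (2 powr (s * of_int k)) * lp_piece_norm \<phi> L T p k u)"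
proof (cases "r = \<infinity>")
  case True
  then show ?thesis by (simp add: besov_norm_def Lp_ennreal_def esssup_count_space)
next
  case False
  then have "0 < enn2real r"
    using assms by (cases r) (auto simp flip: ennreal_1)
  moreover have "ennreal (2 powr (enn2real r * s * of_int k)) * enn_powr x (enn2real r)
      = enn_powr (ennreal (2 powr (s * of_int k)) * x) (enn2real r)" if "0 < enn2real r" for k :: int and x
    using that by (subst enn_powr_mult) (simp_all add: enn_powr_ennreal powr_powr algebra_simps)
  ultimately show ?thesis using False
    by (simp only: besov_norm_def Lp_ennreal_def infsum_ennreal_eq_nn_integral if_False)
qed

section \<open>Translation invariance over a period\<close>

abbreviation strip :: "real \<Rightarrow> real \<Rightarrow> (real \<times> real) measure" where
  "strip T L \<equiv> restrict_space lborel ({0..T} \<times> {0..L})"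

lemma nn_integral_interval_half_open:
  fixes f :: "real \<Rightarrow> ennreal" and a b :: real
  shows "(\<integral>\<^sup>+x. f x * indicator {a..b} x \<partial>lborel) = (\<integral>\<^sup>+x. f x * indicator {a<..b} x \<partial>lborel)"
  by (rule nn_integral_cong_AE)
     (use AE_lborel_singleton[of a] in \<open>auto elim!: eventually_mono split: split_indicator\<close>)

lemma nn_integral_lborel_shift:
  fixes f :: "real \<Rightarrow> ennreal"
  assumes "f \<in> borel_measurable borel"
  shows "(\<integral>\<^sup>+x. f (x + a) \<partial>lborel) = (\<integral>\<^sup>+x. f x \<partial>lborel)"
  using nn_integral_real_affine[OF assms, of 1 a] by (simp add: add.commute)

text \<open>Modulo whole periods the shift is some \<open>b \<in> [0, L)\<close>; the part of the shifted interval that sticks out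
beyond \<open>L\<close> is moved back by one period. Half-open intervals make the two pieces fit without overlap.\<close>

lemma nn_integral_period_shift:
  fixes f :: "real \<Rightarrow> ennreal"
  assumes f[measurable]: "f \<in> borel_measurable borel" and per: "\<And>x. f (x + L) = f x" and "0 < L"
  shows "(\<integral>\<^sup>+x. f (x + a) * indicator {0..L} x \<partial>lborel) = (\<integral>\<^sup>+x. f x * indicator {0..L} x \<partial>lborel)"
proof -
  interpret periodic_fun_simple f L by standard (rule per)
  define b where "b = a - of_int \<lfloor>a / L\<rfloor> * L"
  have b: "0 \<le> b" "b < L"
    using floor_divide_lower[OF \<open>0 < L\<close>, of a] floor_divide_upper[OF \<open>0 < L\<close>, of a]
    by (auto simp: b_def algebra_simps)
  have "f (x + a) = f (x + b)" for x
    using plus_of_int[of "x + b" "\<lfloor>a / L\<rfloor>"] by (simp add: b_def)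
  then have "(\<integral>\<^sup>+x. f (x + a) * indicator {0..L} x \<partial>lborel) = (\<integral>\<^sup>+x. f (x + b) * indicator {0<..L} x \<partial>lborel)"
    by (simp add: nn_integral_interval_half_open)
  also have "\<dots> = (\<integral>\<^sup>+x. f (x + b) * indicator {b<..L + b} (x + b) \<partial>lborel)"
    by (intro nn_integral_cong) (auto split: split_indicator)
  also have "\<dots> = (\<integral>\<^sup>+x. f x * indicator {b<..L + b} x \<partial>lborel)"
    by (rule nn_integral_lborel_shift) measurable
  also have "\<dots> = (\<integral>\<^sup>+x. f x * indicator {b<..L} x + f x * indicator {L<..L + b} x \<partial>lborel)"
    by (intro nn_integral_cong) (use b in \<open>auto split: split_indicator\<close>)
  also have "\<dots> = (\<integral>\<^sup>+x. f x * indicator {b<..L} x \<partial>lborel) + (\<integral>\<^sup>+x. f x * indicator {L<..L + b} x \<partial>lborel)"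
    by (rule nn_integral_add) measurable
  also have "(\<integral>\<^sup>+x. f x * indicator {L<..L + b} x \<partial>lborel) = (\<integral>\<^sup>+x. f (x + L) * indicator {L<..L + b} (x + L) \<partial>lborel)"
    by (rule nn_integral_lborel_shift[symmetric]) measurable
  also have "\<dots> = (\<integral>\<^sup>+x. f x * indicator {0<..b} x \<partial>lborel)"
    by (intro nn_integral_cong) (auto simp: per split: split_indicator)
  also have "(\<integral>\<^sup>+x. f x * indicator {b<..L} x \<partial>lborel) + (\<integral>\<^sup>+x. f x * indicator {0<..b} x \<partial>lborel)
     = (\<integral>\<^sup>+x. f x * indicator {b<..L} x + f x * indicator {0<..b} x \<partial>lborel)"
    by (rule nn_integral_add[symmetric]) measurable
  also have "\<dots> = (\<integral>\<^sup>+x. f x * indicator {0<..L} x \<partial>lborel)"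
    by (intro nn_integral_cong) (use b in \<open>auto split: split_indicator\<close>)
  finally show ?thesis by (simp add: nn_integral_interval_half_open)
qed

lemma set_integral_period_shift:
  fixes f :: "real \<Rightarrow> real"
  assumes f: "continuous_on UNIV f" and per: "\<And>x. f (x + L) = f x" and "0 < L"
  shows "(LINT x:{0..L}|lborel. f (x + a)) = (LINT x:{0..L}|lborel. f x)"
proof -
  have [measurable]: "f \<in> borel_measurable borel" by (rule borel_measurable_continuous_onI[OF f])
  have i: "set_integrable lborel {0..L} (\<lambda>x. f (x + a))" for a
    by (intro borel_integrable_atLeastAtMost')
       (auto intro!: continuous_intros continuous_on_compose2[OF f])
  have s: "ennreal (c * (indicator {0..L} x * y)) = ennreal (c * y) * indicator {0..L} x" for c x y :: real
    by (auto split: split_indicator)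
  have "(\<integral>\<^sup>+x. ennreal (c * (indicator {0..L} x * f (x + a))) \<partial>lborel) =
        (\<integral>\<^sup>+x. ennreal (c * (indicator {0..L} x * f x)) \<partial>lborel)" for c
    unfolding s by (rule nn_integral_period_shift[of "\<lambda>x. ennreal (c * f x)"]) (auto simp: per \<open>0 < L\<close>)
  from this[of 1] this[of "-1"] show ?thesis
    using i[of a] i[of 0] unfolding set_lebesgue_integral_def set_integrable_def
    by (subst (1 2) real_lebesgue_integral_def) auto
qed

lemma nn_integral_strip:
  fixes F :: "real \<times> real \<Rightarrow> ennreal"
  assumes [measurable]: "F \<in> borel_measurable (borel \<Otimes>\<^sub>M borel)"
  shows "(\<integral>\<^sup>+z. F z \<partial>strip T L)
    = (\<integral>\<^sup>+t. (\<integral>\<^sup>+x. F (t, x) * indicator {0..L} x \<partial>lborel) * indicator {0..T} t \<partial>lborel)"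
proof -
  have "(\<integral>\<^sup>+z. F z \<partial>strip T L) = (\<integral>\<^sup>+z. F z * indicator ({0..T} \<times> {0..L}) z \<partial>(lborel \<Otimes>\<^sub>M lborel))"
    by (subst nn_integral_restrict_space) (auto simp: lborel_prod closed_Times borel_closed)
  also have "\<dots> = (\<integral>\<^sup>+t. (\<integral>\<^sup>+x. F (t, x) * indicator {0..L} x * indicator {0..T} t \<partial>lborel) \<partial>lborel)"
    by (subst lborel.nn_integral_fst[symmetric])
       (auto simp: indicator_times mult_ac borel_measurable_indicator' intro!: borel_measurable_times_ennreal)
  also have "\<dots> = (\<integral>\<^sup>+t. (\<integral>\<^sup>+x. F (t, x) * indicator {0..L} x \<partial>lborel) * indicator {0..T} t \<partial>lborel)"
    by (subst nn_integral_multc) auto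
  finally show ?thesis .
qed

lemma measurable_strip:
  "F \<in> borel_measurable (borel \<Otimes>\<^sub>M borel) \<Longrightarrow> F \<in> borel_measurable (strip T L)"
  by (rule measurable_restrict_space1) (simp add: borel_prod)

lemma nn_integral_strip_shift:
  fixes F :: "real \<times> real \<Rightarrow> ennreal"
  assumes [measurable]: "F \<in> borel_measurable (borel \<Otimes>\<^sub>M borel)"
    and per: "\<And>t x. F (t, x + L) = F (t, x)" and "0 < L"
  shows "(\<integral>\<^sup>+z. F (fst z, snd z + a) \<partial>strip T L) = (\<integral>\<^sup>+z. F z \<partial>strip T L)"
  by (subst (1 2) nn_integral_strip, measurable)
     (simp add: nn_integral_period_shift[of "\<lambda>x. F (_, x)"] per \<open>0 < L\<close>)

text \<open>For \<open>p = \<infinity>\<close> this also reduces to the integral case, because the measure of a superlevel set is the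
integral of its indicator.\<close>

lemma Lp_ennreal_strip_shift:
  fixes F :: "real \<times> real \<Rightarrow> ennreal"
  assumes [measurable]: "F \<in> borel_measurable (borel \<Otimes>\<^sub>M borel)"
    and per: "\<And>t x. F (t, x + L) = F (t, x)" and "0 < L"
  shows "Lp_ennreal p (strip T L) (\<lambda>z. F (fst z, snd z + a)) = Lp_ennreal p (strip T L) F"
proof -
  have "emeasure (strip T L) {z \<in> space (strip T L). c < F (fst z, snd z + a)}
      = emeasure (strip T L) {z \<in> space (strip T L). c < F z}" for c
  proof -
    have 1: "emeasure (strip T L) {z \<in> space (strip T L). c < G z} = (\<integral>\<^sup>+z. indicator {c<..} (G z) \<partial>strip T L)"
      if [measurable]: "G \<in> borel_measurable (borel \<Otimes>\<^sub>M borel)" for G :: "real \<times> real \<Rightarrow> ennreal"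
    proof -
      have [measurable]: "G \<in> borel_measurable (strip T L)" by (rule measurable_strip) measurable
      show ?thesis
        by (subst nn_integral_indicator[symmetric], measurable)
           (intro nn_integral_cong, auto split: split_indicator)
    qed
    show ?thesis
      by (subst (1 2) 1, measurable)
         (rule nn_integral_strip_shift[of "\<lambda>z. indicator {c<..} (F z)"], auto simp: per \<open>0 < L\<close>)
  qed
  moreover have "(\<integral>\<^sup>+z. enn_powr (F (fst z, snd z + a)) P \<partial>strip T L) = (\<integral>\<^sup>+z. enn_powr (F z) P \<partial>strip T L)" for P
    by (rule nn_integral_strip_shift[of "\<lambda>z. enn_powr (F z) P"]) (auto simp: per \<open>0 < L\<close>)
  ultimately show ?thesis
    by (simp add: Lp_ennreal_def esssup_eq measurable_strip)
qed

section \<open>Dilations of Schwartz kernels\<close>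

lemma integrable_inverse_1_plus_square_lborel: "integrable lborel (\<lambda>x::real. inverse (1 + x^2))"
  using integrable_inverse_1_plus_square by (simp add: set_integrable_def)

lemma integrable_if_bounded_square:
  fixes f :: "real \<Rightarrow> complex"
  assumes [measurable]: "f \<in> borel_measurable borel"
    and "bounded (range f)" "bounded (range (\<lambda>x. x^2 *\<^sub>R f x))"
  shows "integrable lborel f"
proof -
  obtain A B where A: "\<And>x. norm (f x) \<le> A" and B: "\<And>x. norm (x^2 *\<^sub>R f x) \<le> B"
    using assms(2,3) by (auto simp: bounded_iff)
  show ?thesis
  proof (rule Bochner_Integration.integrable_bound)
    show "integrable lborel (\<lambda>x::real. (A + B) * inverse (1 + x^2))"
      by (intro integrable_mult_right integrable_inverse_1_plus_square_lborel)
    have "norm (f x) \<le> norm ((A + B) * inverse (1 + x^2))" for x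
    proof -
      have "(1 + x^2) * norm (f x) \<le> A + B" using A[of x] B[of x] by (simp add: algebra_simps)
      moreover have "0 < 1 + x^2" by (simp add: add_pos_nonneg)
      ultimately have "norm (f x) \<le> (A + B) / (1 + x^2)" by (simp add: field_simps)
      then show ?thesis by (simp add: divide_inverse)
    qed
    then show "AE x in lborel. norm (f x) \<le> norm ((A + B) * inverse (1 + x^2))" by simp
  qed simp
qed

lemma schwartz_facts:
  assumes "schwartz f"
  obtains f' where "\<And>x. (f has_vector_derivative f' x) (at x)" "continuous_on UNIV f'"
    "integrable lborel f" "integrable lborel f'" "integrable lborel (\<lambda>x. x *\<^sub>R f x)"
proof -
  obtain D where D: "D 0 = f" "\<And>n x. (D n has_vector_derivative D (Suc n) x) (at x)"
    "\<And>m n. bounded (range (\<lambda>x. x ^ m *\<^sub>R D n x))"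
    using assms unfolding schwartz_def by blast
  have cont: "continuous_on UNIV (D n)" for n
    by (intro continuous_at_imp_continuous_on ballI has_vector_derivative_continuous[OF D(2)])
  have [measurable]: "D n \<in> borel_measurable borel" for n
    by (rule borel_measurable_continuous_onI[OF cont])
  have b0: "bounded (range (D n))" for n using D(3)[of 0 n] by simp
  have i: "integrable lborel (D n)" for n
    by (rule integrable_if_bounded_square[OF _ b0 D(3)]) measurable
  have "integrable lborel (\<lambda>x. x *\<^sub>R f x)"
  proof (rule integrable_if_bounded_square)
    show "bounded (range (\<lambda>x. x *\<^sub>R f x))" using D(3)[of 1 0] D(1) by simp
    show "bounded (range (\<lambda>x. x\<^sup>2 *\<^sub>R x *\<^sub>R f x))"
      using D(3)[of 3 0] D(1) by (simp add: power2_eq_square power3_eq_cube mult.assoc)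
    show "(\<lambda>x. x *\<^sub>R f x) \<in> borel_measurable borel" using D(1) by auto
  qed
  then show thesis using that[of "D 1"] D(1) D(2)[of 0] cont[of 1] i[of 0] i[of 1] by simp
qed

text \<open>An increment is the average of \<open>h f'\<close> over the segment from \<open>x\<close> to \<open>x + h\<close>, and all translates of \<open>f'\<close> have
the same \<open>L\<^sup>1\<close> norm.\<close>

lemma L1_norm_increment_le:
  fixes f f' :: "real \<Rightarrow> complex"
  assumes der: "\<And>x. (f has_vector_derivative f' x) (at x)" and f': "continuous_on UNIV f'"
  shows "(\<integral>\<^sup>+x. ennreal (norm (f (x + h) - f x)) \<partial>lborel) \<le> ennreal \<bar>h\<bar> * (\<integral>\<^sup>+x. ennreal (norm (f' x)) \<partial>lborel)"
proof -
  have [measurable]: "f' \<in> borel_measurable borel" by (rule borel_measurable_continuous_onI[OF f'])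
  have "ennreal (norm (f (x + h) - f x)) \<le> (\<integral>\<^sup>+s. ennreal \<bar>h\<bar> * ennreal (norm (f' (x + s * h))) * indicator {0..1} s \<partial>lborel)" for x
  proof -
    have c: "continuous_on {0..1} (\<lambda>s. h *\<^sub>R f' (x + s * h))"
      by (intro continuous_intros continuous_on_compose2[OF f']) auto
    have "((\<lambda>s. f (x + s * h)) has_vector_derivative h *\<^sub>R f' (x + s * h)) (at s within {0..1})" for s
      by (rule vector_diff_chain_within[of "\<lambda>s. x + s * h" h s "{0..1}" f, unfolded o_def])
         (auto intro!: derivative_eq_intros has_vector_derivative_at_within[OF der])
    then have "f (x + h) - f x = integral\<^sup>L lborel (\<lambda>s. indicator {0..1} s *\<^sub>R (h *\<^sub>R f' (x + s * h)))"
      using integral_FTC_atLeastAtMost[OF _ _ c, of "\<lambda>s. f (x + s * h)"] by simp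
    moreover have "integrable lborel (\<lambda>s. indicator {0..1} s *\<^sub>R (h *\<^sub>R f' (x + s * h)))"
      using borel_integrable_atLeastAtMost'[OF c] by (simp add: set_integrable_def)
    ultimately have "ennreal (norm (f (x + h) - f x)) \<le> (\<integral>\<^sup>+s. norm (indicator {0..1} s *\<^sub>R (h *\<^sub>R f' (x + s * h))) \<partial>lborel)"
      by (simp only: integral_norm_bound_ennreal)
    also have "\<dots> = (\<integral>\<^sup>+s. ennreal \<bar>h\<bar> * ennreal (norm (f' (x + s * h))) * indicator {0..1} s \<partial>lborel)"
      by (intro nn_integral_cong) (auto simp: ennreal_mult split: split_indicator)
    finally show ?thesis .
  qed
  then have "(\<integral>\<^sup>+x. ennreal (norm (f (x + h) - f x)) \<partial>lborel)
     \<le> (\<integral>\<^sup>+x. \<integral>\<^sup>+s. ennreal \<bar>h\<bar> * ennreal (norm (f' (x + s * h))) * indicator {0..1} s \<partial>lborel \<partial>lborel)"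
    by (intro nn_integral_mono)
  also have "\<dots> = (\<integral>\<^sup>+s. \<integral>\<^sup>+x. ennreal \<bar>h\<bar> * ennreal (norm (f' (x + s * h))) * indicator {0..1} s \<partial>lborel \<partial>lborel)"
    by (rule lborel_pair.Fubini'[symmetric]) measurable
  also have "\<dots> = (\<integral>\<^sup>+s. (ennreal \<bar>h\<bar> * (\<integral>\<^sup>+x. ennreal (norm (f' x)) \<partial>lborel)) * indicator {0..1} (s::real) \<partial>lborel)"
  proof (rule nn_integral_cong)
    fix s :: real
    have "(\<integral>\<^sup>+x. ennreal \<bar>h\<bar> * ennreal (norm (f' (x + s * h))) * indicator {0..1} s \<partial>lborel)
      = ennreal \<bar>h\<bar> * (\<integral>\<^sup>+x. ennreal (norm (f' (x + s * h))) \<partial>lborel) * indicator {0..1} s"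
      by (simp add: nn_integral_multc nn_integral_cmult)
    also have "(\<integral>\<^sup>+x. ennreal (norm (f' (x + s * h))) \<partial>lborel) = (\<integral>\<^sup>+x. ennreal (norm (f' x)) \<partial>lborel)"
      by (rule nn_integral_lborel_shift) measurable
    finally show "(\<integral>\<^sup>+x. ennreal \<bar>h\<bar> * ennreal (norm (f' (x + s * h))) * indicator {0..1} s \<partial>lborel)
      = (ennreal \<bar>h\<bar> * (\<integral>\<^sup>+x. ennreal (norm (f' x)) \<partial>lborel)) * indicator {0..1} s" .
  qed
  also have "\<dots> = ennreal \<bar>h\<bar> * (\<integral>\<^sup>+x. ennreal (norm (f' x)) \<partial>lborel)"
    by (subst nn_integral_cmult_indicator) auto
  finally show ?thesis .
qed

text \<open>The \<open>L\<^sup>1\<close>-normalised dilation. It has the Fourier transform that is prescribed for \<open>\<phi>\<^sub>k\<close>, and since a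
convolution with a periodic function only sees the Fourier transform of the kernel, it stands in for \<open>\<phi>\<^sub>k\<close>
whenever norms or moments of the kernel at scale \<open>k\<close> are needed.\<close>

definition dilate :: "(real \<Rightarrow> complex) \<Rightarrow> int \<Rightarrow> real \<Rightarrow> complex" where
  "dilate f k x = 2 powi k *\<^sub>R f (2 powi k * x)"

lemma integrable_dilate: "integrable lborel f \<Longrightarrow> integrable lborel (dilate f k)"
  using lborel_integrable_real_affine[of f "2 powi k" 0] by (simp add: dilate_def[abs_def])

lemma measurable_dilate [measurable]: "f \<in> borel_measurable borel \<Longrightarrow> dilate f k \<in> borel_measurable borel"
proof -
  assume [measurable]: "f \<in> borel_measurable borel"
  have "(\<lambda>x. c *\<^sub>R f (c * x)) \<in> borel_measurable borel" for c by measurable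
  then show "dilate f k \<in> borel_measurable borel" by (simp add: dilate_def[abs_def])
qed

lemma fourier_transform_dilate:
  "fourier_transform (dilate f k) \<xi> = fourier_transform f (2 powi (- k) * \<xi>)"
proof -
  define c :: real where "c = 2 powi k"
  have c: "c > 0" "2 powi (-k) = inverse c" by (auto simp: c_def power_int_minus)
  have "fourier_transform f (inverse c * \<xi>)
     = \<bar>c\<bar> *\<^sub>R (LINT x|lborel. exp (- \<i> * of_real (inverse c * \<xi>) * of_real (0 + c * x)) * f (0 + c * x))"
    unfolding fourier_transform_def by (rule lborel_integral_real_affine) (use c in auto)
  also have "\<dots> = (LINT x|lborel. exp (- \<i> * of_real \<xi> * of_real x) * (c *\<^sub>R f (c * x)))"
    using c by (subst integral_scaleR_right[symmetric])
       (simp add: mult_ac scaleR_conv_of_real)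
  finally show ?thesis using c by (simp add: fourier_transform_def dilate_def c_def)
qed

lemma nn_integral_dilate:
  assumes [measurable]: "f \<in> borel_measurable borel" "g \<in> borel_measurable borel"
  shows "(\<integral>\<^sup>+x. ennreal (norm (dilate f k x)) * g (2 powi k * x) \<partial>lborel) = (\<integral>\<^sup>+x. ennreal (norm (f x)) * g x \<partial>lborel)"
proof -
  have "(\<integral>\<^sup>+x. ennreal (norm (f x)) * g x \<partial>lborel)
     = ennreal \<bar>2 powi k\<bar> * (\<integral>\<^sup>+x. ennreal (norm (f (0 + 2 powi k * x))) * g (0 + 2 powi k * x) \<partial>lborel)"
    by (rule nn_integral_real_affine) auto
  also have "\<dots> = (\<integral>\<^sup>+x. ennreal (norm (dilate f k x)) * g (2 powi k * x) \<partial>lborel)"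
    by (subst nn_integral_cmult[symmetric]) (auto simp: dilate_def ennreal_mult mult_ac)
  finally show ?thesis ..
qed

lemma nn_integral_dilate_increment:
  assumes [measurable]: "f \<in> borel_measurable borel"
  shows "(\<integral>\<^sup>+x. ennreal (norm (dilate f k (x + h) - dilate f k x)) \<partial>lborel)
     = (\<integral>\<^sup>+x. ennreal (norm (f (x + 2 powi k * h) - f x)) \<partial>lborel)"
proof -
  have "dilate f k (x + h) - dilate f k x = dilate (\<lambda>x. f (x + 2 powi k * h) - f x) k x" for x
    by (simp add: dilate_def algebra_simps scaleR_diff_right)
  then show ?thesis
    using nn_integral_dilate[of "\<lambda>x. f (x + 2 powi k * h) - f x" "\<lambda>_. 1" k] by simp
qed

section \<open>Absolutely convergent Fourier series\<close>

lemma integrable_CS_if_summable_halves: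
  fixes f :: "int \<Rightarrow> real"
  assumes nn: "\<And>k. 0 \<le> f k" and s: "summable (\<lambda>n. f (int n))" "summable (\<lambda>n. f (- int n))"
  shows "integrable CS f"
proof -
  have half: "(\<integral>\<^sup>+k. ennreal (f k) * indicator (range h) k \<partial>CS) < \<infinity>"
    if "inj h" "summable (\<lambda>n. f (h n))" for h :: "nat \<Rightarrow> int"
  proof -
    have "(\<integral>\<^sup>+k. ennreal (f k) * indicator (range h) k \<partial>CS) = (\<integral>\<^sup>+k. ennreal (f k) \<partial>count_space (range h))"
      by (simp add: nn_integral_count_space_indicator)
    also have "\<dots> = (\<integral>\<^sup>+n. ennreal (f (h n)) \<partial>count_space UNIV)"
      by (rule nn_integral_bij_count_space[symmetric]) (use that(1) in \<open>simp add: inj_on_imp_bij_betw\<close>)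
    also have "\<dots> = (\<Sum>n. ennreal (f (h n)))" by (rule nn_integral_count_space_nat)
    also have "\<dots> = ennreal (\<Sum>n. f (h n))" by (rule suminf_ennreal2) (use nn that(2) in auto)
    finally show ?thesis by simp
  qed
  have "(\<integral>\<^sup>+k. ennreal (norm (f k)) \<partial>CS)
     \<le> (\<integral>\<^sup>+k. ennreal (f k) * indicator (range int) k + ennreal (f k) * indicator (range (\<lambda>n. - int n)) k \<partial>CS)"
  proof (rule nn_integral_mono)
    fix k :: int
    have "k \<in> range int \<or> k \<in> range (\<lambda>n. - int n)" by (cases k rule: int_cases2) auto
    then show "ennreal (norm (f k)) \<le> ennreal (f k) * indicator (range int) k
        + ennreal (f k) * indicator (range (\<lambda>n. - int n)) k"
      using nn[of k] by (auto split: split_indicator)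
  qed
  also have "\<dots> < \<infinity>"
    using half[of int] half[of "\<lambda>n. - int n"] s by (subst nn_integral_add) (auto simp: inj_def)
  finally show ?thesis by (intro integrableI_bounded) auto
qed

lemma integrable_CS_imp_infsum_eq:
  fixes f :: "int \<Rightarrow> complex"
  assumes "integrable CS f"
  shows "(\<Sum>\<^sub>\<infinity>k. f k) = (LINT k|CS. f k)"
proof -
  have "Infinite_Set_Sum.abs_summable_on f UNIV"
    using assms by (simp add: Infinite_Set_Sum.abs_summable_on_def)
  then have "infsetsum f UNIV = infsum f UNIV"
    by (intro infsetsum_infsum) (simp add: abs_summable_equivalent)
  then show ?thesis by (simp add: infsetsum_def)
qed

text \<open>The Fourier mode of frequency \<open>2\<pi>n / L\<close>.\<close>

definition ef :: "real \<Rightarrow> int \<Rightarrow> real \<Rightarrow> complex" where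
  "ef L n x = exp (2 * \<i> * of_real pi * of_int n * of_real x / of_real L)"

lemma ef_eq_cis: "ef L n x = cis (2 * pi * of_int n * x / L)"
  by (simp add: ef_def cis_conv_exp mult_ac)

lemma norm_ef [simp]: "norm (ef L n x) = 1"
  by (simp add: ef_eq_cis)

lemma ef_zero [simp]: "ef L 0 x = 1" "ef L n 0 = 1"
  by (simp_all add: ef_def)

lemma ef_add: "ef L n (x + y) = ef L n x * ef L n y" "ef L (m + n) x = ef L m x * ef L n x"
  by (simp_all add: ef_eq_cis cis_mult algebra_simps add_divide_distrib)

lemma ef_mult_minus [simp]: "ef L n x * ef L n (- x) = 1" "ef L n (- x) * ef L n x = 1"
  by (simp_all flip: ef_add(1))

lemma ef_period: "L \<noteq> 0 \<Longrightarrow> ef L n (x + L) = ef L n x"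
  using cis_multiple_2pi[of "of_int n"] by (simp add: ef_add(1)) (simp add: ef_eq_cis)

lemma continuous_on_ef [continuous_intros]:
  "continuous_on S f \<Longrightarrow> continuous_on S (\<lambda>x. ef L n (f x))"
  unfolding ef_def divide_inverse by (intro continuous_intros)

lemma measurable_ef [measurable]: "ef L n \<in> borel_measurable borel"
  by (intro borel_measurable_continuous_onI continuous_on_ef continuous_on_id)

lemma ef_has_vector_derivative:
  "(ef L n has_vector_derivative (2 * \<i> * of_real pi * of_int n / of_real L) * ef L n x) (at x within S)"
proof -
  let ?c = "2 * \<i> * of_real pi * of_int n / of_real L :: complex"
  have "((\<lambda>z. exp (?c * z)) has_field_derivative ?c * exp (?c * of_real x)) (at (of_real x))"
    by (rule derivative_eq_intros refl)+ simp
  from has_vector_derivative_real_field[OF this, THEN has_vector_derivative_at_within]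
  show ?thesis by (simp add: ef_def[abs_def])
qed

definition fc :: "real \<Rightarrow> (real \<Rightarrow> complex) \<Rightarrow> int \<Rightarrow> complex" where
  "fc L g n = (1 / L) *\<^sub>R (LINT x:{0..L}|lborel. g x * ef L (- n) x)"

lemma fourier_coeff_eq_fc: "fourier_coeff L f = fc L (\<lambda>x. of_real (f x))"
  by (rule ext) (simp add: fourier_coeff_def fc_def ef_def scaleR_conv_of_real)

lemma set_integrable_continuous:
  fixes g :: "real \<Rightarrow> 'a::{banach, second_countable_topology}"
  shows "continuous_on {a..b} g \<Longrightarrow> set_integrable lborel {a..b} g"
  by (rule borel_integrable_atLeastAtMost')

lemma set_integral_FTC:
  fixes F :: "real \<Rightarrow> 'a::euclidean_space"
  assumes "a \<le> b" "\<And>x. a \<le> x \<Longrightarrow> x \<le> b \<Longrightarrow> (F has_vector_derivative f x) (at x within {a..b})"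
    "continuous_on {a..b} f"
  shows "(LINT x:{a..b}|lborel. f x) = F b - F a"
  using integral_FTC_atLeastAtMost[OF assms] by (simp add: set_lebesgue_integral_def)

text \<open>Integration by parts; the boundary terms cancel by periodicity.\<close>

lemma fc_derivative:
  assumes "0 < L" and der: "\<And>x. (g has_vector_derivative g' x) (at x)"
    and g': "continuous_on UNIV g'" and per: "g L = g 0"
  shows "fc L g' n = (2 * \<i> * of_real pi * of_int n / of_real L) * fc L g n"
proof -
  let ?c = "2 * \<i> * of_real pi * of_int n / of_real L :: complex"
  have g: "continuous_on UNIV g"
    by (intro continuous_at_imp_continuous_on ballI has_vector_derivative_continuous[OF der])
  have i1: "set_integrable lborel {0..L} (\<lambda>x. g' x * ef L (- n) x)"
    and i2: "set_integrable lborel {0..L} (\<lambda>x. g x * ef L (- n) x)"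
    by (intro set_integrable_continuous continuous_intros continuous_on_subset[OF g'] continuous_on_subset[OF g] subset_UNIV)+
  have "(LINT x:{0..L}|lborel. g' x * ef L (- n) x - ?c * (g x * ef L (- n) x)) =
      g L * ef L (- n) L - g 0 * ef L (- n) 0"
  proof (rule set_integral_FTC)
    show "continuous_on {0..L} (\<lambda>x. g' x * ef L (- n) x - ?c * (g x * ef L (- n) x))"
      by (intro continuous_intros continuous_on_subset[OF g'] continuous_on_subset[OF g] subset_UNIV)
    show "((\<lambda>x. g x * ef L (- n) x) has_vector_derivative g' x * ef L (- n) x - ?c * (g x * ef L (- n) x)) (at x within {0..L})" for x
      by (rule has_vector_derivative_eq_rhs[OF has_vector_derivative_mult[OF
            has_vector_derivative_at_within[OF der] ef_has_vector_derivative]])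
         (simp add: algebra_simps)
  qed (use \<open>0 < L\<close> in auto)
  also have "\<dots> = 0" using ef_period[of L "- n" 0] \<open>0 < L\<close> per by simp
  finally have "(LINT x:{0..L}|lborel. g' x * ef L (- n) x) = ?c * (LINT x:{0..L}|lborel. g x * ef L (- n) x)"
    using i1 i2 by (simp add: set_integral_diff)
  then show ?thesis by (simp add: fc_def scaleR_conv_of_real)
qed

lemma norm_fc_le:
  assumes "0 < L" "continuous_on {0..L} g" "\<And>x. 0 \<le> x \<Longrightarrow> x \<le> L \<Longrightarrow> norm (g x) \<le> B"
  shows "norm (fc L g n) \<le> B"
proof -
  have "norm (LINT x:{0..L}|lborel. g x * ef L (- n) x) \<le> (LINT x:{0..L}|lborel. B)"
    unfolding set_lebesgue_integral_def
  proof (rule Bochner_Integration.integral_norm_bound_integral)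
    show "integrable lborel (\<lambda>x. indicat_real {0..L} x *\<^sub>R (g x * ef L (- n) x))"
      using set_integrable_continuous[OF continuous_on_mult[OF assms(2) continuous_on_ef[OF continuous_on_id]], of L "- n"]
      by (simp add: set_integrable_def)
    show "integrable lborel (\<lambda>x. indicat_real {0..L} x *\<^sub>R B)"
      using set_integrable_continuous[of 0 L "\<lambda>x. B"] by (auto simp: set_integrable_def)
  qed (use assms(3) in \<open>auto simp: norm_mult split: split_indicator\<close>)
  also have "\<dots> = L * B" using \<open>0 < L\<close> by (simp add: set_lebesgue_integral_def)
  finally show ?thesis using \<open>0 < L\<close> by (simp add: fc_def field_simps)
qed

lemma continuous_periodic_bounded:
  fixes g :: "real \<Rightarrow> 'a::real_normed_vector"
  assumes "0 < L" "continuous_on UNIV g" "\<And>x. g (x + L) = g x"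
  obtains B where "\<And>x. norm (g x) \<le> B"
proof -
  interpret periodic_fun_simple g L by standard (rule assms)
  have "bounded (g ` {0..L})"
    by (intro compact_imp_bounded compact_continuous_image continuous_on_subset[OF assms(2)]) auto
  then obtain B where B: "\<And>x. x \<in> {0..L} \<Longrightarrow> norm (g x) \<le> B" unfolding bounded_iff by blast
  have "norm (g x) \<le> B" for x
  proof -
    have "x - of_int \<lfloor>x / L\<rfloor> * L \<in> {0..L}"
      using floor_divide_lower[OF \<open>0 < L\<close>, of x] floor_divide_upper[OF \<open>0 < L\<close>, of x]
      by (auto simp: algebra_simps)
    from B[OF this] show ?thesis by (simp add: minus_of_int)
  qed
  then show thesis using that by blast
qed

lemma set_integral_period_shift_complex:
  fixes f :: "real \<Rightarrow> complex"
  assumes f: "continuous_on UNIV f" and per: "\<And>x. f (x + L) = f x" and "0 < L"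
  shows "(LINT x:{0..L}|lborel. f (x + a)) = (LINT x:{0..L}|lborel. f x)"
proof -
  have i: "integrable lborel (\<lambda>x. indicat_real {0..L} x *\<^sub>R f (x + a))" for a
    using set_integrable_continuous[of 0 L "\<lambda>x. f (x + a)"] continuous_on_compose2[OF f, of "{0..L}" "\<lambda>x. x + a"]
    by (auto simp: set_integrable_def continuous_intros)
  have Re: "Re (LINT x:{0..L}|lborel. f (x + a)) = (LINT x:{0..L}|lborel. Re (f (x + a)))"
    and Im: "Im (LINT x:{0..L}|lborel. f (x + a)) = (LINT x:{0..L}|lborel. Im (f (x + a)))" for a
    unfolding set_lebesgue_integral_def
    using integral_Re[OF i[of a]] integral_Im[OF i[of a]] by simp_all
  have "(LINT x:{0..L}|lborel. Re (f (x + a))) = (LINT x:{0..L}|lborel. Re (f x))"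
    "(LINT x:{0..L}|lborel. Im (f (x + a))) = (LINT x:{0..L}|lborel. Im (f x))"
    by (rule set_integral_period_shift; use f per \<open>0 < L\<close> in \<open>auto intro!: continuous_intros\<close>)+
  then show ?thesis using Re[of a] Im[of a] Re[of 0] Im[of 0] by (simp add: complex_eq_iff)
qed

text \<open>Riemann-Lebesgue lemma: translating by half a wavelength changes the sign of the exponential,
  so that a Fourier coefficient sees only the increments of \<open>g\<close>.\<close>

lemma fc_small:
  assumes "0 < L" and g: "continuous_on UNIV g" and per: "\<And>x. g (x + L) = g x" and "0 < \<epsilon>"
  obtains M where "\<And>m. M \<le> \<bar>real_of_int m\<bar> \<Longrightarrow> norm (fc L g m) \<le> \<epsilon>"
proof -
  have "uniformly_continuous_on {- L..2 * L} g"
    by (intro compact_uniformly_continuous continuous_on_subset[OF g]) auto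
  then obtain d where d: "0 < d" "\<And>x y. x \<in> {- L..2 * L} \<Longrightarrow> y \<in> {- L..2 * L} \<Longrightarrow> dist y x < d \<Longrightarrow> dist (g y) (g x) < \<epsilon>"
    using \<open>0 < \<epsilon>\<close> unfolding uniformly_continuous_on_def by meson
  have "norm (fc L g m) \<le> \<epsilon>" if m: "max 1 (L / d) \<le> \<bar>real_of_int m\<bar>" for m
  proof -
    define h where "h = L / (2 * m)"
    have m0: "real_of_int m \<noteq> 0" "1 \<le> \<bar>real_of_int m\<bar>" using m by auto
    have "\<bar>h\<bar> = (L / \<bar>real_of_int m\<bar>) / 2" using \<open>0 < L\<close> by (simp add: h_def abs_mult)
    moreover have "L / \<bar>real_of_int m\<bar> \<le> d" using m d(1) m0 by (simp add: field_simps)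
    moreover have "L / \<bar>real_of_int m\<bar> \<le> L" using m0 \<open>0 < L\<close> by (simp add: field_simps)
    ultimately have h: "\<bar>h\<bar> < d" "\<bar>h\<bar> \<le> L" using d(1) \<open>0 < L\<close> by auto
    have sgn: "ef L (- m) h = - 1" using m0 \<open>0 < L\<close> by (simp add: ef_eq_cis h_def complex_eq_iff)
    have gh: "continuous_on UNIV (\<lambda>x. g (x + h))"
      by (intro continuous_on_compose2[OF g] continuous_intros) auto
    have i: "set_integrable lborel {0..L} (\<lambda>x. g x * ef L (- m) x)"
      "set_integrable lborel {0..L} (\<lambda>x. g (x + h) * ef L (- m) x)"
      by (intro set_integrable_continuous continuous_intros continuous_on_subset[OF g] continuous_on_subset[OF gh] subset_UNIV)+
    have "(LINT x:{0..L}|lborel. g x * ef L (- m) x) = (LINT x:{0..L}|lborel. g (x + h) * ef L (- m) (x + h))"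
      by (rule set_integral_period_shift_complex[symmetric])
         (use \<open>0 < L\<close> in \<open>auto simp: per ef_period intro!: continuous_intros g\<close>)
    also have "\<dots> = - (LINT x:{0..L}|lborel. g (x + h) * ef L (- m) x)"
      unfolding ef_add(1) sgn set_lebesgue_integral_def by simp
    finally have "2 * (LINT x:{0..L}|lborel. g x * ef L (- m) x) = (LINT x:{0..L}|lborel. (g x - g (x + h)) * ef L (- m) x)"
      using i by (simp add: left_diff_distrib set_integral_diff)
    then have "2 * fc L g m = fc L (\<lambda>x. g x - g (x + h)) m"
      by (simp add: fc_def scaleR_conv_of_real field_simps)
    moreover have "norm (fc L (\<lambda>x. g x - g (x + h)) m) \<le> \<epsilon>"
    proof (rule norm_fc_le[OF \<open>0 < L\<close>])
      show "continuous_on {0..L} (\<lambda>x. g x - g (x + h))"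
        by (intro continuous_intros continuous_on_subset[OF g] continuous_on_subset[OF gh] subset_UNIV)
      show "norm (g x - g (x + h)) \<le> \<epsilon>" if "0 \<le> x" "x \<le> L" for x
        using d(2)[of "x + h" x] that h by (auto simp: dist_norm abs_le_iff intro: less_imp_le)
    qed
    ultimately have "norm (2 * fc L g m) \<le> \<epsilon>" by simp
    then have "2 * norm (fc L g m) \<le> \<epsilon>" by (simp add: norm_mult)
    then show ?thesis using norm_ge_zero[of "fc L g m"] by linarith
  qed
  then show thesis using that by blast
qed

lemma fc_tendsto_zero:
  assumes "0 < L" and g: "continuous_on UNIV g" and per: "\<And>x. g (x + L) = g x"
  shows "(\<lambda>N. fc L g (int N)) \<longlonglongrightarrow> 0" "(\<lambda>N. fc L g (- int N - 1)) \<longlonglongrightarrow> 0"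
proof -
  have "\<exists>N0. \<forall>N\<ge>N0. norm (fc L g (int N)) < \<epsilon> \<and> norm (fc L g (- int N - 1)) < \<epsilon>" if "0 < \<epsilon>" for \<epsilon>
  proof -
    have "0 < \<epsilon> / 2" using that by simp
    from fc_small[OF assms this] obtain M where M: "\<And>m. M \<le> \<bar>real_of_int m\<bar> \<Longrightarrow> norm (fc L g m) \<le> \<epsilon> / 2" by blast
    show ?thesis
    proof (intro exI[of _ "nat \<lceil>M\<rceil>"] allI impI)
      fix N assume "nat \<lceil>M\<rceil> \<le> N"
      then have "M \<le> real N" by linarith
      then show "norm (fc L g (int N)) < \<epsilon> \<and> norm (fc L g (- int N - 1)) < \<epsilon>"
        using M[of "int N"] M[of "- int N - 1"] that by auto
    qed
  qed
  then show "(\<lambda>N. fc L g (int N)) \<longlonglongrightarrow> 0" "(\<lambda>N. fc L g (- int N - 1)) \<longlonglongrightarrow> 0"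
    unfolding LIMSEQ_iff by (simp_all, meson+)
qed

lemma LINT_CS_limit_symmetric_sums:
  fixes F :: "int \<Rightarrow> complex"
  assumes F: "integrable CS F"
  shows "(\<lambda>N. \<Sum>k\<in>{- int N..int N}. F k) \<longlonglongrightarrow> (LINT k|CS. F k)"
proof -
  have "(\<lambda>N. LINT k|CS. indicator {- int N..int N} k *\<^sub>R F k) \<longlonglongrightarrow> (LINT k|CS. F k)"
  proof (rule integral_dominated_convergence[where w="\<lambda>k. norm (F k)"])
    show "AE k in CS. (\<lambda>N. indicat_real {- int N..int N} k *\<^sub>R F k) \<longlonglongrightarrow> F k"
    proof (rule AE_I2)
      fix k :: int
      have "\<forall>\<^sub>F N in sequentially. indicat_real {- int N..int N} k *\<^sub>R F k = F k"
        using eventually_ge_at_top[of "nat \<bar>k\<bar>"] by eventually_elim (auto split: split_indicator)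
      then show "(\<lambda>N. indicat_real {- int N..int N} k *\<^sub>R F k) \<longlonglongrightarrow> F k"
        by (rule tendsto_eventually)
    qed
  qed (use F in \<open>auto split: split_indicator\<close>)
  moreover have "(LINT k|CS. indicator {- int N..int N} k *\<^sub>R F k) = (\<Sum>k\<in>{- int N..int N}. F k)" for N
  proof -
    have fin: "finite {a. indicat_real {- int N..int N} a *\<^sub>R F a \<noteq> 0}"
      by (rule finite_subset[of _ "{- int N..int N}"]) (auto split: split_indicator_asm)
    have "(LINT k|CS. indicator {- int N..int N} k *\<^sub>R F k) = (\<Sum>k | k \<in> UNIV \<and> indicat_real {- int N..int N} k *\<^sub>R F k \<noteq> 0. indicat_real {- int N..int N} k *\<^sub>R F k)"
      by (rule lebesgue_integral_count_space_finite_support) (use fin in simp)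
    also have "\<dots> = (\<Sum>k\<in>{- int N..int N}. F k)"
      by (rule sum.mono_neutral_cong_left) (auto split: split_indicator_asm)
    finally show ?thesis .
  qed
  ultimately show ?thesis by simp
qed


lemma vector_derivative_quotient_tendsto:
  fixes g :: "real \<Rightarrow> complex"
  assumes "(g has_vector_derivative d) (at x)"
  shows "((\<lambda>y. (g y - g x) / of_real (y - x)) \<longlongrightarrow> d) (at x)"
proof -
  have "((\<lambda>y. (1 / norm (y - x)) *\<^sub>R (g y - (g x + (y - x) *\<^sub>R d))) \<longlongrightarrow> 0) (at x)"
    using assms unfolding has_vector_derivative_def has_derivative_within by blast
  then have "((\<lambda>y. norm ((1 / norm (y - x)) *\<^sub>R (g y - (g x + (y - x) *\<^sub>R d)))) \<longlongrightarrow> 0) (at x)"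
    by (rule tendsto_norm_zero)
  moreover have "\<forall>\<^sub>F y in at x. norm ((1 / norm (y - x)) *\<^sub>R (g y - (g x + (y - x) *\<^sub>R d)))
      = norm ((g y - g x) / of_real (y - x) - d)"
  proof (rule eventually_at_filter[THEN iffD2], rule always_eventually, intro allI impI)
    fix y assume "y \<noteq> x"
    then have "(g y - g x) / of_real (y - x) - d = (g y - (g x + (y - x) *\<^sub>R d)) / of_real (y - x)"
      by (simp add: field_simps scaleR_conv_of_real)
    then show "norm ((1 / norm (y - x)) *\<^sub>R (g y - (g x + (y - x) *\<^sub>R d)))
      = norm ((g y - g x) / of_real (y - x) - d)"
      by (simp add: norm_divide del: of_real_diff)
  qed
  ultimately have "((\<lambda>y. norm ((g y - g x) / of_real (y - x) - d)) \<longlongrightarrow> 0) (at x)"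
    by (rule Lim_transform_eventually)
  then show ?thesis by (simp add: tendsto_norm_zero_iff LIM_zero_iff)
qed

lemma ef_1_eq_iff:
  assumes "L \<noteq> 0"
  shows "ef L 1 x = ef L 1 y \<longleftrightarrow> (\<exists>n::int. x = y + of_int n * L)"
proof -
  have "ef L 1 x = ef L 1 y \<longleftrightarrow> (\<exists>n::int. 2 * pi * x / L = 2 * pi * y / L + 2 * of_int n * pi)"
    unfolding ef_def exp_eq by (intro ex_cong1) (simp add: complex_eq_iff)
  also have "\<dots> \<longleftrightarrow> (\<exists>n::int. x = y + of_int n * L)"
  proof (intro ex_cong1)
    fix n :: int
    have "2 * pi * x / L = 2 * pi * y / L + 2 * of_int n * pi \<longleftrightarrow> (2 * pi / L) * x = (2 * pi / L) * (y + of_int n * L)"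
      using assms by (simp add: field_simps)
    also have "\<dots> \<longleftrightarrow> x = y + of_int n * L"
      using assms by (subst mult_cancel_left) simp
    finally show "2 * pi * x / L = 2 * pi * y / L + 2 * of_int n * pi \<longleftrightarrow> x = y + of_int n * L" .
  qed
  finally show ?thesis .
qed

text \<open>At the points where \<open>ef L 1 x = ef L 1 x0\<close> periodicity gives \<open>g x = g x0\<close>, so the quotient is the ratio of two
difference quotients at \<open>x\<close> and tends to the ratio of the derivatives; this is the value inserted there.\<close>

lemma divided_difference_continuous:
  assumes "0 < L" and der: "\<And>x. (g has_vector_derivative g' x) (at x)"
    and per: "\<And>x. g (x + L) = g x"
  defines "q x0 x \<equiv> (if ef L 1 x = ef L 1 x0 then g' x / (2 * \<i> * of_real pi / of_real L * ef L 1 x)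
     else (g x - g x0) / (ef L 1 x - ef L 1 x0))"
  shows "continuous_on UNIV (q x0)"
proof (intro continuous_at_imp_continuous_on ballI)
  interpret periodic_fun_simple g L by standard (rule per)
  fix x
  have isg: "isCont g y" for y using has_vector_derivative_continuous[OF der] by simp
  have ise: "isCont (ef L 1) y" for y
    using continuous_on_ef[OF continuous_on_id, of UNIV L 1] by (simp add: continuous_on_eq_continuous_at)
  show "isCont (q x0) x"
  proof (cases "ef L 1 x = ef L 1 x0")
    case True
    then have gx: "g x = g x0" using ef_1_eq_iff[of L x x0] \<open>0 < L\<close> by (auto simp: plus_of_int)
    define c where "c = 2 * \<i> * of_real pi / of_real L * ef L 1 x"
    have "norm c = 2 * pi / L" using \<open>0 < L\<close> by (simp add: c_def norm_mult norm_divide)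
    then have "c \<noteq> 0" using \<open>0 < L\<close> by auto
    have e: "((\<lambda>y. (ef L 1 y - ef L 1 x) / of_real (y - x)) \<longlongrightarrow> c) (at x)"
      using vector_derivative_quotient_tendsto[OF ef_has_vector_derivative[of L 1 x UNIV]] by (simp add: c_def)
    have "((\<lambda>y. ((g y - g x) / of_real (y - x)) / ((ef L 1 y - ef L 1 x) / of_real (y - x))) \<longlongrightarrow> g' x / c) (at x)"
      by (intro tendsto_divide vector_derivative_quotient_tendsto der e \<open>c \<noteq> 0\<close>)
    moreover have "\<forall>\<^sub>F y in at x. ((g y - g x) / of_real (y - x)) / ((ef L 1 y - ef L 1 x) / of_real (y - x)) = q x0 y"
      using tendsto_imp_eventually_ne[OF e \<open>c \<noteq> 0\<close>]
    proof eventually_elim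
      case (elim y)
      then have "ef L 1 y \<noteq> ef L 1 x" "of_real (y - x) \<noteq> (0::complex)" by auto
      then show ?case using True gx by (simp add: q_def del: of_real_diff)
    qed
    ultimately have "(q x0 \<longlongrightarrow> g' x / c) (at x)" by (rule Lim_transform_eventually)
    then show ?thesis using True by (simp add: isCont_def q_def c_def)
  next
    case False
    have c: "isCont (\<lambda>x. (g x - g x0) / (ef L 1 x - ef L 1 x0)) x"
      by (intro continuous_intros isg ise) (use False in auto)
    have "\<forall>\<^sub>F y in nhds x. q x0 y = (g y - g x0) / (ef L 1 y - ef L 1 x0)"
    proof -
      have "open {y. ef L 1 y \<noteq> ef L 1 x0}"
        by (intro open_Collect_neq continuous_intros)
      then have "\<forall>\<^sub>F y in nhds x. ef L 1 y \<noteq> ef L 1 x0" using False eventually_nhds_in_open[of "{y. ef L 1 y \<noteq> ef L 1 x0}"] by auto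
      then show ?thesis by eventually_elim (simp add: q_def)
    qed
    from isCont_cong[OF this] c show ?thesis by simp
  qed
qed

text \<open>The sum of a Fourier series. Everything that is done with periodic functions below (convolutions,
Littlewood-Paley pieces, \<open>|\<partial>\<^sub>x|\<close>) acts diagonally on the coefficients.\<close>

definition trig :: "real \<Rightarrow> (int \<Rightarrow> complex) \<Rightarrow> real \<Rightarrow> complex" where
  "trig L b x = (LINT n|CS. b n * ef L n x)"

text \<open>Pointwise inversion: dividing \<open>g - g x0\<close> by \<open>ef L 1 - ef L 1 x0\<close> leaves a continuous function,
  whose coefficients make the symmetric partial sums at \<open>x0\<close> telescope; the two remaining boundary
  terms vanish in the limit by the Riemann-Lebesgue lemma.\<close>

lemma fourier_inversion:
  assumes "0 < L" and der: "\<And>x. (g has_vector_derivative g' x) (at x)"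
    and g': "continuous_on UNIV g'" and per: "\<And>x. g (x + L) = g x" "\<And>x. g' (x + L) = g' x"
    and int: "integrable CS (fc L g)"
  shows "g x0 = trig L (fc L g) x0"
proof -
  let ?e = "ef L 1 x0"
  define q where "q x = (if ef L 1 x = ?e then g' x / (2 * \<i> * of_real pi / of_real L * ef L 1 x)
     else (g x - g x0) / (ef L 1 x - ?e))" for x
  interpret periodic_fun_simple g L by standard (rule per)
  have q: "continuous_on UNIV q"
    unfolding q_def[abs_def] by (rule divided_difference_continuous[OF \<open>0 < L\<close> der per(1)])
  have g: "continuous_on UNIV g"
    by (intro continuous_at_imp_continuous_on ballI has_vector_derivative_continuous[OF der])
  have qper: "q (x + L) = q x" for x using \<open>0 < L\<close> by (simp add: q_def per ef_period)
  have qe: "g x - g x0 = q x * (ef L 1 x - ?e)" for x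
    using ef_1_eq_iff[of L x x0] \<open>0 < L\<close> by (auto simp: q_def plus_of_int)
  have const: "fc L (\<lambda>x. 1) n = (if n = 0 then 1 else 0)" for n
  proof (cases "n = 0")
    case True
    then show ?thesis using \<open>0 < L\<close> by (simp add: fc_def set_lebesgue_integral_def scaleR_conv_of_real)
  next
    case False
    then show ?thesis using fc_derivative[of L "\<lambda>x. 1" "\<lambda>x. 0" n] \<open>0 < L\<close> by (simp add: fc_def)
  qed
  \<comment> \<open>Multiplication by \<open>ef L 1\<close> shifts the coefficients by one; this is where the telescoping comes from.\<close>
  have "fc L g n - g x0 * fc L (\<lambda>x. 1) n = fc L q (n - 1) - ?e * fc L q n" for n
  proof -
    have i: "set_integrable lborel {0..L} (\<lambda>x. g x * ef L (- n) x)"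
      "set_integrable lborel {0..L} (\<lambda>x. g x0 * (1 * ef L (- n) x))"
      "set_integrable lborel {0..L} (\<lambda>x. q x * ef L (- (n - 1)) x)"
      "set_integrable lborel {0..L} (\<lambda>x. ?e * (q x * ef L (- n) x))"
      by (intro set_integrable_continuous continuous_intros continuous_on_subset[OF g] continuous_on_subset[OF q] subset_UNIV)+
    have "g x * ef L (- n) x - g x0 * (1 * ef L (- n) x) = q x * ef L (- (n - 1)) x - ?e * (q x * ef L (- n) x)" for x
    proof -
      have "ef L (- (n - 1)) x = ef L 1 x * ef L (- n) x" by (simp flip: ef_add(2))
      then show ?thesis using arg_cong[OF qe[of x], of "\<lambda>z. z * ef L (- n) x"] by (simp add: algebra_simps)
    qed
    then have "(LINT x:{0..L}|lborel. g x * ef L (- n) x - g x0 * (1 * ef L (- n) x))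
       = (LINT x:{0..L}|lborel. q x * ef L (- (n - 1)) x - ?e * (q x * ef L (- n) x))" by simp
    then have "(LINT x:{0..L}|lborel. g x * ef L (- n) x) - g x0 * (LINT x:{0..L}|lborel. 1 * ef L (- n) x)
       = (LINT x:{0..L}|lborel. q x * ef L (- (n - 1)) x) - ?e * (LINT x:{0..L}|lborel. q x * ef L (- n) x)"
      by (simp only: set_integral_diff(2)[OF i(1,2)] set_integral_diff(2)[OF i(3,4)] set_integral_mult_right)
    from arg_cong[OF this, of "\<lambda>z. (1 / L) *\<^sub>R z"] show ?thesis
      by (simp only: fc_def scaleR_diff_right mult_scaleR_right)
  qed
  then have tele: "fc L g n * ef L n x0 = (if n = 0 then g x0 else 0)
      + (ef L n x0 * fc L q (n - 1) - ef L (n + 1) x0 * fc L q (n + 1 - 1))" for n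
  proof -
    assume "\<And>n. fc L g n - g x0 * fc L (\<lambda>x. 1) n = fc L q (n - 1) - ?e * fc L q n"
    from this[of n] have "fc L g n = g x0 * fc L (\<lambda>x. 1) n + (fc L q (n - 1) - ?e * fc L q n)"
      by (simp add: algebra_simps)
    then show ?thesis by (subst \<open>fc L g n = _\<close>) (auto simp: const ef_add(2) algebra_simps)
  qed
  have part: "(\<Sum>n\<in>{- int N..int N}. fc L g n * ef L n x0)
      = g x0 + (ef L (- int N) x0 * fc L q (- int N - 1) - ef L (int N + 1) x0 * fc L q (int N))" for N
  proof -
    have "(\<Sum>n\<in>{- int N..int N}. ef L n x0 * fc L q (n - 1) - ef L (n + 1) x0 * fc L q (n + 1 - 1))
       = ef L (- int N) x0 * fc L q (- int N - 1) - ef L (int N + 1) x0 * fc L q (int N + 1 - 1)"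
    proof (induction N)
      case (Suc N)
      have "{- int (Suc N)..int (Suc N)} = insert (1 + int N) (insert (- 1 - int N) {- int N..int N})" by auto
      then show ?case
        by (simp only:) (subst sum.insert, simp, simp, subst sum.insert, simp, simp, unfold Suc.IH, simp add: algebra_simps)
    qed simp
    then show ?thesis by (simp only: tele sum.distrib) simp
  qed
  have "(\<lambda>N. g x0 + (ef L (- int N) x0 * fc L q (- int N - 1) - ef L (int N + 1) x0 * fc L q (int N))) \<longlonglongrightarrow> g x0 + (0 - 0)"
  proof (intro tendsto_intros)
    show "(\<lambda>N. ef L (- int N) x0 * fc L q (- int N - 1)) \<longlonglongrightarrow> 0"
      using fc_tendsto_zero(2)[OF \<open>0 < L\<close> q qper] by (rule Lim_null_comparison[OF always_eventually, rotated, OF tendsto_norm_zero]) (simp add: norm_mult)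
    show "(\<lambda>N. ef L (int N + 1) x0 * fc L q (int N)) \<longlonglongrightarrow> 0"
      using fc_tendsto_zero(1)[OF \<open>0 < L\<close> q qper] by (rule Lim_null_comparison[OF always_eventually, rotated, OF tendsto_norm_zero]) (simp add: norm_mult)
  qed
  moreover have "integrable CS (\<lambda>n. fc L g n * ef L n x0)"
    using int by (rule Bochner_Integration.integrable_bound) (auto simp: norm_mult)
  from LINT_CS_limit_symmetric_sums[OF this]
  have "(\<lambda>N. g x0 + (ef L (- int N) x0 * fc L q (- int N - 1) - ef L (int N + 1) x0 * fc L q (int N))) \<longlonglongrightarrow> trig L (fc L g) x0"
    unfolding part trig_def .
  ultimately show ?thesis using LIMSEQ_unique by fastforce
qed

lemma derivative_of_periodic:
  fixes f :: "real \<Rightarrow> real"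
  assumes "\<And>x. (f has_real_derivative f' x) (at x)" "\<And>x. f (x + L) = f x"
  shows "f' (x + L) = f' x"
proof -
  have "(f has_real_derivative f' (x + L)) (at (x + L))" by (rule assms(1))
  then have "((\<lambda>y. f (y + L)) has_real_derivative f' (x + L)) (at x)" by (simp add: DERIV_shift)
  then have "(f has_real_derivative f' (x + L)) (at x)" by (simp add: assms(2))
  then show ?thesis using DERIV_unique assms(1) by blast
qed

text \<open>Three integrations by parts give coefficients of order \<open>\<bar>n\<bar> powr (-3)\<close>, so that even after
multiplication by \<open>\<bar>n\<bar>\<close>, which is what \<open>|\<partial>\<^sub>x|\<close> costs, they remain summable.\<close>

lemma smooth_periodic_fourier:
  fixes f f1 f2 f3 :: "real \<Rightarrow> real"
  assumes "0 < L" and d1: "\<And>x. (f has_real_derivative f1 x) (at x)"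
    and d2: "\<And>x. (f1 has_real_derivative f2 x) (at x)" and d3: "\<And>x. (f2 has_real_derivative f3 x) (at x)"
    and f3: "continuous_on UNIV f3" and per: "\<And>x. f (x + L) = f x"
  shows "integrable CS (fourier_coeff L f)"
    and "integrable CS (\<lambda>n. of_int \<bar>n\<bar> * fourier_coeff L f n)"
    and "of_real (f x) = trig L (fourier_coeff L f) x"
proof -
  let ?g = "\<lambda>f x. complex_of_real (f x)"
  have p: "f1 (x + L) = f1 x" "f2 (x + L) = f2 x" "f3 (x + L) = f3 x" for x
    using derivative_of_periodic[OF d1 per] derivative_of_periodic[OF d2] derivative_of_periodic[OF d3] by metis+
  have cont: "continuous_on UNIV f1" "continuous_on UNIV f2"
    by (intro continuous_at_imp_continuous_on ballI DERIV_isCont[OF d2] DERIV_isCont[OF d3])+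
  have v: "(?g f has_vector_derivative ?g f1 x) (at x)" "(?g f1 has_vector_derivative ?g f2 x) (at x)"
    "(?g f2 has_vector_derivative ?g f3 x) (at x)" for x
    using d1 d2 d3 by (auto intro!: has_vector_derivative_of_real simp: has_real_derivative_iff_has_vector_derivative)
  have c: "continuous_on UNIV (?g f1)" "continuous_on UNIV (?g f2)" "continuous_on UNIV (?g f3)"
    using cont f3 by (auto intro!: continuous_intros)
  define w where "w n = 2 * \<i> * of_real pi * of_int n / of_real L" for n :: int
  have nw: "norm (w n) = 2 * pi / L * \<bar>of_int n\<bar>" for n
    using \<open>0 < L\<close> by (simp add: w_def norm_mult norm_divide)
  have f3c: "fc L (?g f3) n = w n ^ 3 * fc L (?g f) n" for n
    using fc_derivative[OF \<open>0 < L\<close> v(1) c(1), of n] fc_derivative[OF \<open>0 < L\<close> v(2) c(2), of n]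
      fc_derivative[OF \<open>0 < L\<close> v(3) c(3), of n] per[of 0] p(1)[of 0] p(2)[of 0]
    by (simp add: w_def power3_eq_cube)
  obtain B where B: "\<And>x. norm (?g f3 x) \<le> B"
    using continuous_periodic_bounded[OF \<open>0 < L\<close> c(3)] p(3) by metis
  define B' where "B' = B * (L / (2 * pi)) ^ 3"
  have bd: "\<bar>of_int n\<bar> ^ 3 * norm (fc L (?g f) n) \<le> B'" for n
  proof -
    have "norm (fc L (?g f3) n) \<le> B"
      by (rule norm_fc_le[OF \<open>0 < L\<close>]) (use c(3) B in \<open>auto intro: continuous_on_subset\<close>)
    then have "(2 * pi / L) ^ 3 * (\<bar>of_int n\<bar> ^ 3 * norm (fc L (?g f) n)) \<le> B"
      by (simp only: f3c norm_mult norm_power nw power_mult_distrib mult.assoc)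
    then have "\<bar>of_int n\<bar> ^ 3 * norm (fc L (?g f) n) \<le> B / (2 * pi / L) ^ 3"
      using \<open>0 < L\<close> by (subst pos_le_divide_eq) (simp_all only: mult.commute, simp)
    then show ?thesis by (simp add: B'_def power_divide)
  qed
  have bd2: "\<bar>of_int n\<bar> * norm (fc L (?g f) n) \<le> B' / (of_int n)\<^sup>2" if "n \<noteq> 0" for n
  proof -
    have "(\<bar>of_int n\<bar> * norm (fc L (?g f) n)) * (of_int n)\<^sup>2 = \<bar>of_int n\<bar> ^ 3 * norm (fc L (?g f) n)"
      unfolding power2_abs[of "real_of_int n", symmetric] by (simp only: power2_eq_square power3_eq_cube mult_ac)
    then have "(\<bar>of_int n\<bar> * norm (fc L (?g f) n)) * (of_int n)\<^sup>2 \<le> B'" using bd[of n] by (simp only:)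
    then show ?thesis using that by (simp only: pos_le_divide_eq zero_less_power2 of_int_eq_0_iff not_False_eq_True)
  qed
  have bd1: "norm (fc L (?g f) n) \<le> B' / (of_int n)\<^sup>2" if "n \<noteq> 0" for n
  proof -
    have "1 \<le> \<bar>real_of_int n\<bar>" using that by linarith
    then have "1 * norm (fc L (?g f) n) \<le> \<bar>of_int n\<bar> * norm (fc L (?g f) n)"
      by (intro mult_right_mono) auto
    then show ?thesis using bd2[OF that] by simp
  qed
  have sq: "summable (\<lambda>n. B' / (of_int (int n))\<^sup>2)" "summable (\<lambda>n. B' / (of_int (- int n))\<^sup>2)"
    using inverse_power_summable[of 2, where ?'a=real, THEN summable_mult, of B'] by (auto simp: divide_inverse)
  have comp: "integrable CS h" if h: "\<And>n. 0 \<le> h n" "\<And>n. n \<noteq> 0 \<Longrightarrow> h n \<le> B' / (of_int n)\<^sup>2" for h :: "int \<Rightarrow> real"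
  proof (intro integrable_CS_if_summable_halves h(1))
    have "norm (h (int n)) \<le> B' / (of_int (int n))\<^sup>2" "norm (h (- int n)) \<le> B' / (of_int (- int n))\<^sup>2" if "1 \<le> n" for n
      using h(1)[of "int n"] h(2)[of "int n"] h(1)[of "- int n"] h(2)[of "- int n"] that by auto
    then show "summable (\<lambda>n. h (int n))" "summable (\<lambda>n. h (- int n))"
      using summable_comparison_test'[OF sq(1), of 1 "\<lambda>n. h (int n)"]
        summable_comparison_test'[OF sq(2), of 1 "\<lambda>n. h (- int n)"] by auto
  qed
  have "integrable CS (\<lambda>n. norm (fc L (?g f) n))" by (rule comp) (use bd1 in auto)
  then show i: "integrable CS (fourier_coeff L f)"
    by (simp add: integrable_norm_iff fourier_coeff_eq_fc)
  have "integrable CS (\<lambda>n. \<bar>of_int n\<bar> * norm (fc L (?g f) n))" by (rule comp) (use bd2 in auto)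
  then have "integrable CS (\<lambda>n. norm (of_int \<bar>n\<bar> * fc L (?g f) n))"
    by (simp add: norm_mult)
  then show "integrable CS (\<lambda>n. of_int \<bar>n\<bar> * fourier_coeff L f n)"
    by (simp add: integrable_norm_iff fourier_coeff_eq_fc)
  show "of_real (f x) = trig L (fourier_coeff L f) x"
    unfolding fourier_coeff_eq_fc
    by (rule fourier_inversion[OF \<open>0 < L\<close> v(1) c(1)]) (use per p i in \<open>auto simp: fourier_coeff_eq_fc\<close>)
qed

section \<open>Convolution and second differences of Fourier series\<close>

lemma sigma_finite_CS: "sigma_finite_measure CS"
  by (rule sigma_finite_measure_count_space)

text \<open>The summable bounds \<open>w n\<close> on the \<open>L\<^sup>1\<close> norms make the double integral over counting measure absolutely
convergent, which is all that Fubini asks for.\<close>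

lemma LINT_CS_swap:
  fixes F :: "int \<Rightarrow> 'a \<Rightarrow> complex"
  assumes "sigma_finite_measure M" and [measurable]: "\<And>n. F n \<in> borel_measurable M"
    and bd: "\<And>n. (\<integral>\<^sup>+y. ennreal (norm (F n y)) \<partial>M) \<le> ennreal (w n)" and w: "integrable CS w" "\<And>n. 0 \<le> w n"
  shows "(LINT y|M. LINT n|CS. F n y) = (LINT n|CS. LINT y|M. F n y)"
    and "integrable M (\<lambda>y. LINT n|CS. F n y)"
    and "(\<integral>\<^sup>+y. ennreal (norm (LINT n|CS. F n y)) \<partial>M) \<le> ennreal (LINT n|CS. w n)"
proof -
  interpret N: sigma_finite_measure M by fact
  interpret pair_sigma_finite CS M
    by (intro pair_sigma_finite.intro sigma_finite_CS assms(1))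
  have [measurable]: "(\<lambda>p. F (fst p) (snd p)) \<in> borel_measurable (CS \<Otimes>\<^sub>M M)"
    by (rule measurable_pair_measure_countable1) auto
  have "(\<integral>\<^sup>+p. ennreal (norm (F (fst p) (snd p))) \<partial>(CS \<Otimes>\<^sub>M M)) = (\<integral>\<^sup>+n. \<integral>\<^sup>+y. ennreal (norm (F n y)) \<partial>M \<partial>CS)"
    by (subst N.nn_integral_fst[symmetric]) auto
  also have "\<dots> \<le> (\<integral>\<^sup>+n. ennreal (w n) \<partial>CS)" by (intro nn_integral_mono bd)
  also have "\<dots> < \<infinity>" using w by (simp add: nn_integral_eq_integral)
  finally have i: "integrable (CS \<Otimes>\<^sub>M M) (\<lambda>p. F (fst p) (snd p))"
    by (intro integrableI_bounded) auto
  then have i': "integrable (CS \<Otimes>\<^sub>M M) (\<lambda>(n, y). F n y)" by (simp add: case_prod_beta')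
  show "(LINT y|M. LINT n|CS. F n y) = (LINT n|CS. LINT y|M. F n y)"
    by (rule Fubini_integral) (use i' in simp)
  show "integrable M (\<lambda>y. LINT n|CS. F n y)"
    using integrable_snd[OF i'] by simp
  have "AE y in M. integrable CS (\<lambda>n. F n y)"
    using AE_integrable_snd[OF i'] by simp
  then have "(\<integral>\<^sup>+y. ennreal (norm (LINT n|CS. F n y)) \<partial>M) \<le> (\<integral>\<^sup>+y. \<integral>\<^sup>+n. ennreal (norm (F n y)) \<partial>CS \<partial>M)"
    by (intro nn_integral_mono_AE) (auto elim!: eventually_mono intro: integral_norm_bound_ennreal)
  also have "\<dots> = (\<integral>\<^sup>+n. \<integral>\<^sup>+y. ennreal (norm (F n y)) \<partial>M \<partial>CS)"
    using Fubini[of "\<lambda>p. ennreal (norm (F (fst p) (snd p)))"] by simp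
  also have "\<dots> \<le> (\<integral>\<^sup>+n. ennreal (w n) \<partial>CS)" by (intro nn_integral_mono bd)
  also have "\<dots> = ennreal (LINT n|CS. w n)" using w by (simp add: nn_integral_eq_integral)
  finally show "(\<integral>\<^sup>+y. ennreal (norm (LINT n|CS. F n y)) \<partial>M) \<le> ennreal (LINT n|CS. w n)" .
qed

lemma norm_fourier_transform_le:
  assumes "integrable lborel K"
  shows "norm (fourier_transform K \<xi>) \<le> (LINT x|lborel. norm (K x))"
proof -
  have n: "norm (exp (- \<i> * complex_of_real \<xi> * complex_of_real x) * K x) = norm (K x)" for x
    by (simp add: norm_mult norm_exp_eq_Re)
  show ?thesis unfolding fourier_transform_def
    by (rule order_trans[OF integral_norm_bound]) (simp only: n order_refl)
qed

lemma integrable_CS_bounded_mult: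
  fixes a b :: "int \<Rightarrow> complex"
  assumes "integrable CS b" "\<And>n. norm (a n) \<le> C"
  shows "integrable CS (\<lambda>n. a n * b n)"
proof (rule Bochner_Integration.integrable_bound)
  show "integrable CS (\<lambda>n. C * norm (b n))" using assms(1) by simp
  have "0 \<le> C" using assms(2)[of 0] norm_ge_zero order_trans by blast
  then show "AE n in CS. norm (a n * b n) \<le> norm (C * norm (b n))"
    using assms(2) by (auto simp: norm_mult intro!: mult_right_mono)
qed auto

lemma trig_convolution:
  assumes K: "integrable lborel K" and b: "integrable CS b"
  shows "(LINT y|lborel. K y * trig L b (x - y)) = trig L (\<lambda>n. fourier_transform K (2 * pi * of_int n / L) * b n) x"
proof -
  have [measurable]: "K \<in> borel_measurable borel" using K by auto
  have "(LINT y|lborel. K y * trig L b (x - y)) = (LINT y|lborel. LINT n|CS. K y * (b n * ef L n (x - y)))"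
    by (simp add: trig_def)
  also have "\<dots> = (LINT n|CS. LINT y|lborel. K y * (b n * ef L n (x - y)))"
  proof (rule LINT_CS_swap(1)[where w="\<lambda>n. norm (b n) * (LINT x|lborel. norm (K x))"])
    show "(\<integral>\<^sup>+y. ennreal (norm (K y * (b n * ef L n (x - y)))) \<partial>lborel) \<le> ennreal (norm (b n) * (LINT x|lborel. norm (K x)))" for n
    proof -
      have "(\<integral>\<^sup>+y. ennreal (norm (K y * (b n * ef L n (x - y)))) \<partial>lborel) = (\<integral>\<^sup>+y. ennreal (norm (b n) * norm (K y)) \<partial>lborel)"
        by (simp add: norm_mult mult.commute)
      also have "\<dots> = ennreal (LINT y|lborel. norm (b n) * norm (K y))"
        by (rule nn_integral_eq_integral) (use K in auto)
      finally show ?thesis by simp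
    qed
  qed (use b in \<open>auto intro: sigma_finite_lborel\<close>)
  also have "\<dots> = (LINT n|CS. fourier_transform K (2 * pi * of_int n / L) * b n * ef L n x)"
  proof (rule Bochner_Integration.integral_cong[OF refl])
    fix n
    have "K y * (b n * ef L n (x - y)) = (exp (- \<i> * of_real (2 * pi * of_int n / L) * of_real y) * K y) * (b n * ef L n x)" for y
      using ef_add(1)[of L n x "- y"] by (simp add: ef_def[of L n "- y"] mult_ac)
    then have "(LINT y|lborel. K y * (b n * ef L n (x - y)))
        = (LINT y|lborel. (exp (- \<i> * of_real (2 * pi * of_int n / L) * of_real y) * K y) * (b n * ef L n x))"
      by (intro Bochner_Integration.integral_cong refl)
    also have "\<dots> = fourier_transform K (2 * pi * of_int n / L) * (b n * ef L n x)"
      unfolding fourier_transform_def by (rule integral_mult_left_zero)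
    finally show "(LINT y|lborel. K y * (b n * ef L n (x - y))) = fourier_transform K (2 * pi * of_int n / L) * b n * ef L n x"
      by (simp only: mult.assoc)
  qed
  finally show ?thesis by (simp add: trig_def)
qed

text \<open>The constant in \<open>\<integral>(1 - cos (l y)) / y\<^sup>2 dy = C0 \<bar>l\<bar>\<close>, that is, \<open>\<pi>\<close>.\<close>

definition C0 :: real where "C0 = (LINT y|lborel. (1 - cos y) / y\<^sup>2)"

lemma one_minus_cos_le: "1 - cos y \<le> y\<^sup>2 / 2" for y :: real
proof -
  have "1 - cos y = 2 * (sin (y / 2))\<^sup>2" using cos_double_sin[of "y / 2"] by simp
  moreover have "(sin (y / 2))\<^sup>2 \<le> (y / 2)\<^sup>2" by (rule iffD1[OF abs_le_square_iff abs_sin_x_le_abs_x])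
  ultimately show ?thesis by (simp add: power2_eq_square)
qed

lemma integrable_one_minus_cos: "integrable lborel (\<lambda>y::real. (1 - cos y) / y\<^sup>2)"
proof (rule Bochner_Integration.integrable_bound)
  show "integrable lborel (\<lambda>x::real. 4 * inverse (1 + x\<^sup>2))"
    by (intro integrable_mult_right integrable_inverse_1_plus_square_lborel)
  have "norm ((1 - cos y) / y\<^sup>2) \<le> norm (4 * inverse (1 + y\<^sup>2))" for y :: real
  proof (cases "y = 0")
    case False
    have "(1 - cos y) * y\<^sup>2 \<le> 2 * y\<^sup>2" using cos_ge_minus_one[of y] by (intro mult_right_mono) auto
    then have "(1 - cos y) * (1 + y\<^sup>2) \<le> 4 * y\<^sup>2" 
      using one_minus_cos_le[of y] zero_le_power2[of y] unfolding distrib_left mult_1_right by linarith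
    moreover have "0 < 1 + y\<^sup>2" by (simp add: add_pos_nonneg)
    ultimately have "(1 - cos y) / y\<^sup>2 \<le> 4 / (1 + y\<^sup>2)" using False by (simp add: divide_simps mult.commute)
    then show ?thesis by (simp add: divide_inverse)
  qed simp
  then show "AE y in lborel. norm ((1 - cos y) / y\<^sup>2) \<le> norm (4 * inverse (1 + (y::real)\<^sup>2))" by simp
qed simp

lemma C0_pos: "0 < C0"
proof (rule ccontr)
  assume "\<not> 0 < C0"
  moreover have "0 \<le> C0" unfolding C0_def by (intro Bochner_Integration.integral_nonneg) simp
  ultimately have "C0 = 0" by simp
  then have "(LINT y|lborel. (1 - cos y) / (y::real)\<^sup>2) = 0" by (simp add: C0_def)
  then have "AE y in lborel. (1 - cos y) / (y::real)\<^sup>2 = 0"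
    by (subst (asm) integral_nonneg_eq_0_iff_AE[OF integrable_one_minus_cos]) auto
  then have "AE y in lborel. y \<notin> {0<..<1::real}"
  proof eventually_elim
    case (elim y)
    show ?case
    proof
      assume "y \<in> {0<..<1}"
      then have "0 < y" "y < pi" using pi_gt3 by auto
      then have "cos y < cos 0" by (intro cos_monotone_0_pi) auto
      then show False using elim \<open>0 < y\<close> by simp
    qed
  qed
  then have "{0<..<1::real} \<in> null_sets lborel" by (subst AE_iff_null_sets) auto
  then show False by (simp add: null_sets_def)
qed

lemma one_minus_cos_scaled:
  "integrable lborel (\<lambda>y::real. (1 - cos (l * y)) / y\<^sup>2)" "(LINT y|lborel. (1 - cos (l * y)) / (y::real)\<^sup>2) = C0 * \<bar>l\<bar>"
proof -
  have "integrable lborel (\<lambda>y::real. (1 - cos (l * y)) / y\<^sup>2) \<and> (LINT y|lborel. (1 - cos (l * y)) / y\<^sup>2) = C0 * \<bar>l\<bar>"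
  proof (cases "l = 0")
    case False
    have e: "(1 - cos (l * y)) / y\<^sup>2 = l\<^sup>2 * ((1 - cos (0 + l * y)) / (0 + l * y)\<^sup>2)" for y
      using False by (simp add: power_mult_distrib)
    have "C0 = \<bar>l\<bar> * (LINT y|lborel. (1 - cos (0 + l * y)) / (0 + l * y)\<^sup>2)"
      unfolding C0_def using lborel_integral_real_affine[OF False, of "\<lambda>y. (1 - cos y) / y\<^sup>2" 0] by simp
    then have "C0 * \<bar>l\<bar> = (\<bar>l\<bar> * \<bar>l\<bar>) * (LINT y|lborel. (1 - cos (0 + l * y)) / (0 + l * y)\<^sup>2)"
      using arg_cong[of C0 _ "\<lambda>z. z * \<bar>l\<bar>"] by (simp only: mult_ac)
    then have "C0 * \<bar>l\<bar> = l\<^sup>2 * (LINT y|lborel. (1 - cos (0 + l * y)) / (0 + l * y)\<^sup>2)"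
      by (simp add: power2_eq_square)
    moreover have "integrable lborel (\<lambda>y. l\<^sup>2 * ((1 - cos (0 + l * y)) / (0 + l * y)\<^sup>2))"
      using lborel_integrable_real_affine[OF integrable_one_minus_cos False, of 0] by (intro integrable_mult_right)
    ultimately show ?thesis unfolding e integral_mult_right_zero by simp
  qed simp
  then show "integrable lborel (\<lambda>y::real. (1 - cos (l * y)) / y\<^sup>2)" "(LINT y|lborel. (1 - cos (l * y)) / y\<^sup>2) = C0 * \<bar>l\<bar>"
    by auto
qed

lemma of_real_abs_of_int: "complex_of_real \<bar>of_int n\<bar> = of_int \<bar>n\<bar>"
  by (metis of_int_abs of_real_of_int_eq)

lemma abs_dx_eq_trig:
  assumes "integrable CS (\<lambda>n. of_int \<bar>n\<bar> * fourier_coeff L f n)"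
  shows "abs_dx L f x = trig L (\<lambda>n. of_real (2 * pi / L) * (of_int \<bar>n\<bar> * fourier_coeff L f n)) x"
proof -
  have "integrable CS (\<lambda>n. of_real (2 * pi / L) * (of_int \<bar>n\<bar> * fourier_coeff L f n))"
    using assms by simp
  then have "integrable CS (\<lambda>n. of_real (2 * pi / L) * (of_int \<bar>n\<bar> * fourier_coeff L f n) * ef L n x)"
    by (rule Bochner_Integration.integrable_bound) (auto simp: norm_mult norm_divide)
  from integrable_CS_imp_infsum_eq[OF this] show ?thesis
    unfolding abs_dx_def trig_def ef_def by (simp add: of_real_abs_of_int mult_ac)
qed

text \<open>The operator \<open>|\<partial>\<^sub>x|\<close> as a singular integral, from \<open>\<integral>(1 - cos (l y)) / y\<^sup>2 dy = C0 |l|\<close>; the difference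
  is symmetrised in \<open>y\<close> so that the integrand is bounded at the origin.\<close>

lemma trig_singular_integral:
  assumes "0 < L" and b: "integrable CS b" and nb: "integrable CS (\<lambda>n. of_int \<bar>n\<bar> * b n)"
  shows "integrable lborel (\<lambda>y. (trig L b x - (trig L b (x + y) + trig L b (x - y)) / 2) / of_real (y\<^sup>2))" (is ?int)
    and "(LINT y|lborel. (trig L b x - (trig L b (x + y) + trig L b (x - y)) / 2) / of_real (y\<^sup>2))
      = of_real C0 * trig L (\<lambda>n. of_real (2 * pi / L) * (of_int \<bar>n\<bar> * b n)) x" (is ?eq)
    and "(\<integral>\<^sup>+y. ennreal (norm ((trig L b x - (trig L b (x + y) + trig L b (x - y)) / 2) / of_real (y\<^sup>2))) \<partial>lborel)
      \<le> ennreal (LINT n|CS. C0 * (2 * pi / L) * norm (of_int \<bar>n\<bar> * b n))" (is ?bd)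
proof -
  have be: "integrable CS (\<lambda>n. b n * ef L n z)" for z
    by (rule Bochner_Integration.integrable_bound[OF b]) (auto simp: norm_mult)
  let ?l = "\<lambda>n::int. 2 * pi * of_int n / L"
  let ?F = "\<lambda>n y. of_real ((1 - cos (?l n * y)) / y\<^sup>2) * (b n * ef L n x)"
  have t: "(trig L b x - (trig L b (x + y) + trig L b (x - y)) / 2) / of_real (y\<^sup>2) = (LINT n|CS. ?F n y)" for y
  proof -
    have "(trig L b x - (trig L b (x + y) + trig L b (x - y)) / 2) =
        (LINT n|CS. b n * ef L n x - (b n * ef L n (x + y) + b n * ef L n (x - y)) / 2)"
      using be by (simp add: trig_def)
    also have "\<dots> = (LINT n|CS. of_real (1 - cos (?l n * y)) * (b n * ef L n x))"
    proof (rule Bochner_Integration.integral_cong[OF refl])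
      fix n
      have "ef L n y + ef L n (- y) = 2 * of_real (cos (?l n * y))"
        by (simp add: ef_eq_cis complex_eq_iff)
      then have "ef L n (x + y) + ef L n (x - y) = 2 * of_real (cos (?l n * y)) * ef L n x"
        using ef_add(1)[of L n x y] ef_add(1)[of L n x "- y"] by (simp flip: distrib_left)
      then have "b n * ef L n (x + y) + b n * ef L n (x - y) = 2 * of_real (cos (?l n * y)) * (b n * ef L n x)"
        by (simp flip: distrib_left)
      then show "b n * ef L n x - (b n * ef L n (x + y) + b n * ef L n (x - y)) / 2 = of_real (1 - cos (?l n * y)) * (b n * ef L n x)"
        by (simp add: algebra_simps)
    qed
    also have "\<dots> / of_real (y\<^sup>2) = (LINT n|CS. of_real (1 - cos (?l n * y)) * (b n * ef L n x) / of_real (y\<^sup>2))"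
      by simp
    finally show ?thesis by (simp add: field_simps)
  qed
  have sw: "(\<integral>\<^sup>+y. ennreal (norm (?F n y)) \<partial>lborel) \<le> ennreal (C0 * (2 * pi / L) * norm (of_int \<bar>n\<bar> * b n))" for n
  proof -
    have "(\<integral>\<^sup>+y. ennreal (norm (?F n y)) \<partial>lborel) = (\<integral>\<^sup>+y. ennreal ((1 - cos (?l n * y)) / y\<^sup>2 * norm (b n)) \<partial>lborel)"
      by (intro nn_integral_cong) (simp add: norm_mult norm_divide abs_mult del: of_real_divide of_real_diff)
    also have "\<dots> = ennreal (LINT y|lborel. (1 - cos (?l n * y)) / y\<^sup>2 * norm (b n))"
      by (intro nn_integral_eq_integral integrable_mult_left one_minus_cos_scaled) auto
    also have "\<dots> = ennreal (C0 * \<bar>?l n\<bar> * norm (b n))"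
      by (simp only: integral_mult_left_zero one_minus_cos_scaled(2))
    finally show ?thesis using \<open>0 < L\<close> by (simp add: abs_mult norm_mult mult_ac)
  qed
  have w: "integrable CS (\<lambda>n. C0 * (2 * pi / L) * norm (of_int \<bar>n\<bar> * b n))"
    using nb by (intro integrable_mult_right integrable_norm)
  have m: "?F n \<in> borel_measurable lborel" for n by measurable
  have pos: "0 \<le> C0 * (2 * pi / L) * norm (of_int \<bar>n\<bar> * b n)" for n using C0_pos \<open>0 < L\<close> by simp
  show ?int unfolding t by (rule LINT_CS_swap(2)[OF sigma_finite_lborel m sw w pos])
  show ?bd unfolding t by (rule LINT_CS_swap(3)[OF sigma_finite_lborel m sw w pos])
  have "(LINT y|lborel. LINT n|CS. ?F n y) = (LINT n|CS. LINT y|lborel. ?F n y)"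
    by (rule LINT_CS_swap(1)[OF sigma_finite_lborel m sw w pos])
  also have "\<dots> = (LINT n|CS. of_real C0 * (of_real (2 * pi / L) * (of_int \<bar>n\<bar> * b n) * ef L n x))"
  proof (rule Bochner_Integration.integral_cong[OF refl])
    fix n
    have "(LINT y|lborel. ?F n y) = of_real (LINT y|lborel. (1 - cos (?l n * y)) / y\<^sup>2) * (b n * ef L n x)"
      by (simp only: integral_mult_left_zero integral_complex_of_real)
    also have "\<dots> = of_real (C0 * (2 * pi / L) * of_int \<bar>n\<bar>) * (b n * ef L n x)"
      using \<open>0 < L\<close> by (simp only: one_minus_cos_scaled(2)) (simp add: abs_mult)
    finally show "(LINT y|lborel. ?F n y) = of_real C0 * (of_real (2 * pi / L) * (of_int \<bar>n\<bar> * b n) * ef L n x)"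
      by (simp add: of_real_abs_of_int mult_ac)
  qed
  finally have "(LINT y|lborel. LINT n|CS. ?F n y)
      = of_real C0 * trig L (\<lambda>n. of_real (2 * pi / L) * (of_int \<bar>n\<bar> * b n)) x"
    unfolding trig_def integral_mult_right_zero .
  then show ?eq unfolding t .
qed

section \<open>Littlewood-Paley pieces\<close>

text \<open>The functions that lie, with one derivative, in the Wiener algebra of absolutely convergent Fourier series.\<close>

definition wiener :: "real \<Rightarrow> (real \<Rightarrow> real) \<Rightarrow> bool" where
  "wiener L f \<longleftrightarrow> integrable CS (fourier_coeff L f) \<and> integrable CS (\<lambda>n. of_int \<bar>n\<bar> * fourier_coeff L f n)
     \<and> (\<forall>x. of_real (f x) = trig L (fourier_coeff L f) x) \<and> continuous_on UNIV f"

lemma norm_trig_le: "integrable CS b \<Longrightarrow> norm (trig L b x) \<le> (LINT n|CS. norm (b n))"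
  unfolding trig_def by (rule order_trans[OF integral_norm_bound]) (simp add: norm_mult)

lemma measurable_trig [measurable]: "trig L b \<in> borel_measurable borel"
proof -
  interpret sigma_finite_measure CS by (rule sigma_finite_CS)
  have "(\<lambda>p. b (fst p) * ef L (fst p) (snd p)) \<in> borel_measurable (CS \<Otimes>\<^sub>M borel)"
    by (rule measurable_pair_measure_countable1) auto
  from measurable_compose[OF measurable_pair_swap' this]
  have "(\<lambda>(x, n). b n * ef L n x) \<in> borel_measurable (borel \<Otimes>\<^sub>M CS)"
    by (simp add: case_prod_beta')
  then show ?thesis unfolding trig_def[abs_def] by (rule borel_measurable_lebesgue_integral)
qed

lemma trig_period: "L \<noteq> 0 \<Longrightarrow> trig L b (x + L) = trig L b x"
  by (simp add: trig_def ef_period)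

lemma integrable_kernel_mult_trig:
  assumes "integrable lborel K" "integrable CS b"
  shows "integrable lborel (\<lambda>y. K y * trig L b (x - y))"
proof (rule Bochner_Integration.integrable_bound)
  show "integrable lborel (\<lambda>y. (LINT n|CS. norm (b n)) * norm (K y))" using assms(1) by simp
  have [measurable]: "K \<in> borel_measurable borel" using assms(1) by auto
  show "(\<lambda>y. K y * trig L b (x - y)) \<in> borel_measurable lborel" by measurable
  have "norm (K y * trig L b (x - y)) \<le> norm ((LINT n|CS. norm (b n)) * norm (K y))" for y
  proof -
    have "norm (trig L b (x - y)) * norm (K y) \<le> (LINT n|CS. norm (b n)) * norm (K y)"
      using norm_trig_le[OF assms(2)] by (rule mult_right_mono) simp
    then show ?thesis by (simp add: norm_mult mult.commute)
  qed
  then show "AE y in lborel. norm (K y * trig L b (x - y)) \<le> norm ((LINT n|CS. norm (b n)) * norm (K y))" by simp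
qed

locale LP_family =
  fixes \<phi> :: "int \<Rightarrow> real \<Rightarrow> complex"
  assumes LP: "littlewood_paley \<phi>"
begin

text \<open>The Littlewood-Paley multipliers. The kernels enter the analysis of periodic functions only through them.\<close>

definition m :: "int \<Rightarrow> real \<Rightarrow> complex" where
  "m k \<xi> = fourier_transform (\<phi> 0) (2 powi (- k) * \<xi>)"

lemma fourier_transform_family: "fourier_transform (\<phi> k) \<xi> = m k \<xi>"
  using LP unfolding littlewood_paley_def m_def by blast

lemma fourier_transform_dilated: "fourier_transform (dilate (\<phi> 0) k) \<xi> = m k \<xi>"
  by (simp add: fourier_transform_dilate m_def)

lemma integrable_family: "integrable lborel (\<phi> k)"
  using LP schwartz_facts[of "\<phi> k"] unfolding littlewood_paley_def by metis

lemma measurable_family [measurable]: "\<phi> k \<in> borel_measurable borel"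
  using integrable_family[of k] by auto

lemma norm_m_le: "norm (m k \<xi>) \<le> (LINT x|lborel. norm (\<phi> 0 x))"
  unfolding m_def by (rule norm_fourier_transform_le[OF integrable_family])

lemma m_support:
  assumes "m k \<xi> \<noteq> 0"
  shows "2 powi (k - 1) < \<bar>\<xi>\<bar>" "\<bar>\<xi>\<bar> < 2 powi (k + 1)"
proof -
  have "\<bar>2 powi (- k) * \<xi>\<bar> \<in> {1/2<..<2}"
    using LP assms unfolding littlewood_paley_def m_def by blast
  then have "1 / 2 < 2 powi (- k) * \<bar>\<xi>\<bar>" "2 powi (- k) * \<bar>\<xi>\<bar> < 2" by (simp_all add: abs_mult)
  then show "2 powi (k - 1) < \<bar>\<xi>\<bar>" "\<bar>\<xi>\<bar> < 2 powi (k + 1)"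
    by (simp_all add: power_int_minus power_int_diff power_int_add field_simps)
qed

lemma m_zero [simp]: "m k 0 = 0"
  using m_support(1)[of k 0] by (metis abs_zero not_less_iff_gr_or_eq zero_less_power_int zero_less_numeral)

text \<open>The annulus \<open>2 powi (k - 1) < \<bar>\<xi>\<bar> < 2 powi (k + 1)\<close> meets only the two adjacent ones.\<close>

lemma m_neighbours:
  assumes "m j \<xi> \<noteq> 0" "m k \<xi> \<noteq> 0"
  shows "k \<in> {j - 1..j + 1}"
proof -
  have "(2::real) powi (j - 1) < 2 powi (k + 1)" "(2::real) powi (k - 1) < 2 powi (j + 1)"
    using m_support[OF assms(1)] m_support[OF assms(2)] by linarith+
  then have "\<not> k + 1 \<le> j - 1" "\<not> j + 1 \<le> k - 1"
    using power_int_increasing[of "k + 1" "j - 1" "2::real"] power_int_increasing[of "j + 1" "k - 1" "2::real"]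
    by linarith+
  then show ?thesis by auto
qed

lemma has_sum_m: "\<xi> \<noteq> 0 \<Longrightarrow> ((\<lambda>k. m k \<xi>) has_sum 1) UNIV"
  using LP fourier_transform_family unfolding littlewood_paley_def by simp

lemma sum_m:
  assumes "m j \<xi> \<noteq> 0"
  shows "(\<Sum>i\<in>{j - 1..j + 1}. m i \<xi>) = 1"
proof -
  have "\<xi> \<noteq> 0" using assms by auto
  have "((\<lambda>k. m k \<xi>) has_sum 1) {j - 1..j + 1}"
    using has_sum_m[OF \<open>\<xi> \<noteq> 0\<close>] m_neighbours[OF assms]
    by (subst has_sum_cong_neutral[of "UNIV" "{j - 1..j + 1}" _ "\<lambda>k. m k \<xi>"]) auto
  then show ?thesis by (simp add: has_sum_finite_iff)
qed

lemma nn_integral_m_le: "(\<integral>\<^sup>+k. ennreal (norm (m k \<xi>)) \<partial>CS) \<le> ennreal (3 * (LINT x|lborel. norm (\<phi> 0 x)))"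
proof (cases "\<exists>j. m j \<xi> \<noteq> 0")
  case True
  then obtain j where j: "m j \<xi> \<noteq> 0" by blast
  have "(\<integral>\<^sup>+k. ennreal (norm (m k \<xi>)) \<partial>CS) = (\<Sum>k\<in>{j - 1..j + 1}. ennreal (norm (m k \<xi>)))"
    by (rule nn_integral_count_space') (use m_neighbours[OF j] in auto)
  also have "\<dots> \<le> (\<Sum>k\<in>{j - 1..j + 1}. ennreal (LINT x|lborel. norm (\<phi> 0 x)))"
    by (intro sum_mono ennreal_leI norm_m_le)
  finally show ?thesis by (simp add: ennreal_mult)
qed simp

text \<open>The sum of a kernel and its two neighbours has multiplier \<open>1\<close> on the support of the multiplier \<open>m j\<close>, so
convolution with it reproduces the \<open>j\<close>-th piece. Increments of a piece can thus be put on a smooth kernel.\<close>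

definition reproducing_kernel :: "int \<Rightarrow> real \<Rightarrow> complex" where
  "reproducing_kernel j y = (\<Sum>i\<in>{j - 1..j + 1}. dilate (\<phi> 0) i y)"

lemma integrable_reproducing_kernel: "integrable lborel (reproducing_kernel j)"
  unfolding reproducing_kernel_def[abs_def]
  by (intro Bochner_Integration.integrable_sum integrable_dilate integrable_family)

lemma measurable_reproducing_kernel [measurable]: "reproducing_kernel j \<in> borel_measurable borel"
  using integrable_reproducing_kernel[of j] by auto

lemma fourier_transform_reproducing_kernel:
  "fourier_transform (reproducing_kernel j) \<xi> = (\<Sum>i\<in>{j - 1..j + 1}. m i \<xi>)"
proof -
  have i: "integrable lborel (\<lambda>x. exp (- \<i> * of_real \<xi> * of_real x) * dilate (\<phi> 0) i x)" for i
    by (rule Bochner_Integration.integrable_bound[OF integrable_dilate[OF integrable_family[of 0], of i]])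
       (auto simp: norm_mult norm_exp_eq_Re)
  have "fourier_transform (reproducing_kernel j) \<xi> = (\<Sum>i\<in>{j - 1..j + 1}. fourier_transform (dilate (\<phi> 0) i) \<xi>)"
    unfolding fourier_transform_def reproducing_kernel_def sum_distrib_left
    by (rule Bochner_Integration.integral_sum) (rule i)
  then show ?thesis by (simp add: fourier_transform_dilated)
qed

text \<open>A Bernstein inequality in integrated form: an increment of an \<open>L\<^sup>1\<close> kernel is bounded by twice its norm, and
by \<open>\<bar>h\<bar>\<close> times the norm of the derivative, which dilation to scale \<open>j\<close> multiplies by \<open>2 powi j\<close>.\<close>

lemma reproducing_kernel_increments:
  obtains \<kappa> where "0 < \<kappa>" "\<And>j h. (\<integral>\<^sup>+z. ennreal (norm (reproducing_kernel j (z + h) - reproducing_kernel j z)) \<partial>lborel)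
    \<le> ennreal (\<kappa> * min 1 (2 powi j * \<bar>h\<bar>))"
proof -
  have "schwartz (\<phi> 0)" using LP unfolding littlewood_paley_def by blast
  then obtain f' where f': "\<And>x. (\<phi> 0 has_vector_derivative f' x) (at x)" "continuous_on UNIV f'" "integrable lborel f'"
    by (rule schwartz_facts) blast
  define A where "A = (LINT x|lborel. norm (\<phi> 0 x))"
  define B where "B = (LINT x|lborel. norm (f' x))"
  have AB: "0 \<le> A" "0 \<le> B" by (auto simp: A_def B_def)
  have A: "(\<integral>\<^sup>+x. ennreal (norm (\<phi> 0 x)) \<partial>lborel) = ennreal A"
    unfolding A_def using integrable_family[of 0] by (intro nn_integral_eq_integral) auto
  have B: "(\<integral>\<^sup>+x. ennreal (norm (f' x)) \<partial>lborel) = ennreal B"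
    unfolding B_def using f'(3) by (intro nn_integral_eq_integral) auto
  \<comment> \<open>Three dilates, each with the bound \<open>2 (A + B + 1) min 1 (2 powi j \<bar>h\<bar>)\<close>; the \<open>2\<close> covers both the triangle inequality and \<open>i = j + 1\<close>.\<close>
  define \<kappa> where "\<kappa> = 6 * (A + B + 1)"
  have one: "(\<integral>\<^sup>+z. ennreal (norm (dilate (\<phi> 0) i (z + h) - dilate (\<phi> 0) i z)) \<partial>lborel) \<le> ennreal (2 * (A + B + 1) * min 1 (2 powi j * \<bar>h\<bar>))"
    if "i \<in> {j - 1..j + 1}" for i j h
  proof -
    have 1: "(\<integral>\<^sup>+z. ennreal (norm (\<phi> 0 (z + l) - \<phi> 0 z)) \<partial>lborel) \<le> ennreal (2 * A)" for l
    proof -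
      have "(\<integral>\<^sup>+z. ennreal (norm (\<phi> 0 (z + l) - \<phi> 0 z)) \<partial>lborel) \<le> (\<integral>\<^sup>+z. ennreal (norm (\<phi> 0 (z + l))) + ennreal (norm (\<phi> 0 z)) \<partial>lborel)"
        by (intro nn_integral_mono) (simp add: ennreal_plus[symmetric] ennreal_leI norm_triangle_ineq4 del: ennreal_plus)
      also have "\<dots> = ennreal (2 * A)"
        using nn_integral_lborel_shift[of "\<lambda>z. ennreal (norm (\<phi> 0 z))" l] A AB
        by (subst nn_integral_add) (auto simp: ennreal_plus[symmetric] simp del: ennreal_plus)
      finally show ?thesis .
    qed
    have 2: "(\<integral>\<^sup>+z. ennreal (norm (\<phi> 0 (z + l) - \<phi> 0 z)) \<partial>lborel) \<le> ennreal (\<bar>l\<bar> * B)" for l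
      using L1_norm_increment_le[OF f'(1,2), of l] AB by (simp add: B ennreal_mult)
    have "2 powi i \<le> (2::real) powi (j + 1)" using that by (intro power_int_increasing) auto
    then have 3: "2 powi i * \<bar>h\<bar> \<le> 2 * (2 powi j * \<bar>h\<bar>)" 
      using mult_right_mono[of "2 powi i" "2 powi (j + 1)" "\<bar>h\<bar>"] by (simp add: power_int_add mult_ac)
    have "\<bar>2 powi i * h\<bar> * B \<le> 2 * (2 powi j * \<bar>h\<bar>) * (A + B + 1)"
      using AB 3 by (intro mult_mono) (auto simp: abs_mult)
    then have "min (2 * A) (\<bar>2 powi i * h\<bar> * B) \<le> 2 * (A + B + 1) * min 1 (2 powi j * \<bar>h\<bar>)"
      using AB by (auto simp: min_def algebra_simps)
    moreover have "(\<integral>\<^sup>+z. ennreal (norm (dilate (\<phi> 0) i (z + h) - dilate (\<phi> 0) i z)) \<partial>lborel) \<le> ennreal (min (2 * A) (\<bar>2 powi i * h\<bar> * B))"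
      using 1[of "2 powi i * h"] 2[of "2 powi i * h"] unfolding nn_integral_dilate_increment[OF measurable_family]
      by (auto simp: min_def)
    ultimately show ?thesis using ennreal_leI order_trans by blast
  qed
  have "(\<integral>\<^sup>+z. ennreal (norm (reproducing_kernel j (z + h) - reproducing_kernel j z)) \<partial>lborel)
    \<le> ennreal (\<kappa> * min 1 (2 powi j * \<bar>h\<bar>))" for j h
  proof -
    have "(\<integral>\<^sup>+z. ennreal (norm (reproducing_kernel j (z + h) - reproducing_kernel j z)) \<partial>lborel)
      \<le> (\<integral>\<^sup>+z. (\<Sum>i\<in>{j - 1..j + 1}. ennreal (norm (dilate (\<phi> 0) i (z + h) - dilate (\<phi> 0) i z))) \<partial>lborel)"
      by (intro nn_integral_mono)
         (simp only: reproducing_kernel_def sum_subtractf[symmetric] sum_ennreal norm_ge_zero ennreal_leI norm_sum)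
    also have "\<dots> = (\<Sum>i\<in>{j - 1..j + 1}. (\<integral>\<^sup>+z. ennreal (norm (dilate (\<phi> 0) i (z + h) - dilate (\<phi> 0) i z)) \<partial>lborel))"
      by (rule nn_integral_sum) measurable
    also have "\<dots> \<le> (\<Sum>i\<in>{j - 1..j + 1}. ennreal (2 * (A + B + 1) * min 1 (2 powi j * \<bar>h\<bar>)))"
      by (intro sum_mono one)
    also have "\<dots> = ennreal (\<Sum>i\<in>{j - 1..j + 1}. 2 * (A + B + 1) * min 1 (2 powi j * \<bar>h\<bar>))"
      using AB by (intro sum_ennreal) auto
    also have "(\<Sum>i\<in>{j - 1..j + 1}. 2 * (A + B + 1) * min 1 (2 powi j * \<bar>h\<bar>)) = \<kappa> * min 1 (2 powi j * \<bar>h\<bar>)"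
      by (simp add: \<kappa>_def)
    finally show ?thesis .
  qed
  moreover have "0 < \<kappa>" using AB by (simp add: \<kappa>_def)
  ultimately show thesis using that by blast
qed

lemma lp_piece_eq_trig:
  assumes "wiener L (u t)"
  shows "lp_piece \<phi> k u t x = trig L (\<lambda>n. m k (2 * pi * of_int n / L) * fourier_coeff L (u t) n) x"
    and "lp_piece \<phi> k u t x = (LINT y|lborel. dilate (\<phi> 0) k y * of_real (u t (x - y)))"
    and "integrable CS (\<lambda>n. m k (2 * pi * of_int n / L) * fourier_coeff L (u t) n)"
  using assms trig_convolution[OF integrable_family, of "fourier_coeff L (u t)" k L x]
    trig_convolution[OF integrable_dilate[OF integrable_family[of 0], of k], of "fourier_coeff L (u t)" L x]
  by (auto simp: wiener_def lp_piece_def fourier_transform_family fourier_transform_dilated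
      intro: integrable_CS_bounded_mult norm_m_le)

lemma norm_lp_piece_increment_le:
  assumes "wiener L (u t)"
  shows "ennreal (norm (lp_piece \<phi> j u t (x + h) - lp_piece \<phi> j u t x))
    \<le> (\<integral>\<^sup>+z. ennreal (norm (reproducing_kernel j (z + h) - reproducing_kernel j z)) * ennreal (norm (lp_piece \<phi> j u t (x - z))) \<partial>lborel)"
proof -
  define b where "b n = m j (2 * pi * of_int n / L) * fourier_coeff L (u t) n" for n
  have u: "lp_piece \<phi> j u t x = trig L b x" for x unfolding b_def by (rule lp_piece_eq_trig(1)[where u=u and t=t, OF assms])
  have b: "integrable CS b" unfolding b_def by (rule lp_piece_eq_trig(3)[where u=u and t=t, OF assms])
  let ?K = "reproducing_kernel j"
  have rep: "trig L b x = (LINT z|lborel. ?K z * trig L b (x - z))" for x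
  proof -
    have "(\<lambda>n. fourier_transform ?K (2 * pi * of_int n / L) * b n) = b"
    proof
      fix n
      show "fourier_transform ?K (2 * pi * of_int n / L) * b n = b n"
      using sum_m[of j "2 * pi * of_int n / L"]
      by (cases "m j (2 * pi * of_int n / L) = 0") (auto simp: b_def fourier_transform_reproducing_kernel)
    qed
    then show ?thesis by (simp only: trig_convolution[OF integrable_reproducing_kernel b])
  qed
  have K': "integrable lborel (\<lambda>z. ?K (z + h))"
    using lborel_integrable_real_affine[OF integrable_reproducing_kernel, of 1 j h] by (simp add: add.commute)
  have "(LINT z|lborel. ?K z * trig L b (x + h - z)) = (LINT z|lborel. ?K (z + h) * trig L b (x - z))"
    using lborel_integral_real_affine[of 1 "\<lambda>z. ?K z * trig L b (x + h - z)" h] by (simp add: add.commute)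
  then have "trig L b (x + h) - trig L b x = (LINT z|lborel. ?K (z + h) * trig L b (x - z)) - (LINT z|lborel. ?K z * trig L b (x - z))"
    using rep[of "x + h"] rep[of x] by simp
  also have "\<dots> = (LINT z|lborel. ?K (z + h) * trig L b (x - z) - ?K z * trig L b (x - z))"
    by (intro Bochner_Integration.integral_diff[symmetric] integrable_kernel_mult_trig K' integrable_reproducing_kernel b)
  finally have "trig L b (x + h) - trig L b x = (LINT z|lborel. ?K (z + h) * trig L b (x - z) - ?K z * trig L b (x - z))" .
  moreover have "integrable lborel (\<lambda>z. ?K (z + h) * trig L b (x - z) - ?K z * trig L b (x - z))"
    by (intro Bochner_Integration.integrable_diff integrable_kernel_mult_trig K' integrable_reproducing_kernel b)
  ultimately have "ennreal (norm (trig L b (x + h) - trig L b x)) \<le> (\<integral>\<^sup>+z. norm (?K (z + h) * trig L b (x - z) - ?K z * trig L b (x - z)) \<partial>lborel)"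
    by (simp only: integral_norm_bound_ennreal)
  also have "\<dots> = (\<integral>\<^sup>+z. ennreal (norm (?K (z + h) - ?K z)) * ennreal (norm (trig L b (x - z))) \<partial>lborel)"
    by (simp add: left_diff_distrib[symmetric] norm_mult ennreal_mult)
  finally show ?thesis by (simp add: u)
qed

text \<open>Summing the pieces recovers \<open>u\<close> up to its mean, because the multipliers sum to \<open>1\<close> at every nonzero
frequency and vanish at zero. The mean cancels in increments.\<close>

lemma increment_le_sum_pieces:
  assumes "wiener L (u t)"
  shows "ennreal \<bar>u t (x + y) - u t x\<bar> \<le> (\<integral>\<^sup>+k. ennreal (norm (lp_piece \<phi> k u t (x + y) - lp_piece \<phi> k u t x)) \<partial>CS)"
proof -
  define b where "b = fourier_coeff L (u t)"
  have b: "integrable CS b" and u: "\<And>x. of_real (u t x) = trig L b x"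
    using assms by (auto simp: wiener_def b_def)
  let ?l = "\<lambda>n::int. 2 * pi * of_int n / L"
  have bL: "integrable CS (\<lambda>n. b n * ef L n x)" for x
    by (rule Bochner_Integration.integrable_bound[OF b]) (auto simp: norm_mult)
  define C where "C = 3 * (LINT x|lborel. norm (\<phi> 0 x))"
  have C: "0 \<le> C" by (simp add: C_def)
  have piece: "lp_piece \<phi> k u t x = (LINT n|CS. m k (?l n) * (b n * ef L n x))" for k x
    unfolding lp_piece_eq_trig(1)[where u=u and t=t, OF assms] trig_def b_def by (simp add: mult.assoc)
  have sw: "(\<integral>\<^sup>+k. ennreal (norm (m k (?l n) * (b n * ef L n x))) \<partial>CS) \<le> ennreal (C * norm (b n))" for n x
  proof -
    have "(\<integral>\<^sup>+k. ennreal (norm (m k (?l n) * (b n * ef L n x))) \<partial>CS) = (\<integral>\<^sup>+k. ennreal (norm (m k (?l n))) * ennreal (norm (b n)) \<partial>CS)"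
      by (simp add: norm_mult ennreal_mult)
    also have "\<dots> \<le> ennreal C * ennreal (norm (b n))"
      using nn_integral_m_le[of "?l n"] by (subst nn_integral_multc) (auto simp: C_def intro: mult_right_mono)
    finally show ?thesis using C by (simp add: ennreal_mult)
  qed
  have w: "integrable CS (\<lambda>n. C * norm (b n))" "0 \<le> C * norm (b n)" for n using b C by auto
  have i: "integrable CS (\<lambda>k. lp_piece \<phi> k u t x)" for x
    unfolding piece by (rule LINT_CS_swap(2)[OF sigma_finite_CS _ sw w]) simp
  have sumk: "(LINT k|CS. m k \<xi>) = (if \<xi> = 0 then 0 else 1)" for \<xi>
  proof (cases "\<xi> = 0")
    case False
    have "integrable CS (\<lambda>k. m k \<xi>)"
      using le_less_trans[OF nn_integral_m_le[of \<xi>] ennreal_less_top] by (intro integrableI_bounded) auto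
    then show ?thesis using infsumI[OF has_sum_m[OF False]] False integrable_CS_imp_infsum_eq by simp
  qed simp
  have total: "(LINT k|CS. lp_piece \<phi> k u t x) = (LINT n|CS. (if ?l n = 0 then 0 else 1) * (b n * ef L n x))" for x
  proof -
    have "(LINT k|CS. lp_piece \<phi> k u t x) = (LINT n|CS. LINT k|CS. m k (?l n) * (b n * ef L n x))"
      unfolding piece by (rule LINT_CS_swap(1)[OF sigma_finite_CS _ sw w]) simp
    then show ?thesis by (simp only: integral_mult_left_zero sumk)
  qed
  have i0: "integrable CS (\<lambda>n. (if ?l n = 0 then 0 else 1) * (b n * ef L n x))" for x
    by (rule Bochner_Integration.integrable_bound[OF b]) (auto simp: norm_mult)
  have "complex_of_real (u t (x + y) - u t x) = (LINT n|CS. b n * ef L n (x + y) - b n * ef L n x)"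
    using bL by (simp add: u trig_def)
  also have "\<dots> = (LINT n|CS. (if ?l n = 0 then 0 else 1) * (b n * ef L n (x + y)) - (if ?l n = 0 then 0 else 1) * (b n * ef L n x))"
  proof (rule Bochner_Integration.integral_cong[OF refl])
    fix n
    show "b n * ef L n (x + y) - b n * ef L n x = (if ?l n = 0 then 0 else 1) * (b n * ef L n (x + y)) - (if ?l n = 0 then 0 else 1) * (b n * ef L n x)"
      by (cases "?l n = 0") (auto simp: ef_eq_cis)
  qed
  also have "\<dots> = (LINT k|CS. lp_piece \<phi> k u t (x + y) - lp_piece \<phi> k u t x)"
    using i i0 by (simp only: Bochner_Integration.integral_diff total)
  finally have eq: "complex_of_real (u t (x + y) - u t x) = (LINT k|CS. lp_piece \<phi> k u t (x + y) - lp_piece \<phi> k u t x)" .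
  have "integrable CS (\<lambda>k. lp_piece \<phi> k u t (x + y) - lp_piece \<phi> k u t x)"
    by (intro Bochner_Integration.integrable_diff i)
  from integral_norm_bound_ennreal[OF this]
  show ?thesis unfolding eq[symmetric] norm_of_real .
qed

text \<open>The kernel has mean zero, as its multiplier vanishes at frequency zero; so \<open>u t x\<close> may be subtracted
under the convolution.\<close>

lemma norm_lp_piece_le:
  assumes "wiener L (u t)"
  shows "ennreal (norm (lp_piece \<phi> k u t x)) \<le> (\<integral>\<^sup>+y. ennreal (norm (dilate (\<phi> 0) k y)) * ennreal \<bar>u t (x - y) - u t x\<bar> \<partial>lborel)"
proof -
  let ?K = "dilate (\<phi> 0) k"
  have K: "integrable lborel ?K" by (intro integrable_dilate integrable_family)
  have b: "integrable CS (fourier_coeff L (u t))" and u: "\<And>x. of_real (u t x) = trig L (fourier_coeff L (u t)) x"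
    using assms by (auto simp: wiener_def)
  have i: "integrable lborel (\<lambda>y. ?K y * of_real (u t (x - y)))"
    unfolding u by (rule integrable_kernel_mult_trig[OF K b])
  have i2: "integrable lborel (\<lambda>y. ?K y * of_real (u t x))" using K by simp
  have "(LINT y|lborel. ?K y) = 0"
    using fourier_transform_dilated[of k 0] by (simp add: fourier_transform_def)
  then have "lp_piece \<phi> k u t x = (LINT y|lborel. ?K y * of_real (u t (x - y))) - (LINT y|lborel. ?K y * of_real (u t x))"
    by (simp add: lp_piece_eq_trig(2)[where u=u and t=t, OF assms])
  also have "\<dots> = (LINT y|lborel. ?K y * of_real (u t (x - y)) - ?K y * of_real (u t x))"
    using i i2 by simp
  finally have "ennreal (norm (lp_piece \<phi> k u t x)) \<le> (\<integral>\<^sup>+y. norm (?K y * of_real (u t (x - y)) - ?K y * of_real (u t x)) \<partial>lborel)"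
    using i i2 by (simp only: integral_norm_bound_ennreal Bochner_Integration.integrable_diff)
  also have "\<dots> = (\<integral>\<^sup>+y. ennreal (norm (?K y)) * ennreal \<bar>u t (x - y) - u t x\<bar> \<partial>lborel)"
    by (simp add: right_diff_distrib[symmetric] norm_mult ennreal_mult of_real_diff[symmetric] del: of_real_diff)
  finally show ?thesis .
qed

end

section \<open>The dyadic kernel of the bilinear form\<close>

lemma nn_integral_powr_has_integral:
  assumes "((\<lambda>x. x powr a) has_integral I) S" "S \<in> sets borel"
  shows "(\<integral>\<^sup>+x. ennreal (x powr a) * indicator S x \<partial>lborel) = ennreal I"
proof -
  have "(\<integral>\<^sup>+x. ennreal (if x \<in> S then x powr a else 0) \<partial>lborel) = ennreal I"
    by (rule nn_integral_has_integral_lborel)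
       (use assms in \<open>auto simp: has_integral_restrict_UNIV\<close>)
  then show ?thesis by (subst (asm) nn_integral_cong) (auto split: split_indicator)
qed

text \<open>Finite for \<open>0 < \<theta> < 1\<close>, since the integrand is \<open>\<bar>z\<bar> powr (\<theta> - 1)\<close> near the origin and \<open>\<bar>z\<bar> powr (\<theta> - 2)\<close> at
infinity.\<close>

definition kernel_moment :: "real \<Rightarrow> ennreal" where
  "kernel_moment \<theta> = (\<integral>\<^sup>+z. ennreal (\<bar>z\<bar> powr (\<theta> - 2) * min 1 \<bar>z\<bar>) \<partial>lborel)"

lemma kernel_moment_finite:
  assumes "0 < \<theta>" "\<theta> < 1"
  shows "kernel_moment \<theta> < \<infinity>"
proof -
  define g where "g z = ennreal (z powr (\<theta> - 2) * min 1 z) * indicator {0..} z" for z :: real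
  have [measurable]: "g \<in> borel_measurable borel" unfolding g_def[abs_def] by measurable
  have "(\<integral>\<^sup>+z. g z \<partial>lborel) \<le> (\<integral>\<^sup>+z. ennreal (z powr (\<theta> - 1)) * indicator {0..1} z + ennreal (z powr (\<theta> - 2)) * indicator {1..} z \<partial>lborel)"
  proof (rule nn_integral_mono)
    fix z :: real
    show "g z \<le> ennreal (z powr (\<theta> - 1)) * indicator {0..1} z + ennreal (z powr (\<theta> - 2)) * indicator {1..} z"
    proof (cases "0 < z")
      case True
      have "z powr (\<theta> - 2) * z = z powr (\<theta> - 1)"
        using True powr_add[of z "\<theta> - 2" 1] by simp
      then show ?thesis using True by (auto simp: g_def min_def split: split_indicator)
    qed (auto simp: g_def split: split_indicator)
  qed
  also have "\<dots> = ennreal (1 powr (\<theta> - 1 + 1) / (\<theta> - 1 + 1)) + ennreal (- (1 powr (\<theta> - 2 + 1)) / (\<theta> - 2 + 1))"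
    using assms nn_integral_powr_has_integral[OF has_integral_powr_from_0[of "\<theta> - 1" 1]]
      nn_integral_powr_has_integral[OF has_integral_powr_to_inf[of "\<theta> - 2" 1]]
    by (subst nn_integral_add) auto
  also have "\<dots> < \<infinity>" by simp
  finally have g: "(\<integral>\<^sup>+z. g z \<partial>lborel) < \<infinity>" .
  have "kernel_moment \<theta> \<le> (\<integral>\<^sup>+z. g z + g (- z) \<partial>lborel)"
    unfolding kernel_moment_def by (intro nn_integral_mono) (auto simp: g_def split: split_indicator)
  also have "\<dots> = (\<integral>\<^sup>+z. g z \<partial>lborel) + (\<integral>\<^sup>+z. g z \<partial>lborel)"
    using nn_integral_real_affine[of g "-1" 0] by (subst nn_integral_add) auto
  also have "\<dots> < \<infinity>" using g by (simp add: ennreal_add_eq_top less_top)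
  finally show ?thesis .
qed

text \<open>Bound the first minimum by \<open>(2 powi j * \<bar>y\<bar>) powr \<theta>\<close> and substitute \<open>y = z / 2 powi k\<close>. The exponent \<open>\<theta>\<close>
stays free, so that it can be chosen on either side of \<open>s\<close> according to the sign of \<open>j - k\<close>.\<close>

lemma dyadic_kernel_le:
  assumes "0 < \<theta>" "\<theta> < 1"
  shows "(\<integral>\<^sup>+y. ennreal (1 / y\<^sup>2 * (min 1 (2 powi j * \<bar>y\<bar>) * min 1 (2 powi k * \<bar>y\<bar>))) \<partial>lborel)
    \<le> ennreal (2 powr (\<theta> * of_int j + (1 - \<theta>) * of_int k)) * kernel_moment \<theta>"
proof -
  define A where "A = (2::real) powr of_int j"
  define B where "B = (2::real) powr of_int k"
  have AB: "0 < A" "0 < B" by (auto simp: A_def B_def)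
  have p: "2 powi j = A" "2 powi k = B" by (auto simp: A_def B_def powr_real_of_int')
  have ge: "1 / y\<^sup>2 * (min 1 (A * \<bar>y\<bar>) * min 1 (B * \<bar>y\<bar>)) \<le> A powr \<theta> * (\<bar>y\<bar> powr (\<theta> - 2) * min 1 (B * \<bar>y\<bar>))" for y
  proof (cases "y = 0")
    case False
    have "min 1 (A * \<bar>y\<bar>) \<le> (A * \<bar>y\<bar>) powr \<theta>"
    proof (cases "A * \<bar>y\<bar> \<le> 1")
      case True
      have "(A * \<bar>y\<bar>) powr 1 \<le> (A * \<bar>y\<bar>) powr \<theta>"
        using assms AB True False by (intro powr_mono') auto
      then show ?thesis using AB by simp
    next
      case F: False
      then have "1 powr \<theta> \<le> (A * \<bar>y\<bar>) powr \<theta>" using assms by (intro powr_mono2) auto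
      then show ?thesis by simp
    qed
    also have "\<dots> = A powr \<theta> * \<bar>y\<bar> powr \<theta>" using AB by (simp add: powr_mult)
    also have "\<bar>y\<bar> powr \<theta> = \<bar>y\<bar> powr (\<theta> - 2) * y\<^sup>2"
      using False powr_add[of "\<bar>y\<bar>" "\<theta> - 2" 2] by (simp add: powr_numeral)
    finally have "min 1 (A * \<bar>y\<bar>) * min 1 (B * \<bar>y\<bar>) \<le> A powr \<theta> * (\<bar>y\<bar> powr (\<theta> - 2) * y\<^sup>2) * min 1 (B * \<bar>y\<bar>)"
      using AB by (intro mult_right_mono) auto
    also have "\<dots> = A powr \<theta> * (\<bar>y\<bar> powr (\<theta> - 2) * min 1 (B * \<bar>y\<bar>)) * y\<^sup>2" by simp
    finally show ?thesis using False by (simp add: divide_simps)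
  qed simp
  have "(\<integral>\<^sup>+y. ennreal (1 / y\<^sup>2 * (min 1 (2 powi j * \<bar>y\<bar>) * min 1 (2 powi k * \<bar>y\<bar>))) \<partial>lborel)
    \<le> (\<integral>\<^sup>+y. ennreal (A powr \<theta> * (\<bar>y\<bar> powr (\<theta> - 2) * min 1 (B * \<bar>y\<bar>))) \<partial>lborel)"
    unfolding p by (intro nn_integral_mono ennreal_leI ge)
  also have "\<dots> = ennreal (1 / B) * (\<integral>\<^sup>+z. ennreal (A powr \<theta> * (\<bar>1 / B * z\<bar> powr (\<theta> - 2) * min 1 (B * \<bar>1 / B * z\<bar>))) \<partial>lborel)"
    using AB nn_integral_real_affine[of "\<lambda>y. ennreal (A powr \<theta> * (\<bar>y\<bar> powr (\<theta> - 2) * min 1 (B * \<bar>y\<bar>)))" "1 / B" 0] by simp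
  also have "\<dots> = (\<integral>\<^sup>+z. ennreal (2 powr (\<theta> * of_int j + (1 - \<theta>) * of_int k)) * ennreal (\<bar>z\<bar> powr (\<theta> - 2) * min 1 \<bar>z\<bar>) \<partial>lborel)"
  proof (subst nn_integral_cmult[symmetric], measurable, rule nn_integral_cong)
    fix z :: real
    have "1 / B * (A powr \<theta> * (\<bar>1 / B * z\<bar> powr (\<theta> - 2) * min 1 (B * \<bar>1 / B * z\<bar>)))
      = (1 / B * A powr \<theta> * (1 / B) powr (\<theta> - 2)) * (\<bar>z\<bar> powr (\<theta> - 2) * min 1 \<bar>z\<bar>)"
      using AB by (simp add: abs_mult powr_mult powr_divide)
    also have "1 / B * A powr \<theta> * (1 / B) powr (\<theta> - 2) = 2 powr (\<theta> * of_int j + (1 - \<theta>) * of_int k)"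
    proof -
      have "1 / B = 2 powr (- of_int k)" by (simp add: B_def powr_minus_divide)
      then show ?thesis by (simp add: A_def powr_powr powr_add[symmetric] algebra_simps)
    qed
    finally show "ennreal (1 / B) * ennreal (A powr \<theta> * (\<bar>1 / B * z\<bar> powr (\<theta> - 2) * min 1 (B * \<bar>1 / B * z\<bar>)))
      = ennreal (2 powr (\<theta> * of_int j + (1 - \<theta>) * of_int k)) * ennreal (\<bar>z\<bar> powr (\<theta> - 2) * min 1 \<bar>z\<bar>)"
      using AB by (simp add: ennreal_mult[symmetric])
  qed
  also have "\<dots> = ennreal (2 powr (\<theta> * of_int j + (1 - \<theta>) * of_int k)) * kernel_moment \<theta>"
    unfolding kernel_moment_def by (rule nn_integral_cmult) measurable
  finally show ?thesis .
qed

lemma Lp_ennreal_CS_shift: "Lp_ennreal r CS (\<lambda>j. b (j + i)) = Lp_ennreal r CS b"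
proof -
  have bij: "bij (\<lambda>j::int. j + i)" by (rule bij_plus_right)
  have "(\<integral>\<^sup>+j. enn_powr (b (j + i)) R \<partial>CS) = (\<integral>\<^sup>+j. enn_powr (b j) R \<partial>CS)" for R
    by (rule nn_integral_bij_count_space[OF bij, of "\<lambda>j. enn_powr (b j) R"])
  moreover have "range (\<lambda>j. b (j + i)) = range b"
    using arg_cong[OF bij_is_surj[OF bij], of "image b"] unfolding image_image .
  ultimately show ?thesis by (simp add: Lp_ennreal_def esssup_count_space)
qed

lemma geometric_kernel_finite:
  assumes "0 < \<epsilon>"
  shows "(\<integral>\<^sup>+i. ennreal (2 powr (- \<epsilon> * \<bar>of_int i\<bar>)) \<partial>CS) < \<infinity>"
proof -
  have "2 powr (- \<epsilon>) < (1::real)" using assms by (simp add: powr_less_one)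
  then have "summable (\<lambda>n. (2 powr (- \<epsilon>)) ^ n :: real)" by (intro summable_geometric) simp
  moreover have "(2 powr (- \<epsilon>)) ^ n = (2::real) powr (- \<epsilon> * real n)" for n
    by (simp add: powr_realpow[symmetric] powr_powr)
  ultimately have "summable (\<lambda>n. (2::real) powr (- \<epsilon> * real n))" by simp
  then have "integrable CS (\<lambda>i. (2::real) powr (- \<epsilon> * \<bar>of_int i\<bar>))"
    by (intro integrable_CS_if_summable_halves) auto
  then show ?thesis by (subst nn_integral_eq_integral) auto
qed

text \<open>Substituting \<open>k = i + j\<close> turns the double sum into a superposition over \<open>i\<close> of pairings of \<open>a\<close> with
shifts of \<open>b\<close>. Hoelder bounds all of these by the same product, as the norms are shift invariant.\<close>

lemma discrete_Young:
  fixes a b K :: "int \<Rightarrow> ennreal"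
  assumes "1 \<le> r" "1 \<le> r'" "1 / r + 1 / r' = 1"
  shows "(\<integral>\<^sup>+j. \<integral>\<^sup>+k. K (k - j) * (a j * b k) \<partial>CS \<partial>CS)
    \<le> (\<integral>\<^sup>+i. K i \<partial>CS) * (Lp_ennreal r CS a * Lp_ennreal r' CS b)"
proof -
  interpret pair_sigma_finite CS CS by (intro pair_sigma_finite.intro sigma_finite_CS)
  have bij: "bij (\<lambda>i::int. i + j)" for j by (rule bij_plus_right)
  have "(\<integral>\<^sup>+j. \<integral>\<^sup>+k. K (k - j) * (a j * b k) \<partial>CS \<partial>CS) = (\<integral>\<^sup>+j. \<integral>\<^sup>+i. K i * (a j * b (i + j)) \<partial>CS \<partial>CS)"
  proof (rule nn_integral_cong)
    fix j
    show "(\<integral>\<^sup>+k. K (k - j) * (a j * b k) \<partial>CS) = (\<integral>\<^sup>+i. K i * (a j * b (i + j)) \<partial>CS)"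
      using nn_integral_bij_count_space[OF bij[of j], of "\<lambda>k. K (k - j) * (a j * b k)"] by simp
  qed
  also have "\<dots> = (\<integral>\<^sup>+i. \<integral>\<^sup>+j. K i * (a j * b (i + j)) \<partial>CS \<partial>CS)"
    by (rule Fubini') (rule measurable_pair_measure_countable1, auto)
  also have "\<dots> = (\<integral>\<^sup>+i. K i * (\<integral>\<^sup>+j. a j * b (j + i) \<partial>CS) \<partial>CS)"
    by (simp add: nn_integral_cmult add.commute)
  also have "\<dots> \<le> (\<integral>\<^sup>+i. K i * (Lp_ennreal r CS a * Lp_ennreal r' CS b) \<partial>CS)"
  proof (intro nn_integral_mono mult_left_mono)
    fix i
    show "(\<integral>\<^sup>+j. a j * b (j + i) \<partial>CS) \<le> Lp_ennreal r CS a * Lp_ennreal r' CS b"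
      using Hoelder_ennreal[OF _ _ assms, of a CS "\<lambda>j. b (j + i)"] by (simp add: Lp_ennreal_CS_shift)
  qed simp
  finally show ?thesis by (simp add: nn_integral_multc)
qed

lemma nn_integral_product_swap:
  assumes "sigma_finite_measure S" "sigma_finite_measure M1" "sigma_finite_measure M2"
    and A[measurable]: "(\<lambda>p. A (fst p) (snd p)) \<in> borel_measurable (S \<Otimes>\<^sub>M M1)"
    and B[measurable]: "(\<lambda>p. B (fst p) (snd p)) \<in> borel_measurable (S \<Otimes>\<^sub>M M2)"
  shows "(\<integral>\<^sup>+s. (\<integral>\<^sup>+z. A s z \<partial>M1) * (\<integral>\<^sup>+w. B s w \<partial>M2) \<partial>S)
    = (\<integral>\<^sup>+z. \<integral>\<^sup>+w. \<integral>\<^sup>+s. (A s z * B s w :: ennreal) \<partial>S \<partial>M2 \<partial>M1)"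
proof -
  interpret S: sigma_finite_measure S by fact
  interpret M1: sigma_finite_measure M1 by fact
  interpret M2: sigma_finite_measure M2 by fact
  interpret P1: pair_sigma_finite S M1 ..
  interpret P2: pair_sigma_finite S M2 ..
  have A2: "A s \<in> borel_measurable M1" if "s \<in> space S" for s
    using measurable_compose[OF measurable_Pair1'[OF that, of M1] A] by simp
  have B2: "B s \<in> borel_measurable M2" if "s \<in> space S" for s
    using measurable_compose[OF measurable_Pair1'[OF that, of M2] B] by simp
  have "(\<integral>\<^sup>+s. (\<integral>\<^sup>+z. A s z \<partial>M1) * (\<integral>\<^sup>+w. B s w \<partial>M2) \<partial>S) = (\<integral>\<^sup>+s. \<integral>\<^sup>+z. A s z * (\<integral>\<^sup>+w. B s w \<partial>M2) \<partial>M1 \<partial>S)"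
    by (intro nn_integral_cong nn_integral_multc[symmetric] A2)
  also have "\<dots> = (\<integral>\<^sup>+z. \<integral>\<^sup>+s. A s z * (\<integral>\<^sup>+w. B s w \<partial>M2) \<partial>S \<partial>M1)"
  proof (rule P1.Fubini'[symmetric])
    have [measurable]: "(\<lambda>s. \<integral>\<^sup>+w. B s w \<partial>M2) \<in> borel_measurable S"
      using M2.borel_measurable_nn_integral_fst[OF B] by simp
    show "(\<lambda>(s, z). A s z * (\<integral>\<^sup>+w. B s w \<partial>M2)) \<in> borel_measurable (S \<Otimes>\<^sub>M M1)"
      unfolding case_prod_beta' by measurable
  qed
  also have "\<dots> = (\<integral>\<^sup>+z. \<integral>\<^sup>+s. \<integral>\<^sup>+w. A s z * B s w \<partial>M2 \<partial>S \<partial>M1)"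
    by (intro nn_integral_cong nn_integral_cmult[symmetric] B2)
  also have "\<dots> = (\<integral>\<^sup>+z. \<integral>\<^sup>+w. \<integral>\<^sup>+s. A s z * B s w \<partial>S \<partial>M2 \<partial>M1)"
  proof (intro nn_integral_cong P2.Fubini'[symmetric])
    fix z assume z: "z \<in> space M1"
    have [measurable]: "(\<lambda>s. A s z) \<in> borel_measurable S"
      using measurable_compose[OF measurable_Pair2'[OF z, of S] A] by simp
    show "(\<lambda>(s, w). A s z * B s w) \<in> borel_measurable (S \<Otimes>\<^sub>M M2)"
      unfolding case_prod_beta' by measurable
  qed
  finally show ?thesis .
qed

section \<open>The bilinear estimate\<close>

lemma measurable_nn_integral_CS:
  fixes G :: "int \<Rightarrow> 'a \<Rightarrow> ennreal"
  assumes "\<And>k. G k \<in> borel_measurable M"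
  shows "(\<lambda>p. G (snd p) (fst p)) \<in> borel_measurable (M \<Otimes>\<^sub>M CS)"
    and "(\<lambda>y. \<integral>\<^sup>+k. G k y \<partial>CS) \<in> borel_measurable M"
proof -
  interpret C: sigma_finite_measure CS by (rule sigma_finite_CS)
  have "(\<lambda>p. G (fst p) (snd p)) \<in> borel_measurable (CS \<Otimes>\<^sub>M M)"
    by (rule measurable_pair_measure_countable1) (use assms in auto)
  from measurable_compose[OF measurable_pair_swap' this]
  show m2: "(\<lambda>p. G (snd p) (fst p)) \<in> borel_measurable (M \<Otimes>\<^sub>M CS)"
    by (simp add: case_prod_beta')
  show "(\<lambda>y. \<integral>\<^sup>+k. G k y \<partial>CS) \<in> borel_measurable M"
    using C.borel_measurable_nn_integral_fst[OF m2] by simp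
qed

lemma nn_integral_CS_swap:
  fixes G :: "int \<Rightarrow> 'a \<Rightarrow> ennreal"
  assumes "sigma_finite_measure M" "\<And>k. G k \<in> borel_measurable M"
  shows "(\<integral>\<^sup>+y. \<integral>\<^sup>+k. G k y \<partial>CS \<partial>M) = (\<integral>\<^sup>+k. \<integral>\<^sup>+y. G k y \<partial>M \<partial>CS)"
proof -
  interpret N: sigma_finite_measure M by fact
  interpret C: sigma_finite_measure CS by (rule sigma_finite_CS)
  interpret pair_sigma_finite CS M ..
  have "(\<lambda>p. G (fst p) (snd p)) \<in> borel_measurable (CS \<Otimes>\<^sub>M M)"
    by (rule measurable_pair_measure_countable1) (use assms(2) in auto)
  from Fubini[OF this] show ?thesis by simp
qed

lemma sigma_finite_strip: "sigma_finite_measure (strip T L)"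
  by (rule sigma_finite_measure_restrict_space[OF sigma_finite_lborel])
     (simp add: borel_closed closed_Times)

lemma measurable_strip_fst_snd [measurable]:
  "fst \<in> borel_measurable (strip T L)" "snd \<in> borel_measurable (strip T L)"
  by (rule measurable_strip[OF measurable_fst], rule measurable_strip[OF measurable_snd])

text \<open>Global measurability in time and space, so that Tonelli applies without reference to a time interval;
solutions on \<open>[0,T]\<close> get this property by extending them by zero in time.\<close>

definition admissible :: "real \<Rightarrow> (real \<Rightarrow> real \<Rightarrow> real) \<Rightarrow> bool" where
  "admissible L u \<longleftrightarrow> (\<lambda>p. u (fst p) (snd p)) \<in> borel_measurable (borel \<Otimes>\<^sub>M borel) \<and> (\<forall>t. wiener L (u t))"

lemma admissible_measurable:
  assumes "admissible L u" "f \<in> borel_measurable M" "g \<in> borel_measurable M"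
  shows "(\<lambda>x. u (f x) (g x)) \<in> borel_measurable M"
  using assms(1) measurable_compose[OF measurable_Pair[OF assms(2,3)], of "\<lambda>p. u (fst p) (snd p)" borel]
  by (simp add: admissible_def)

lemma admissible_period: "admissible L u \<Longrightarrow> L \<noteq> 0 \<Longrightarrow> u t (x + L) = u t x"
  unfolding admissible_def wiener_def by (metis of_real_eq_iff trig_period)

context LP_family
begin

definition incr :: "int \<Rightarrow> (real \<Rightarrow> real \<Rightarrow> real) \<Rightarrow> real \<Rightarrow> real \<Rightarrow> real \<Rightarrow> ennreal" where
  "incr j u h t x = ennreal (norm (lp_piece \<phi> j u t (x + h) - lp_piece \<phi> j u t x))"

lemma measurable_lp_piece [measurable (raw)]:
  assumes "admissible L u" "f \<in> borel_measurable M" "g \<in> borel_measurable M"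
  shows "(\<lambda>x. lp_piece \<phi> k u (f x) (g x)) \<in> borel_measurable M"
proof -
  have "(\<lambda>(p, y). \<phi> k y * of_real (u (fst p) (snd p - y))) \<in> borel_measurable ((borel \<Otimes>\<^sub>M borel) \<Otimes>\<^sub>M lborel)"
  proof -
    have [measurable]: "(\<lambda>q. u (fst (fst q)) (snd (fst q) - snd q)) \<in> borel_measurable ((borel \<Otimes>\<^sub>M borel) \<Otimes>\<^sub>M borel)"
      by (rule admissible_measurable[OF assms(1)]) measurable
    show ?thesis unfolding case_prod_beta' by measurable
  qed
  then have "(\<lambda>p. lp_piece \<phi> k u (fst p) (snd p)) \<in> borel_measurable (borel \<Otimes>\<^sub>M borel)"
    unfolding lp_piece_def by (rule lborel.borel_measurable_lebesgue_integral)
  from measurable_compose[OF measurable_Pair[OF assms(2,3)] this] show ?thesis by simp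
qed

lemma lp_piece_period:
  assumes "admissible L u" "L \<noteq> 0"
  shows "lp_piece \<phi> k u t (x + L) = lp_piece \<phi> k u t x"
proof -
  have "wiener L (u t)" using assms(1) by (simp add: admissible_def)
  from lp_piece_eq_trig(1)[where u=u and t=t, OF this] show ?thesis
    by (simp only: trig_period[OF assms(2)])
qed

lemma lp_piece_norm_eq:
  "lp_piece_norm \<phi> L T p k u = Lp_ennreal p (strip T L) (\<lambda>z. ennreal (norm (lp_piece \<phi> k u (fst z) (snd z))))"
  by (simp add: lp_piece_norm_def Lp_norm_eq_Lp_ennreal case_prod_beta')

lemma lp_piece_norm_shift:
  assumes "admissible L u" "0 < L"
  shows "Lp_ennreal p (strip T L) (\<lambda>z. ennreal (norm (lp_piece \<phi> k u (fst z) (snd z + a)))) = lp_piece_norm \<phi> L T p k u"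
  unfolding lp_piece_norm_eq
  using Lp_ennreal_strip_shift[of "\<lambda>z. ennreal (norm (lp_piece \<phi> k u (fst z) (snd z)))" L p T a] assms
  by (simp add: lp_piece_period)

text \<open>Each increment is a superposition of translates of its own piece, with weight the increment of the
reproducing kernel. Hoelder is applied for fixed translates, whose norms do not depend on the
translation, and the weights are integrated afterwards.\<close>

lemma increments_product_le:
  assumes u: "admissible L u" and v: "admissible L v" and "0 < L"
    and p: "1 \<le> p" "1 \<le> p'" "1 / p + 1 / p' = 1"
  shows "(\<integral>\<^sup>+z. incr j u h (fst z) (snd z + a) * incr k v h (fst z) (snd z) \<partial>strip T L)
    \<le> (\<integral>\<^sup>+z. ennreal (norm (reproducing_kernel j (z + h) - reproducing_kernel j z)) \<partial>lborel)
      * (\<integral>\<^sup>+z. ennreal (norm (reproducing_kernel k (z + h) - reproducing_kernel k z)) \<partial>lborel)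
      * (lp_piece_norm \<phi> L T p j u * lp_piece_norm \<phi> L T p' k v)"
proof -
  define \<omega> where "\<omega> i z = ennreal (norm (reproducing_kernel i (z + h) - reproducing_kernel i z))" for i z
  have [measurable]: "\<omega> i \<in> borel_measurable borel" for i unfolding \<omega>_def by measurable
  define P where "P t x = ennreal (norm (lp_piece \<phi> j u t x))" for t x
  define Q where "Q t x = ennreal (norm (lp_piece \<phi> k v t x))" for t x
  have [measurable (raw)]: "(\<lambda>x. P (f x) (g x)) \<in> borel_measurable M" "(\<lambda>x. Q (f x) (g x)) \<in> borel_measurable M"
    if "f \<in> borel_measurable M" "g \<in> borel_measurable M" for f g and M :: "'c measure"
    using that u v unfolding P_def Q_def by measurable
  have wu: "wiener L (u t)" and wv: "wiener L (v t)" for t using u v by (auto simp: admissible_def)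
  define c where "c = lp_piece_norm \<phi> L T p j u * lp_piece_norm \<phi> L T p' k v"
  have "incr j u h t x \<le> (\<integral>\<^sup>+z. \<omega> j z * P t (x - z) \<partial>lborel)" for t x
    unfolding incr_def \<omega>_def P_def by (rule norm_lp_piece_increment_le[where u=u and t=t, OF wu])
  moreover have "incr k v h t x \<le> (\<integral>\<^sup>+z. \<omega> k z * Q t (x - z) \<partial>lborel)" for t x
    unfolding incr_def \<omega>_def Q_def by (rule norm_lp_piece_increment_le[where u=v and t=t, OF wv])
  ultimately have "(\<integral>\<^sup>+s. incr j u h (fst s) (snd s + a) * incr k v h (fst s) (snd s) \<partial>strip T L)
    \<le> (\<integral>\<^sup>+s. (\<integral>\<^sup>+z. \<omega> j z * P (fst s) (snd s + a - z) \<partial>lborel) * (\<integral>\<^sup>+w. \<omega> k w * Q (fst s) (snd s - w) \<partial>lborel) \<partial>strip T L)"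
    by (intro nn_integral_mono mult_mono) auto
  also have "\<dots> = (\<integral>\<^sup>+z. \<integral>\<^sup>+w. \<integral>\<^sup>+s. (\<omega> j z * P (fst s) (snd s + a - z)) * (\<omega> k w * Q (fst s) (snd s - w)) \<partial>strip T L \<partial>lborel \<partial>lborel)"
    by (rule nn_integral_product_swap[OF sigma_finite_strip sigma_finite_lborel sigma_finite_lborel]) measurable
  also have "\<dots> \<le> (\<integral>\<^sup>+z. \<integral>\<^sup>+w. \<omega> j z * (\<omega> k w * c) \<partial>lborel \<partial>lborel)"
  proof (intro nn_integral_mono)
    fix z w :: real
    have "(\<integral>\<^sup>+s. P (fst s) (snd s + (a - z)) * Q (fst s) (snd s + (- w)) \<partial>strip T L)
      \<le> Lp_ennreal p (strip T L) (\<lambda>s. P (fst s) (snd s + (a - z))) * Lp_ennreal p' (strip T L) (\<lambda>s. Q (fst s) (snd s + (- w)))"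
      by (rule Hoelder_ennreal[OF _ _ p]) measurable
    also have "\<dots> = c"
      unfolding P_def Q_def c_def lp_piece_norm_shift[OF u \<open>0 < L\<close>] lp_piece_norm_shift[OF v \<open>0 < L\<close>] ..
    finally have le: "(\<integral>\<^sup>+s. P (fst s) (snd s + (a - z)) * Q (fst s) (snd s + (- w)) \<partial>strip T L) \<le> c" .
    have "(\<integral>\<^sup>+s. (\<omega> j z * P (fst s) (snd s + a - z)) * (\<omega> k w * Q (fst s) (snd s - w)) \<partial>strip T L)
      = (\<integral>\<^sup>+s. (\<omega> j z * \<omega> k w) * (P (fst s) (snd s + (a - z)) * Q (fst s) (snd s + (- w))) \<partial>strip T L)"
      by (intro nn_integral_cong) (simp add: add_diff_eq mult_ac)
    also have "\<dots> = \<omega> j z * \<omega> k w * (\<integral>\<^sup>+s. P (fst s) (snd s + (a - z)) * Q (fst s) (snd s + (- w)) \<partial>strip T L)"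
      by (rule nn_integral_cmult) measurable
    also have "\<dots> \<le> \<omega> j z * \<omega> k w * c" by (rule mult_left_mono[OF le]) simp
    finally show "(\<integral>\<^sup>+s. (\<omega> j z * P (fst s) (snd s + a - z)) * (\<omega> k w * Q (fst s) (snd s - w)) \<partial>strip T L)
      \<le> \<omega> j z * (\<omega> k w * c)" by (simp only: mult.assoc)
  qed
  also have "\<dots> = (\<integral>\<^sup>+z. \<omega> j z \<partial>lborel) * ((\<integral>\<^sup>+w. \<omega> k w \<partial>lborel) * c)"
    by (simp add: nn_integral_cmult nn_integral_multc)
  finally show ?thesis by (simp add: c_def \<omega>_def mult.assoc)
qed

text \<open>The heart of the harmonic analysis. The pieces \<open>j\<close> and \<open>k\<close> interact with strength
\<open>\<integral> min 1 (2 powi j \<bar>y\<bar>) min 1 (2 powi k \<bar>y\<bar>) / y\<^sup>2 dy\<close>. Relative to the weight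
\<open>2 powr (s j + (1 - s) k)\<close> of the two Besov norms this decays geometrically in \<open>\<bar>k - j\<bar>\<close>, because \<open>s\<close> lies
strictly between \<open>0\<close> and \<open>1\<close>; the double sum is then closed by the discrete Young inequality.\<close>

lemma bilinear_increments_le:
  assumes s: "0 < s" "s < 1"
    and r: "1 \<le> r" "1 \<le> r'" "1 / r + 1 / r' = 1" and p: "1 \<le> p" "1 \<le> p'" "1 / p + 1 / p' = 1"
  obtains C :: real where "0 < C" "\<And>L T u v a. 0 < L \<Longrightarrow> admissible L u \<Longrightarrow> admissible L v \<Longrightarrow>
    (\<integral>\<^sup>+y. ennreal (1 / y\<^sup>2) * (\<integral>\<^sup>+z. (\<integral>\<^sup>+j. incr j u y (fst z) (snd z + a) \<partial>CS)
       * (\<integral>\<^sup>+k. incr k v y (fst z) (snd z) \<partial>CS) \<partial>strip T L) \<partial>lborel)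
    \<le> ennreal C * (besov_norm \<phi> L T s p r u * besov_norm \<phi> L T (1 - s) p' r' v)"
proof -
  obtain \<kappa> where \<kappa>: "0 < \<kappa>" "\<And>j h. (\<integral>\<^sup>+z. ennreal (norm (reproducing_kernel j (z + h) - reproducing_kernel j z)) \<partial>lborel)
    \<le> ennreal (\<kappa> * min 1 (2 powi j * \<bar>h\<bar>))"
    using reproducing_kernel_increments by blast
  \<comment> \<open>Half the distance of \<open>s\<close> to the endpoints, so that \<open>s - \<epsilon>\<close> and \<open>s + \<epsilon>\<close> are both admissible exponents.\<close>
  define \<epsilon> where "\<epsilon> = min s (1 - s) / 2"
  have \<epsilon>: "0 < \<epsilon>" "0 < s - \<epsilon>" "s + \<epsilon> < 1" "s - \<epsilon> < 1" "0 < s + \<epsilon>" 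
  proof -
    have "0 < \<epsilon>" "\<epsilon> \<le> s / 2" "\<epsilon> \<le> (1 - s) / 2" using s by (auto simp: \<epsilon>_def)
    then show "0 < \<epsilon>" "0 < s - \<epsilon>" "s + \<epsilon> < 1" "s - \<epsilon> < 1" "0 < s + \<epsilon>" using s by (auto simp: field_simps)
  qed
  define K where "K i = ennreal (2 powr (- \<epsilon> * \<bar>of_int i\<bar>))" for i :: int
  define J' where "J' = kernel_moment (s + \<epsilon>) + kernel_moment (s - \<epsilon>)"
  define E where "E = ennreal (\<kappa>\<^sup>2) * J' * (\<integral>\<^sup>+i. K i \<partial>CS)"
  have "E < \<infinity>"
    using kernel_moment_finite[of "s + \<epsilon>"] kernel_moment_finite[of "s - \<epsilon>"] geometric_kernel_finite[OF \<epsilon>(1)] \<epsilon>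
    by (simp add: E_def J'_def K_def ennreal_mult_less_top)
  define C where "C = enn2real E + 1"
  have C: "0 < C" by (simp add: C_def add_nonneg_pos)
  have "E = ennreal (enn2real E)" using \<open>E < \<infinity>\<close> by simp
  also have "\<dots> \<le> ennreal C" by (intro ennreal_leI) (simp add: C_def)
  finally have EC: "E \<le> ennreal C" .
  have "(\<integral>\<^sup>+y. ennreal (1 / y\<^sup>2) * (\<integral>\<^sup>+z. (\<integral>\<^sup>+j. incr j u y (fst z) (snd z + a) \<partial>CS)
       * (\<integral>\<^sup>+k. incr k v y (fst z) (snd z) \<partial>CS) \<partial>strip T L) \<partial>lborel)
    \<le> E * (besov_norm \<phi> L T s p r u * besov_norm \<phi> L T (1 - s) p' r' v)"
    if L: "0 < L" and u: "admissible L u" and v: "admissible L v" for L T u v a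
  proof -
    define N where "N j = lp_piece_norm \<phi> L T p j u" for j
    define M where "M k = lp_piece_norm \<phi> L T p' k v" for k
    define q :: "int \<Rightarrow> real \<Rightarrow> real" where "q j y = min 1 (2 powi j * \<bar>y\<bar>)" for j y
    have [measurable]: "q j \<in> borel_measurable borel" for j
      unfolding q_def by (intro borel_measurable_min borel_measurable_times borel_measurable_const) simp_all
    have q0: "0 \<le> q j y" for j y by (simp add: q_def)
    have um[measurable]: "(\<lambda>z. incr j u y (fst z) (snd z + a)) \<in> borel_measurable (strip T L)"
      and vm[measurable]: "(\<lambda>z. incr j v y (fst z) (snd z)) \<in> borel_measurable (strip T L)" for j y
      unfolding incr_def using u v by measurable
    have inner: "(\<integral>\<^sup>+z. (\<integral>\<^sup>+j. incr j u y (fst z) (snd z + a) \<partial>CS) * (\<integral>\<^sup>+k. incr k v y (fst z) (snd z) \<partial>CS) \<partial>strip T L)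
      \<le> (\<integral>\<^sup>+j. \<integral>\<^sup>+k. ennreal (\<kappa>\<^sup>2 * (q j y * q k y)) * (N j * M k) \<partial>CS \<partial>CS)" for y
    proof -
      have "(\<integral>\<^sup>+z. (\<integral>\<^sup>+j. incr j u y (fst z) (snd z + a) \<partial>CS) * (\<integral>\<^sup>+k. incr k v y (fst z) (snd z) \<partial>CS) \<partial>strip T L)
        = (\<integral>\<^sup>+j. \<integral>\<^sup>+k. \<integral>\<^sup>+z. incr j u y (fst z) (snd z + a) * incr k v y (fst z) (snd z) \<partial>strip T L \<partial>CS \<partial>CS)"
        by (rule nn_integral_product_swap[OF sigma_finite_strip sigma_finite_CS sigma_finite_CS
              measurable_nn_integral_CS(1)[OF um] measurable_nn_integral_CS(1)[OF vm]])
      also have "\<dots> \<le> (\<integral>\<^sup>+j. \<integral>\<^sup>+k. ennreal (\<kappa>\<^sup>2 * (q j y * q k y)) * (N j * M k) \<partial>CS \<partial>CS)"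
      proof (intro nn_integral_mono)
        fix j k
        have "(\<integral>\<^sup>+z. incr j u y (fst z) (snd z + a) * incr k v y (fst z) (snd z) \<partial>strip T L)
          \<le> (ennreal (\<kappa> * q j y) * ennreal (\<kappa> * q k y)) * (N j * M k)"
          unfolding N_def M_def q_def
          by (rule order_trans[OF increments_product_le[OF u v L p]]) (intro mult_mono \<kappa>(2); simp)
        also have "ennreal (\<kappa> * q j y) * ennreal (\<kappa> * q k y) = ennreal (\<kappa>\<^sup>2 * (q j y * q k y))"
          using \<kappa>(1) q0 by (simp add: ennreal_mult[symmetric] power2_eq_square mult_ac)
        finally show "(\<integral>\<^sup>+z. incr j u y (fst z) (snd z + a) * incr k v y (fst z) (snd z) \<partial>strip T L)
          \<le> ennreal (\<kappa>\<^sup>2 * (q j y * q k y)) * (N j * M k)" .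
      qed
      finally show ?thesis .
    qed
    define g where "g j k y = ennreal (1 / y\<^sup>2 * (q j y * q k y)) * (ennreal (\<kappa>\<^sup>2) * (N j * M k))" for j k y
    have gm: "g j k \<in> borel_measurable lborel" for j k unfolding g_def by measurable
    have gm2: "(\<lambda>y. \<integral>\<^sup>+k. g j k y \<partial>CS) \<in> borel_measurable lborel" for j
      by (rule measurable_nn_integral_CS(2)[OF gm])
    have "(\<integral>\<^sup>+y. ennreal (1 / y\<^sup>2) * (\<integral>\<^sup>+z. (\<integral>\<^sup>+j. incr j u y (fst z) (snd z + a) \<partial>CS)
       * (\<integral>\<^sup>+k. incr k v y (fst z) (snd z) \<partial>CS) \<partial>strip T L) \<partial>lborel)
      \<le> (\<integral>\<^sup>+y. ennreal (1 / y\<^sup>2) * (\<integral>\<^sup>+j. \<integral>\<^sup>+k. ennreal (\<kappa>\<^sup>2 * (q j y * q k y)) * (N j * M k) \<partial>CS \<partial>CS) \<partial>lborel)"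
      by (intro nn_integral_mono mult_left_mono inner) simp
    also have "\<dots> = (\<integral>\<^sup>+y. \<integral>\<^sup>+j. \<integral>\<^sup>+k. g j k y \<partial>CS \<partial>CS \<partial>lborel)"
    proof (rule nn_integral_cong)
      fix y :: real
      have "ennreal (1 / y\<^sup>2) * (ennreal (\<kappa>\<^sup>2 * (q j y * q k y)) * (N j * M k)) = g j k y" for j k
      proof -
        have "ennreal (1 / y\<^sup>2 * (q j y * q k y)) = ennreal (1 / y\<^sup>2) * ennreal (q j y * q k y)"
          "ennreal (\<kappa>\<^sup>2 * (q j y * q k y)) = ennreal (\<kappa>\<^sup>2) * ennreal (q j y * q k y)"
          by (rule ennreal_mult; simp add: q0)+
        then show ?thesis unfolding g_def by (simp only: mult_ac)
      qed
      then show "ennreal (1 / y\<^sup>2) * (\<integral>\<^sup>+j. \<integral>\<^sup>+k. ennreal (\<kappa>\<^sup>2 * (q j y * q k y)) * (N j * M k) \<partial>CS \<partial>CS)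
        = (\<integral>\<^sup>+j. \<integral>\<^sup>+k. g j k y \<partial>CS \<partial>CS)"
        by (simp add: nn_integral_cmult[symmetric])
    qed
    also have "\<dots> = (\<integral>\<^sup>+j. \<integral>\<^sup>+k. \<integral>\<^sup>+y. g j k y \<partial>lborel \<partial>CS \<partial>CS)"
      by (simp only: nn_integral_CS_swap[OF sigma_finite_lborel gm2] nn_integral_CS_swap[OF sigma_finite_lborel gm])
    also have "\<dots> \<le> (\<integral>\<^sup>+j. \<integral>\<^sup>+k. (ennreal (\<kappa>\<^sup>2) * J') * (K (k - j) * ((ennreal (2 powr (s * of_int j)) * N j) * (ennreal (2 powr ((1 - s) * of_int k)) * M k))) \<partial>CS \<partial>CS)"
    proof (intro nn_integral_mono)
      fix j k :: int
      \<comment> \<open>With this choice \<open>(\<theta> - s) (j - k) = - \<epsilon> \<bar>k - j\<bar>\<close>.\<close>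
      define \<theta> where "\<theta> = (if j \<le> k then s + \<epsilon> else s - \<epsilon>)"
      have \<theta>: "0 < \<theta>" "\<theta> < 1" using \<epsilon> by (auto simp: \<theta>_def)
      have JJ: "kernel_moment \<theta> \<le> J'" by (simp add: \<theta>_def J'_def)
      have ex: "2 powr (\<theta> * of_int j + (1 - \<theta>) * of_int k)
        = 2 powr (- \<epsilon> * \<bar>of_int (k - j)\<bar>) * (2 powr (s * of_int j) * 2 powr ((1 - s) * of_int k) :: real)"
        unfolding powr_add[symmetric] by (auto simp: \<theta>_def algebra_simps)
      have "(\<integral>\<^sup>+y. g j k y \<partial>lborel) = (\<integral>\<^sup>+y. ennreal (1 / y\<^sup>2 * (q j y * q k y)) \<partial>lborel) * (ennreal (\<kappa>\<^sup>2) * (N j * M k))"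
        unfolding g_def by (rule nn_integral_multc) measurable
      also have "\<dots> \<le> (ennreal (2 powr (\<theta> * of_int j + (1 - \<theta>) * of_int k)) * kernel_moment \<theta>) * (ennreal (\<kappa>\<^sup>2) * (N j * M k))"
        unfolding q_def by (intro mult_right_mono dyadic_kernel_le \<theta>) simp
      also have "\<dots> \<le> (ennreal (2 powr (\<theta> * of_int j + (1 - \<theta>) * of_int k)) * J') * (ennreal (\<kappa>\<^sup>2) * (N j * M k))"
        by (intro mult_right_mono mult_left_mono JJ) simp_all
      also have "\<dots> = (ennreal (\<kappa>\<^sup>2) * J') * (K (k - j) * ((ennreal (2 powr (s * of_int j)) * N j) * (ennreal (2 powr ((1 - s) * of_int k)) * M k)))"
        unfolding ex K_def by (simp add: ennreal_mult mult_ac)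
      finally show "(\<integral>\<^sup>+y. g j k y \<partial>lborel) \<le> (ennreal (\<kappa>\<^sup>2) * J') * (K (k - j) * ((ennreal (2 powr (s * of_int j)) * N j) * (ennreal (2 powr ((1 - s) * of_int k)) * M k)))" .
    qed
    also have "\<dots> = (ennreal (\<kappa>\<^sup>2) * J') * (\<integral>\<^sup>+j. \<integral>\<^sup>+k. K (k - j) * ((ennreal (2 powr (s * of_int j)) * N j) * (ennreal (2 powr ((1 - s) * of_int k)) * M k)) \<partial>CS \<partial>CS)"
      by (simp add: nn_integral_cmult)
    also have "\<dots> \<le> (ennreal (\<kappa>\<^sup>2) * J') * ((\<integral>\<^sup>+i. K i \<partial>CS) * (besov_norm \<phi> L T s p r u * besov_norm \<phi> L T (1 - s) p' r' v))"
      unfolding besov_norm_eq_Lp_ennreal[OF r(1)] besov_norm_eq_Lp_ennreal[OF r(2)] N_def M_def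
      by (intro mult_left_mono discrete_Young r) simp
    finally show ?thesis by (simp add: E_def mult.assoc)
  qed
  note bound = this
  show thesis
    by (rule that[OF C]) (rule order_trans[OF bound mult_right_mono[OF EC]], simp_all)
qed

end

section \<open>Pairing with \<open>|\<partial>\<^sub>x|\<close>\<close>

text \<open>Expand both sides. By translation over a period, \<open>v(x + y) f(x + y)\<close> and \<open>v(x) f(x)\<close> have the same integral,
and so have \<open>v(x + y) f(x)\<close> and \<open>v(x) f(x - y)\<close>.\<close>

lemma set_integral_symmetrize:
  fixes v f :: "real \<Rightarrow> real"
  assumes "0 < L" and v: "continuous_on UNIV v" "\<And>x. v (x + L) = v x"
    and f: "continuous_on UNIV f" "\<And>x. f (x + L) = f x"
  shows "(LINT x:{0..L}|lborel. v x * (f x - (f (x + y) + f (x - y)) / 2))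
    = (LINT x:{0..L}|lborel. (v (x + y) - v x) * (f (x + y) - f x)) / 2"
proof -
  have per': "v (x + L + c) = v (x + c)" "f (x + L + c) = f (x + c)" "f (x + L - c) = f (x - c)" for x c
    using v(2)[of "x + c"] f(2)[of "x + c"] f(2)[of "x - c"] by (simp_all add: algebra_simps)
  have c: "continuous_on UNIV (\<lambda>x. v (x + c))" "continuous_on UNIV (\<lambda>x. f (x + c))" "continuous_on UNIV (\<lambda>x. f (x - c))" for c
    by (intro continuous_on_compose2[OF v(1)] continuous_on_compose2[OF f(1)] continuous_intros subset_UNIV)+
  have cs: "continuous_on S (\<lambda>x. v (x + c))" "continuous_on S (\<lambda>x. f (x + c))" "continuous_on S (\<lambda>x. f (x - c))"
    "continuous_on S v" "continuous_on S f" for S c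
    using c v(1) f(1) by (auto intro: continuous_on_subset)
  have i: "set_integrable lborel {0..L} (\<lambda>x. v x * f x)"
    "set_integrable lborel {0..L} (\<lambda>x. v x * f (x + y))"
    "set_integrable lborel {0..L} (\<lambda>x. v x * f (x - y))"
    "set_integrable lborel {0..L} (\<lambda>x. v (x + y) * f x)"
    "set_integrable lborel {0..L} (\<lambda>x. v (x + y) * f (x + y))"
    by (intro set_integrable_continuous continuous_intros cs)+
  have A: "(LINT x:{0..L}|lborel. v (x + y) * f (x + y)) = (LINT x:{0..L}|lborel. v x * f x)"
    by (rule set_integral_period_shift[of "\<lambda>x. v x * f x"])
       (use \<open>0 < L\<close> v f in \<open>auto intro!: continuous_intros\<close>)
  have B: "(LINT x:{0..L}|lborel. v (x + y) * f x) = (LINT x:{0..L}|lborel. v x * f (x - y))"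
    using set_integral_period_shift[of "\<lambda>x. v x * f (x - y)" L y] \<open>0 < L\<close> v(2) per'
    by (simp add: continuous_intros cs)
  have "v x * (f x - (f (x + y) + f (x - y)) / 2) = v x * f x - (v x * f (x + y) + v x * f (x - y)) * (1/2)" for x
    by (simp add: algebra_simps)
  then have "(LINT x:{0..L}|lborel. v x * (f x - (f (x + y) + f (x - y)) / 2))
    = (LINT x:{0..L}|lborel. v x * f x) - ((LINT x:{0..L}|lborel. v x * f (x + y)) + (LINT x:{0..L}|lborel. v x * f (x - y))) / 2"
    using i by (simp add: set_integral_diff set_integral_add set_integral_mult_left)
  moreover have "(v (x + y) - v x) * (f (x + y) - f x) = v (x + y) * f (x + y) - v (x + y) * f x - v x * f (x + y) + v x * f x" for x
    by (simp add: algebra_simps)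
  then have "(LINT x:{0..L}|lborel. (v (x + y) - v x) * (f (x + y) - f x))
     = (LINT x:{0..L}|lborel. v (x + y) * f (x + y)) - (LINT x:{0..L}|lborel. v (x + y) * f x) - (LINT x:{0..L}|lborel. v x * f (x + y)) + (LINT x:{0..L}|lborel. v x * f x)"
    using i by (simp add: set_integral_diff set_integral_add)
  moreover have "P = Q / 2" if "P = A - (B + C) / 2" "Q = A - C - B + A" for P Q A B C :: real
    using that by (simp add: field_simps)
  ultimately show ?thesis unfolding A B by blast
qed

text \<open>The uniform bound \<open>W\<close> is the absolutely convergent sum of \<open>2\<pi>\<bar>n\<bar> / L\<close> times the coefficients, up to the constant
\<open>C0\<close>; it justifies exchanging the integrals in \<open>x\<close> and \<open>y\<close>.\<close>

lemma abs_dx_singular_integral: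
  assumes "0 < L" "wiener L f"
  defines "D x y \<equiv> (f x - (f (x + y) + f (x - y)) / 2) / y\<^sup>2"
  shows "(LINT y|lborel. D x y) = C0 * Re (abs_dx L f x)"
    and "\<exists>W\<ge>0. \<forall>x. (\<integral>\<^sup>+y. ennreal \<bar>D x y\<bar> \<partial>lborel) \<le> ennreal W"
proof -
  let ?b = "fourier_coeff L f"
  have b: "integrable CS ?b" "integrable CS (\<lambda>n. of_int \<bar>n\<bar> * ?b n)" "\<And>x. of_real (f x) = trig L ?b x"
    using assms(2) by (auto simp: wiener_def)
  have e: "(trig L ?b x - (trig L ?b (x + y) + trig L ?b (x - y)) / 2) / of_real (y\<^sup>2) = complex_of_real (D x y)" for x y
    by (simp add: b(3)[symmetric] D_def)
  note S = trig_singular_integral[OF assms(1) b(1,2), unfolded e]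
  have "complex_of_real (LINT y|lborel. D x y) = of_real C0 * abs_dx L f x"
    using S(2)[of x] by (simp only: integral_complex_of_real abs_dx_eq_trig[OF b(2)])
  from arg_cong[OF this, of Re] show "(LINT y|lborel. D x y) = C0 * Re (abs_dx L f x)" by simp
  show "\<exists>W\<ge>0. \<forall>x. (\<integral>\<^sup>+y. ennreal \<bar>D x y\<bar> \<partial>lborel) \<le> ennreal W"
  proof (intro exI conjI allI)
    show "0 \<le> (LINT n|CS. C0 * (2 * pi / L) * norm (of_int \<bar>n\<bar> * ?b n))"
      using C0_pos \<open>0 < L\<close> by (intro Bochner_Integration.integral_nonneg) simp
    show "(\<integral>\<^sup>+y. ennreal \<bar>D x y\<bar> \<partial>lborel) \<le> ennreal (LINT n|CS. C0 * (2 * pi / L) * norm (of_int \<bar>n\<bar> * ?b n))" for x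
      using S(3)[of x] by (simp only: norm_of_real)
  qed
qed

text \<open>The operator \<open>|\<partial>\<^sub>x|\<close> is half of a derivative on each factor: after symmetrisation only increments of \<open>v\<close>
occur. This is why a merely Lipschitz function of \<open>u\<close>, such as \<open>\<bar>u(x + h) - u(x)\<bar>\<close>, is as good a test
function as \<open>u\<close>. The double integral converges absolutely because the second difference of \<open>f\<close>, and not a
first difference, stands next to \<open>y powi (-2)\<close> before symmetrisation.\<close>

lemma abs_dx_pairing_le:
  assumes "0 < L" and f: "wiener L f" and v: "continuous_on UNIV v" "\<And>x. v (x + L) = v x"
  shows "ennreal (C0 * \<bar>LINT x:{0..L}|lborel. v x * Re (abs_dx L f x)\<bar>)
    \<le> (\<integral>\<^sup>+y. ennreal (1 / y\<^sup>2) * (\<integral>\<^sup>+x. ennreal (\<bar>v (x + y) - v x\<bar> * \<bar>f (x + y) - f x\<bar>) * indicator {0..L} x \<partial>lborel) \<partial>lborel)"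
proof -
  define D where "D x y = (f x - (f (x + y) + f (x - y)) / 2) / y\<^sup>2" for x y
  note D = abs_dx_singular_integral[OF assms(1,2), folded D_def]
  obtain W where W: "0 \<le> W" "\<And>x. (\<integral>\<^sup>+y. ennreal \<bar>D x y\<bar> \<partial>lborel) \<le> ennreal W" using D(2) by blast
  obtain B where B: "\<And>x. norm (v x) \<le> B" using continuous_periodic_bounded[OF assms(1) v] by blast
  have B0: "0 \<le> B" using B[of 0] norm_ge_zero order_trans by blast
  have fc: "continuous_on UNIV f" using f by (simp add: wiener_def)
  have fp: "f (x + L) = f x" for x
  proof -
    have "complex_of_real (f (x + L)) = of_real (f x)"
      using f \<open>0 < L\<close> unfolding wiener_def by (simp add: trig_period del: of_real_eq_iff)
    then show ?thesis by simp
  qed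
  have [measurable]: "f \<in> borel_measurable borel" "v \<in> borel_measurable borel"
    using fc v(1) by (auto intro: borel_measurable_continuous_onI)
  define G where "G x y = indicator {0..L} x * (v x * D x y)" for x y
  have Gm: "(\<lambda>(x, y). G x y) \<in> borel_measurable (lborel \<Otimes>\<^sub>M lborel)"
    unfolding G_def D_def by measurable
  have "(\<integral>\<^sup>+p. ennreal (norm (case p of (x, y) \<Rightarrow> G x y)) \<partial>(lborel \<Otimes>\<^sub>M lborel)) = (\<integral>\<^sup>+x. \<integral>\<^sup>+y. ennreal (norm (G x y)) \<partial>lborel \<partial>lborel)"
    by (subst lborel.nn_integral_fst[symmetric]) (use Gm in \<open>auto simp: case_prod_beta'\<close>)
  also have "\<dots> \<le> (\<integral>\<^sup>+x. ennreal (B * W) * indicator {0..L} x \<partial>lborel)"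
  proof (rule nn_integral_mono)
    fix x
    have "(\<integral>\<^sup>+y. ennreal (norm (G x y)) \<partial>lborel) \<le> (\<integral>\<^sup>+y. ennreal (B * indicator {0..L} x) * ennreal \<bar>D x y\<bar> \<partial>lborel)"
      using B[of x] B0 by (intro nn_integral_mono)
        (auto simp: G_def abs_mult ennreal_mult[symmetric] intro!: ennreal_leI mult_right_mono split: split_indicator)
    also have "\<dots> = ennreal (B * indicator {0..L} x) * (\<integral>\<^sup>+y. ennreal \<bar>D x y\<bar> \<partial>lborel)"
      by (rule nn_integral_cmult) (simp add: D_def)
    also have "\<dots> \<le> ennreal (B * indicator {0..L} x) * ennreal W" by (intro mult_left_mono W(2)) simp
    also have "\<dots> = ennreal (B * W) * indicator {0..L} x"
      using B0 W(1) by (auto simp: ennreal_mult split: split_indicator)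
    finally show "(\<integral>\<^sup>+y. ennreal (norm (G x y)) \<partial>lborel) \<le> ennreal (B * W) * indicator {0..L} x" .
  qed
  also have "\<dots> < \<infinity>" by (subst nn_integral_cmult_indicator) (use \<open>0 < L\<close> in \<open>auto simp: ennreal_mult_less_top\<close>)
  finally have Gi: "integrable (lborel \<Otimes>\<^sub>M lborel) (\<lambda>(x, y). G x y)"
    using Gm by (intro integrableI_bounded) auto
  have "(LINT y|lborel. LINT x|lborel. G x y) = (LINT x|lborel. LINT y|lborel. G x y)"
    by (rule lborel_pair.Fubini_integral[OF Gi])
  also have "\<dots> = (LINT x|lborel. indicator {0..L} x * (v x * (C0 * Re (abs_dx L f x))))"
    by (simp only: G_def integral_mult_right_zero D(1))
  also have "\<dots> = (LINT x:{0..L}|lborel. C0 * (v x * Re (abs_dx L f x)))"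
    by (simp add: set_lebesgue_integral_def mult_ac)
  also have "\<dots> = C0 * (LINT x:{0..L}|lborel. v x * Re (abs_dx L f x))"
    by (rule set_integral_mult_right)
  finally have eq: "C0 * (LINT x:{0..L}|lborel. v x * Re (abs_dx L f x)) = (LINT y|lborel. LINT x|lborel. G x y)" ..
  have inner: "ennreal \<bar>LINT x|lborel. G x y\<bar> \<le> ennreal (1 / y\<^sup>2) * (\<integral>\<^sup>+x. ennreal (\<bar>v (x + y) - v x\<bar> * \<bar>f (x + y) - f x\<bar>) * indicator {0..L} x \<partial>lborel)" for y
  proof -
    let ?I = "LINT x:{0..L}|lborel. (v (x + y) - v x) * (f (x + y) - f x)"
    have "(LINT x|lborel. G x y) = (LINT x:{0..L}|lborel. (v x * (f x - (f (x + y) + f (x - y)) / 2)) / y\<^sup>2)"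
      by (simp add: G_def D_def set_lebesgue_integral_def)
    also have "\<dots> = (?I / 2) / y\<^sup>2"
      unfolding set_integral_symmetrize[OF assms(1) v fc fp, of y, symmetric] by simp
    finally have "\<bar>LINT x|lborel. G x y\<bar> = (1 / y\<^sup>2) * (\<bar>?I\<bar> / 2)" by (simp add: abs_mult)
    also have "\<dots> \<le> (1 / y\<^sup>2) * \<bar>?I\<bar>" by (intro mult_left_mono) auto
    finally have "ennreal \<bar>LINT x|lborel. G x y\<bar> \<le> ennreal (1 / y\<^sup>2) * ennreal \<bar>?I\<bar>"
      by (simp add: ennreal_mult[symmetric] ennreal_leI)
    also have "\<dots> \<le> ennreal (1 / y\<^sup>2) * (\<integral>\<^sup>+x. ennreal (\<bar>v (x + y) - v x\<bar> * \<bar>f (x + y) - f x\<bar>) * indicator {0..L} x \<partial>lborel)"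
    proof (rule mult_left_mono)
      have c: "continuous_on {0..L} (\<lambda>x. (v (x + y) - v x) * (f (x + y) - f x))"
        by (intro continuous_intros continuous_on_compose2[OF v(1)] continuous_on_compose2[OF fc] continuous_on_subset[OF v(1)] continuous_on_subset[OF fc] subset_UNIV)
      have "ennreal (norm ?I) \<le> (\<integral>\<^sup>+x. norm (indicat_real {0..L} x *\<^sub>R ((v (x + y) - v x) * (f (x + y) - f x))) \<partial>lborel)"
        unfolding set_lebesgue_integral_def
        by (rule integral_norm_bound_ennreal) (use set_integrable_continuous[OF c] in \<open>simp add: set_integrable_def\<close>)
      also have "\<dots> = (\<integral>\<^sup>+x. ennreal (\<bar>v (x + y) - v x\<bar> * \<bar>f (x + y) - f x\<bar>) * indicator {0..L} x \<partial>lborel)"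
        by (intro nn_integral_cong) (auto simp: abs_mult split: split_indicator)
      finally show "ennreal \<bar>?I\<bar> \<le> (\<integral>\<^sup>+x. ennreal (\<bar>v (x + y) - v x\<bar> * \<bar>f (x + y) - f x\<bar>) * indicator {0..L} x \<partial>lborel)"
        by simp
    qed simp
    finally show ?thesis .
  qed
  have "integrable lborel (\<lambda>y. LINT x|lborel. G x y)" by (rule lborel_pair.integrable_snd[OF Gi])
  from integral_norm_bound_ennreal[OF this]
  have "ennreal \<bar>LINT y|lborel. LINT x|lborel. G x y\<bar> \<le> (\<integral>\<^sup>+y. ennreal \<bar>LINT x|lborel. G x y\<bar> \<partial>lborel)" by simp
  also have "\<dots> \<le> (\<integral>\<^sup>+y. ennreal (1 / y\<^sup>2) * (\<integral>\<^sup>+x. ennreal (\<bar>v (x + y) - v x\<bar> * \<bar>f (x + y) - f x\<bar>) * indicator {0..L} x \<partial>lborel) \<partial>lborel)"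
    by (intro nn_integral_mono inner)
  finally show ?thesis using C0_pos by (simp add: eq[symmetric] abs_mult)
qed

lemma ennreal_abs_set_integral_le:
  fixes g :: "real \<Rightarrow> real"
  shows "ennreal \<bar>LINT t:A|lborel. g t\<bar> \<le> (\<integral>\<^sup>+t. ennreal \<bar>g t\<bar> * indicator A t \<partial>lborel)"
proof (cases "set_integrable lborel A g")
  case True
  then have "ennreal (norm (LINT t:A|lborel. g t)) \<le> (\<integral>\<^sup>+t. norm (indicat_real A t *\<^sub>R g t) \<partial>lborel)"
    unfolding set_lebesgue_integral_def set_integrable_def by (rule integral_norm_bound_ennreal)
  also have "\<dots> = (\<integral>\<^sup>+t. ennreal \<bar>g t\<bar> * indicator A t \<partial>lborel)"
    by (intro nn_integral_cong) (auto split: split_indicator)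
  finally show ?thesis by simp
next
  case False
  then show ?thesis
    by (simp add: set_lebesgue_integral_def set_integrable_def not_integrable_integral_eq)
qed

text \<open>What the bilinear estimate needs from a test function \<open>w\<close>: its increments are bounded by those
  of two translates of \<open>u\<close>. Both \<open>u\<close> itself and \<open>\<bar>u(x + h) - u(x)\<bar>\<close> qualify; the latter is only Lipschitz in
  \<open>x\<close> and is accessible through its increments rather than through its Littlewood-Paley pieces.\<close>

definition controlled_by :: "real \<Rightarrow> (real \<Rightarrow> real \<Rightarrow> real) \<Rightarrow> (real \<Rightarrow> real \<Rightarrow> real) \<Rightarrow> bool" where
  "controlled_by L u w \<longleftrightarrow> (\<forall>t. continuous_on UNIV (w t)) \<and> (\<forall>t x. w t (x + L) = w t x) \<and>
     (\<exists>a b. \<forall>t x y. \<bar>w t x - w t y\<bar> \<le> \<bar>u t (x + a) - u t (y + a)\<bar> + \<bar>u t (x + b) - u t (y + b)\<bar>)"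

text \<open>The bound is stated through a measurable majorant \<open>\<Phi>\<close>, so that bounds for two functions \<open>f\<close> can
  be added without knowing that the pairings are measurable in time.\<close>

definition abs_dx_pairing_bounded ::
  "real \<Rightarrow> real \<Rightarrow> (real \<Rightarrow> real \<Rightarrow> real) \<Rightarrow> (real \<Rightarrow> real \<Rightarrow> real) \<Rightarrow> ennreal \<Rightarrow> bool" where
  "abs_dx_pairing_bounded L T w f B \<longleftrightarrow> (\<exists>\<Phi>\<in>borel_measurable borel.
     (\<forall>t. ennreal \<bar>LINT x:{0..L}|lborel. w t x * Re (abs_dx L (f t) x)\<bar> \<le> \<Phi> t) \<and>
     (\<integral>\<^sup>+t. \<Phi> t * indicator {0..T} t \<partial>lborel) \<le> B)"

context LP_family
begin

text \<open>Bound the increments of \<open>w\<close> by those of the two translates of \<open>u\<close>, replace increments by the sums of the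
increments of the pieces, and apply the bilinear estimate once for each translate.\<close>

lemma abs_dx_bilinear:
  assumes s: "0 < s" "s < 1"
    and r: "1 \<le> r" "1 \<le> r'" "1 / r + 1 / r' = 1" and p: "1 \<le> p" "1 \<le> p'" "1 / p + 1 / p' = 1"
  obtains C :: real where "0 < C" "\<And>L T u \<xi> w. 0 < L \<Longrightarrow> admissible L u \<Longrightarrow> admissible L \<xi> \<Longrightarrow> controlled_by L u w \<Longrightarrow>
    abs_dx_pairing_bounded L T w \<xi> (ennreal C * (besov_norm \<phi> L T s p r u * besov_norm \<phi> L T (1 - s) p' r' \<xi>))"
proof -
  obtain C where C: "0 < C" "\<And>L T u v a. 0 < L \<Longrightarrow> admissible L u \<Longrightarrow> admissible L v \<Longrightarrow>
    (\<integral>\<^sup>+y. ennreal (1 / y\<^sup>2) * (\<integral>\<^sup>+z. (\<integral>\<^sup>+j. incr j u y (fst z) (snd z + a) \<partial>CS)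
       * (\<integral>\<^sup>+k. incr k v y (fst z) (snd z) \<partial>CS) \<partial>strip T L) \<partial>lborel)
    \<le> ennreal C * (besov_norm \<phi> L T s p r u * besov_norm \<phi> L T (1 - s) p' r' v)"
    using bilinear_increments_le[OF s r p] by blast
  have "abs_dx_pairing_bounded L T w \<xi> (ennreal (2 * C / C0) * (besov_norm \<phi> L T s p r u * besov_norm \<phi> L T (1 - s) p' r' \<xi>))"
    if L: "0 < L" and u: "admissible L u" and \<xi>: "admissible L \<xi>" and ctrl: "controlled_by L u w" for L T u \<xi> w
  proof -
    obtain a b where w: "\<And>t. continuous_on UNIV (w t)" "\<And>t x. w t (x + L) = w t x"
      "\<And>t x y. \<bar>w t x - w t y\<bar> \<le> \<bar>u t (x + a) - u t (y + a)\<bar> + \<bar>u t (x + b) - u t (y + b)\<bar>"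
      using ctrl unfolding controlled_by_def by blast
    define H where "H u y t x = (\<integral>\<^sup>+j. incr j u y t x \<partial>CS)" for u y t x
    have Hm[measurable (raw)]: "(\<lambda>q. H u (f q) (g q) (h q)) \<in> borel_measurable M"
      "(\<lambda>q. H \<xi> (f q) (g q) (h q)) \<in> borel_measurable M"
      if [measurable]: "f \<in> borel_measurable M" "g \<in> borel_measurable M" "h \<in> borel_measurable M"
      for f g h :: "'b \<Rightarrow> real" and M
      unfolding H_def incr_def using u \<xi> by (intro measurable_nn_integral_CS(2); measurable)+
    have Hu: "ennreal \<bar>u t (x + y) - u t x\<bar> \<le> H u y t x" and H\<xi>: "ennreal \<bar>\<xi> t (x + y) - \<xi> t x\<bar> \<le> H \<xi> y t x" for t x y
      unfolding H_def incr_def using increment_le_sum_pieces[where u=u and t=t and L=L] increment_le_sum_pieces[where u=\<xi> and t=t and L=L] u \<xi>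
      by (auto simp: admissible_def)
    define F where "F y t x = (H u y t (x + a) + H u y t (x + b)) * H \<xi> y t x" for y t x
    have Fm[measurable (raw)]: "(\<lambda>q. F (f q) (g q) (h q)) \<in> borel_measurable M"
      if [measurable]: "f \<in> borel_measurable M" "g \<in> borel_measurable M" "h \<in> borel_measurable M"
      for f g h :: "'b \<Rightarrow> real" and M
      unfolding F_def by measurable
    have Fle: "ennreal (\<bar>w t (x + y) - w t x\<bar> * \<bar>\<xi> t (x + y) - \<xi> t x\<bar>) \<le> F y t x" for t x y
    proof -
      have "ennreal \<bar>w t (x + y) - w t x\<bar> \<le> ennreal \<bar>u t (x + y + a) - u t (x + a)\<bar> + ennreal \<bar>u t (x + y + b) - u t (x + b)\<bar>"
        using w(3)[of t "x + y" x] by (simp add: ennreal_plus[symmetric] ennreal_leI del: ennreal_plus)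
      also have "\<dots> \<le> H u y t (x + a) + H u y t (x + b)"
        using Hu[of t "x + a" y] Hu[of t "x + b" y] by (intro add_mono) (simp_all add: ac_simps)
      finally show ?thesis unfolding F_def using H\<xi>[of t x y] by (simp add: ennreal_mult mult_mono)
    qed
    define \<Psi> where "\<Psi> t = (\<integral>\<^sup>+y. ennreal (1 / y\<^sup>2) * (\<integral>\<^sup>+x. F y t x * indicator {0..L} x \<partial>lborel) \<partial>lborel)" for t
    have [measurable]: "\<Psi> \<in> borel_measurable borel" unfolding \<Psi>_def[abs_def] by measurable
    have unit: "ennreal (1 / C0) * (ennreal C0 * x) = x" for x
      using C0_pos by (simp add: mult.assoc[symmetric] ennreal_mult[symmetric])
    have pointwise: "ennreal \<bar>LINT x:{0..L}|lborel. w t x * Re (abs_dx L (\<xi> t) x)\<bar> \<le> ennreal (1 / C0) * \<Psi> t" for t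
    proof -
      have "ennreal C0 * ennreal \<bar>LINT x:{0..L}|lborel. w t x * Re (abs_dx L (\<xi> t) x)\<bar>
        \<le> (\<integral>\<^sup>+y. ennreal (1 / y\<^sup>2) * (\<integral>\<^sup>+x. ennreal (\<bar>w t (x + y) - w t x\<bar> * \<bar>\<xi> t (x + y) - \<xi> t x\<bar>) * indicator {0..L} x \<partial>lborel) \<partial>lborel)"
        using abs_dx_pairing_le[OF L _ w(1) w(2), of "\<xi> t" t] \<xi> C0_pos by (simp add: admissible_def ennreal_mult)
      also have "\<dots> \<le> \<Psi> t"
        unfolding \<Psi>_def by (intro nn_integral_mono mult_left_mono mult_right_mono Fle) simp_all
      finally show ?thesis using unit mult_left_mono[of _ _ "ennreal (1 / C0)"] by (metis zero_le)
    qed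
    have "(\<integral>\<^sup>+t. \<Psi> t * indicator {0..T} t \<partial>lborel) = (\<integral>\<^sup>+t. (\<integral>\<^sup>+y. ennreal (1 / y\<^sup>2) * (\<integral>\<^sup>+x. F y t x * indicator {0..L} x \<partial>lborel) \<partial>lborel) * indicator {0..T} t \<partial>lborel)"
      by (simp only: \<Psi>_def)
    also have "\<dots> = (\<integral>\<^sup>+t. \<integral>\<^sup>+y. ennreal (1 / y\<^sup>2) * (\<integral>\<^sup>+x. F y t x * indicator {0..L} x \<partial>lborel) * indicator {0..T} t \<partial>lborel \<partial>lborel)"
      by (intro nn_integral_cong nn_integral_multc[symmetric]) measurable
    also have "\<dots> = (\<integral>\<^sup>+y. \<integral>\<^sup>+t. ennreal (1 / y\<^sup>2) * (\<integral>\<^sup>+x. F y t x * indicator {0..L} x \<partial>lborel) * indicator {0..T} t \<partial>lborel \<partial>lborel)"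
      by (rule lborel_pair.Fubini') measurable
    also have "\<dots> = (\<integral>\<^sup>+y. ennreal (1 / y\<^sup>2) * (\<integral>\<^sup>+z. F y (fst z) (snd z) \<partial>strip T L) \<partial>lborel)"
    proof (rule nn_integral_cong)
      fix y :: real
      have mF: "(\<lambda>z. F y (fst z) (snd z)) \<in> borel_measurable (borel \<Otimes>\<^sub>M borel)"
        by (rule Fm) measurable
      have "(\<integral>\<^sup>+z. F y (fst z) (snd z) \<partial>strip T L) = (\<integral>\<^sup>+t. (\<integral>\<^sup>+x. F y t x * indicator {0..L} x \<partial>lborel) * indicator {0..T} t \<partial>lborel)"
        using nn_integral_strip[OF mF, of T L] by simp
      then show "(\<integral>\<^sup>+t. ennreal (1 / y\<^sup>2) * (\<integral>\<^sup>+x. F y t x * indicator {0..L} x \<partial>lborel) * indicator {0..T} t \<partial>lborel)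
        = ennreal (1 / y\<^sup>2) * (\<integral>\<^sup>+z. F y (fst z) (snd z) \<partial>strip T L)"
        by (subst mult.assoc) (simp add: nn_integral_cmult)
    qed
    also have "\<dots> = (\<integral>\<^sup>+y. ennreal (1 / y\<^sup>2) * (\<integral>\<^sup>+z. H u y (fst z) (snd z + a) * H \<xi> y (fst z) (snd z) \<partial>strip T L)
       + ennreal (1 / y\<^sup>2) * (\<integral>\<^sup>+z. H u y (fst z) (snd z + b) * H \<xi> y (fst z) (snd z) \<partial>strip T L) \<partial>lborel)"
      unfolding F_def distrib_right by (intro nn_integral_cong) (subst nn_integral_add, measurable, simp add: distrib_left)
    also have "\<dots> = (\<integral>\<^sup>+y. ennreal (1 / y\<^sup>2) * (\<integral>\<^sup>+z. H u y (fst z) (snd z + a) * H \<xi> y (fst z) (snd z) \<partial>strip T L) \<partial>lborel)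
       + (\<integral>\<^sup>+y. ennreal (1 / y\<^sup>2) * (\<integral>\<^sup>+z. H u y (fst z) (snd z + b) * H \<xi> y (fst z) (snd z) \<partial>strip T L) \<partial>lborel)"
      by (intro nn_integral_add borel_measurable_times_ennreal sigma_finite_measure.borel_measurable_nn_integral[OF sigma_finite_strip])
         measurable
    also have "\<dots> \<le> ennreal C * (besov_norm \<phi> L T s p r u * besov_norm \<phi> L T (1 - s) p' r' \<xi>)
        + ennreal C * (besov_norm \<phi> L T s p r u * besov_norm \<phi> L T (1 - s) p' r' \<xi>)"
      unfolding H_def by (intro add_mono C(2) L u \<xi>)
    also have "\<dots> = ennreal (2 * C) * (besov_norm \<phi> L T s p r u * besov_norm \<phi> L T (1 - s) p' r' \<xi>)"
      using C(1) by (simp add: distrib_right[symmetric] ennreal_plus[symmetric] del: ennreal_plus)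
    finally have main: "(\<integral>\<^sup>+t. \<Psi> t * indicator {0..T} t \<partial>lborel)
      \<le> ennreal (2 * C) * (besov_norm \<phi> L T s p r u * besov_norm \<phi> L T (1 - s) p' r' \<xi>)" .
    have "(\<integral>\<^sup>+t. ennreal (1 / C0) * \<Psi> t * indicator {0..T} t \<partial>lborel) = ennreal (1 / C0) * (\<integral>\<^sup>+t. \<Psi> t * indicator {0..T} t \<partial>lborel)"
      by (simp add: mult.assoc nn_integral_cmult)
    also have "\<dots> \<le> ennreal (1 / C0) * (ennreal (2 * C) * (besov_norm \<phi> L T s p r u * besov_norm \<phi> L T (1 - s) p' r' \<xi>))"
      by (rule mult_left_mono[OF main]) simp
    also have "\<dots> = ennreal (2 * C / C0) * (besov_norm \<phi> L T s p r u * besov_norm \<phi> L T (1 - s) p' r' \<xi>)"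
      using C0_pos C(1) by (simp add: mult.assoc[symmetric] ennreal_mult[symmetric])
    finally show ?thesis unfolding abs_dx_pairing_bounded_def using pointwise by (intro bexI[of _ "\<lambda>t. ennreal (1 / C0) * \<Psi> t"]) auto
  qed
  note bound = this
  show thesis by (rule that[of "2 * C / C0"]) (use C(1) C0_pos in simp, rule bound)
qed

end

section \<open>The Karman-Howarth-Monin identity and the energy identity\<close>

lemma integral_FTC:
  fixes F :: "real \<Rightarrow> real"
  assumes "a \<le> b" "\<And>x. x \<in> {a..b} \<Longrightarrow> (F has_real_derivative f x) (at x within {a..b})"
  shows "integral {a..b} f = F b - F a" "f integrable_on {a..b}"
  using fundamental_theorem_of_calculus[OF assms(1), of F f] assms(2)
  by (auto simp: has_real_derivative_iff_has_vector_derivative integral_unique integrable_on_def)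

lemma continuous_on_section:
  fixes f :: "real \<Rightarrow> real \<Rightarrow> 'a::topological_space"
  assumes "continuous_on (S \<times> A) (\<lambda>(t, x). f t x)"
  shows "t \<in> S \<Longrightarrow> continuous_on A (f t)" "x \<in> A \<Longrightarrow> continuous_on S (\<lambda>t. f t x)"
proof -
  show "continuous_on A (f t)" if "t \<in> S"
    using continuous_on_compose2[OF assms, of A, OF continuous_on_Pair, of "\<lambda>_. t" "\<lambda>x. x"] that by auto
  show "continuous_on S (\<lambda>t. f t x)" if "x \<in> A"
    using continuous_on_compose2[OF assms, of S, OF continuous_on_Pair, of "\<lambda>t. t" "\<lambda>_. x"] that by auto
qed

lemma continuous_on_inner_integral:
  fixes f :: "real \<Rightarrow> real \<Rightarrow> real"
  assumes "continuous_on (S \<times> {a..b}) (\<lambda>(t, x). f t x)"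
  shows "continuous_on S (\<lambda>t. integral {a..b} (f t))"
  using integral_continuous_on_param[of S a b f] assms by simp

lemma integral_swap:
  fixes f :: "real \<Rightarrow> real \<Rightarrow> real"
  assumes "continuous_on ({a..b} \<times> {c..d}) (\<lambda>(t, x). f t x)"
  shows "integral {a..b} (\<lambda>t. integral {c..d} (f t)) = integral {c..d} (\<lambda>x. integral {a..b} (\<lambda>t. f t x))"
  using integral_swap_continuous[of a c b d f] assms by (simp add: cbox_Pair_eq)

lemma set_integral_eq_integral:
  fixes f :: "real \<Rightarrow> real"
  shows "continuous_on {a..b} f \<Longrightarrow> (LINT x:{a..b}|lborel. f x) = integral {a..b} f"
  by (rule set_borel_integral_eq_integral(2)[OF set_integrable_continuous])

lemma integral_period_shift:
  fixes f :: "real \<Rightarrow> real"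
  assumes f: "continuous_on UNIV f" and per: "\<And>x. f (x + L) = f x" and "0 < L"
  shows "integral {0..L} (\<lambda>x. f (x + a)) = integral {0..L} f"
proof -
  have c: "continuous_on {0..L} (\<lambda>x. f (x + a))"
    by (intro continuous_on_compose2[OF f] continuous_intros) auto
  show ?thesis
    using set_integral_period_shift[OF assms, of a]
    by (simp only: set_integral_eq_integral[OF c] set_integral_eq_integral[OF continuous_on_subset[OF f subset_UNIV]])
qed

text \<open>Fundamental theorem of calculus in time, Fubini, and the vanishing of the flux over a period.\<close>

lemma balance_law:
  fixes P p Q q :: "real \<Rightarrow> real \<Rightarrow> real"
  assumes "0 \<le> T" "0 \<le> L"
    and P: "\<And>t x. t \<in> {0..T} \<Longrightarrow> ((\<lambda>\<tau>. P \<tau> x) has_real_derivative p t x) (at t within {0..T})"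
    and Q: "\<And>t x. t \<in> {0..T} \<Longrightarrow> (Q t has_real_derivative q t x) (at x)"
    and per: "\<And>t. t \<in> {0..T} \<Longrightarrow> Q t L = Q t 0"
    and p: "continuous_on ({0..T} \<times> {0..L}) (\<lambda>(t, x). p t x)"
  shows "integral {0..L} (\<lambda>x. P T x - P 0 x) = integral {0..T} (\<lambda>t. integral {0..L} (\<lambda>x. p t x + q t x))"
proof -
  have "integral {0..L} (\<lambda>x. P T x - P 0 x) = integral {0..L} (\<lambda>x. integral {0..T} (\<lambda>t. p t x))"
    using integral_FTC(1)[OF assms(1) P] by (intro Henstock_Kurzweil_Integration.integral_cong) simp
  also have "\<dots> = integral {0..T} (\<lambda>t. integral {0..L} (p t))" by (rule integral_swap[OF p, symmetric])
  also have "\<dots> = integral {0..T} (\<lambda>t. integral {0..L} (\<lambda>x. p t x + q t x))"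
  proof (rule Henstock_Kurzweil_Integration.integral_cong)
    fix t assume t: "t \<in> {0..T}"
    have Q': "(Q t has_real_derivative q t x) (at x within {0..L})" for x
      using Q[OF t] by (rule DERIV_subset) simp
    have "p t integrable_on {0..L}"
      using integrable_continuous_interval[OF continuous_on_section(1)[OF p t]] .
    then have "integral {0..L} (\<lambda>x. p t x + q t x) = integral {0..L} (p t) + integral {0..L} (q t)"
      by (rule Henstock_Kurzweil_Integration.integral_add) (rule integral_FTC(2)[OF assms(2) Q'])
    also have "integral {0..L} (q t) = 0"
      using integral_FTC(1)[OF assms(2) Q'] per[OF t] by simp
    finally show "integral {0..L} (p t) = integral {0..L} (\<lambda>x. p t x + q t x)" by simp
  qed
  finally show ?thesis .
qed

text \<open>The weight \<open>\<bar>w\<bar>\<close> is the derivative of a function that is continuously differentiable even at \<open>w = 0\<close>, so the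
chain rule applies without regularising the absolute value.\<close>

lemma has_real_derivative_abs_mult_self:
  "((\<lambda>x. x * \<bar>x\<bar>) has_real_derivative 2 * \<bar>a\<bar>) (at a within S)" for a :: real
proof -
  have "((\<lambda>x. x * \<bar>x\<bar>) has_real_derivative 2 * \<bar>a\<bar>) (at a)"
  proof (cases "a = 0")
    case True
    have "((\<lambda>h. (h * \<bar>h\<bar>) / h) \<longlongrightarrow> \<bar>0\<bar>) (at (0::real))"
      by (rule Lim_transform_eventually[OF tendsto_rabs[OF tendsto_ident_at]]) (simp add: eventually_at_filter)
    then show ?thesis unfolding has_field_derivative_def using True by (simp add: DERIV_def[unfolded has_field_derivative_def])
  next
    case False
    have "\<forall>\<^sub>F x in nhds a. x * \<bar>x\<bar> = sgn a * x\<^sup>2"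
    proof (cases "0 < a")
      case True
      show ?thesis using eventually_nhds_in_open[OF open_greaterThan, of a 0] True
        by (auto elim!: eventually_mono simp: power2_eq_square)
    next
      case F: False
      show ?thesis using eventually_nhds_in_open[OF open_lessThan, of a 0] False F
        by (auto elim!: eventually_mono simp: power2_eq_square)
    qed
    moreover have "((\<lambda>x. sgn a * x\<^sup>2) has_real_derivative 2 * \<bar>a\<bar>) (at a)"
      by (auto intro!: derivative_eq_intros simp: abs_sgn)
    ultimately show ?thesis by (subst DERIV_cong_ev[OF refl _ refl])
  qed
  then show ?thesis by (rule DERIV_subset) simp
qed

lemma has_real_derivative_abs_cube:
  "((\<lambda>x. \<bar>x\<bar> ^ 3) has_real_derivative 3 * (a * \<bar>a\<bar>)) (at a within S)" for a :: real
proof -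
  have "\<bar>x\<bar> ^ 3 = x * (x * \<bar>x\<bar>)" for x :: real by (simp add: power3_eq_cube mult.assoc[symmetric])
  moreover have "((\<lambda>x. x * (x * \<bar>x\<bar>)) has_real_derivative 3 * (a * \<bar>a\<bar>)) (at a within S)"
    by (rule derivative_eq_intros has_real_derivative_abs_mult_self refl)+ simp
  ultimately show ?thesis by simp
qed

text \<open>A smooth solution together with the two first derivatives that the identities need. Time derivatives
are one-sided at the ends of the interval.\<close>

locale burgers_strip =
  fixes T L :: real and u ut ux :: "real \<Rightarrow> real \<Rightarrow> real"
  assumes T: "0 < T" and L: "0 < L"
    and cu: "continuous_on ({0..T} \<times> UNIV) (\<lambda>(t, x). u t x)"
    and cut: "continuous_on ({0..T} \<times> UNIV) (\<lambda>(t, x). ut t x)"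
    and cux: "continuous_on ({0..T} \<times> UNIV) (\<lambda>(t, x). ux t x)"
    and dt: "\<And>t x. t \<in> {0..T} \<Longrightarrow> ((\<lambda>\<tau>. u \<tau> x) has_real_derivative ut t x) (at t within {0..T})"
    and dx: "\<And>t x. t \<in> {0..T} \<Longrightarrow> (u t has_real_derivative ux t x) (at x)"
    and per: "\<And>t x. t \<in> {0..T} \<Longrightarrow> u t (x + L) = u t x"
begin

text \<open>The forcing, read off from the left-hand side of the equation, where its continuity is evident.\<close>

definition \<eta> :: "real \<Rightarrow> real \<Rightarrow> real" where "\<eta> t x = ut t x + u t x * ux t x"

definition energy :: "real \<Rightarrow> real" where "energy t = integral {0..L} (\<lambda>x. (u t x)\<^sup>2)"

definition d :: "real \<Rightarrow> real \<Rightarrow> real \<Rightarrow> real" where "d h t x = u t (x + h) - u t x"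

lemma continuous_compose_u:
  assumes "continuous_on A f" "continuous_on A g" "f ` A \<subseteq> {0..T}"
  shows "continuous_on A (\<lambda>z. u (f z) (g z))" "continuous_on A (\<lambda>z. ut (f z) (g z))" "continuous_on A (\<lambda>z. ux (f z) (g z))"
  using assms continuous_on_compose2[OF cu continuous_on_Pair[OF assms(1,2)]]
    continuous_on_compose2[OF cut continuous_on_Pair[OF assms(1,2)]]
    continuous_on_compose2[OF cux continuous_on_Pair[OF assms(1,2)]] by auto

lemma u_shift_derivative:
  assumes "t \<in> {0..T}"
  shows "((\<lambda>x. u t (x + h)) has_real_derivative ux t (x + h)) (at x)"
    "((\<lambda>h. u t (x + h)) has_real_derivative ux t (x + h)) (at h)"
  using DERIV_shift[of "u t" "ux t (x + h)" x h] DERIV_shift[of "u t" "ux t (x + h)" h x] dx[OF assms, of "x + h"]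
  by (simp_all add: add.commute)

lemma \<eta>_period:
  assumes t: "t \<in> {0..T}"
  shows "\<eta> t (x + L) = \<eta> t x"
proof -
  have "ux t (x + L) = ux t x" using derivative_of_periodic[OF dx[OF t] per[OF t]] .
  moreover have "ut t (x + L) = ut t x"
  proof -
    have "((\<lambda>\<tau>. u \<tau> x) has_real_derivative ut t (x + L)) (at t within {0..T})"
      by (rule has_field_derivative_transform_within[OF dt[OF t, of "x + L"] zero_less_one t]) (simp add: per)
    then have "((\<lambda>\<tau>. u \<tau> x) has_vector_derivative ut t (x + L)) (at t within cbox 0 T)"
      "((\<lambda>\<tau>. u \<tau> x) has_vector_derivative ut t x) (at t within cbox 0 T)"
      using dt[OF t, of x] by (simp_all add: has_real_derivative_iff_has_vector_derivative)
    then show ?thesis using vector_derivative_within_cbox[OF T, of t] t by (metis box_real(2))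
  qed
  ultimately show ?thesis by (simp add: \<eta>_def per[OF t])
qed

text \<open>Moving the increment from the forcing to the weight \<open>\<bar>d h\<bar>\<close> by translation invariance, so that only
  \<open>\<eta>\<close> itself is paired with functions controlled by \<open>u\<close>.\<close>

lemma increment_pairing_shift:
  "integral {0..T} (\<lambda>t. integral {0..L} (\<lambda>x. \<bar>d h t x\<bar> * (\<eta> t (x + h) - \<eta> t x)))
   = integral {0..T} (\<lambda>t. integral {0..L} (\<lambda>x. \<bar>d h t (x - h)\<bar> * \<eta> t x))
     - integral {0..T} (\<lambda>t. integral {0..L} (\<lambda>x. \<bar>d h t x\<bar> * \<eta> t x))"
proof -
  have c: "continuous_on ({0..T} \<times> {0..L}) (\<lambda>(t, x). \<bar>d h t (x - h)\<bar> * \<eta> t x)"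
    "continuous_on ({0..T} \<times> {0..L}) (\<lambda>(t, x). \<bar>d h t x\<bar> * \<eta> t x)"
    unfolding case_prod_beta' d_def \<eta>_def by (intro continuous_intros continuous_compose_u; auto)+
  have inner: "integral {0..L} (\<lambda>x. \<bar>d h t x\<bar> * (\<eta> t (x + h) - \<eta> t x))
    = integral {0..L} (\<lambda>x. \<bar>d h t (x - h)\<bar> * \<eta> t x) - integral {0..L} (\<lambda>x. \<bar>d h t x\<bar> * \<eta> t x)" if t: "t \<in> {0..T}" for t
  proof -
    have p: "u t (x + L - h) = u t (x - h)" for x using per[OF t, of "x - h"] by (simp add: algebra_simps)
    have "continuous_on {0..L} (\<lambda>x. \<bar>d h t x\<bar> * \<eta> t (x + h))" "continuous_on {0..L} (\<lambda>x. \<bar>d h t x\<bar> * \<eta> t x)"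
      unfolding d_def \<eta>_def by (intro continuous_intros continuous_compose_u; use t in auto)+
    then have "integral {0..L} (\<lambda>x. \<bar>d h t x\<bar> * (\<eta> t (x + h) - \<eta> t x))
      = integral {0..L} (\<lambda>x. \<bar>d h t x\<bar> * \<eta> t (x + h)) - integral {0..L} (\<lambda>x. \<bar>d h t x\<bar> * \<eta> t x)"
      unfolding right_diff_distrib
      by (intro Henstock_Kurzweil_Integration.integral_diff integrable_continuous_interval)
    also have "integral {0..L} (\<lambda>x. \<bar>d h t x\<bar> * \<eta> t (x + h)) = integral {0..L} (\<lambda>x. \<bar>d h t (x - h)\<bar> * \<eta> t x)"
    proof -
      have "continuous_on UNIV (\<lambda>x. \<bar>d h t (x - h)\<bar> * \<eta> t x)"
        unfolding d_def \<eta>_def by (intro continuous_intros continuous_compose_u; use t in auto)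
      from integral_period_shift[OF this _ L, of h] show ?thesis
        using p per[OF t] \<eta>_period[OF t] by (simp add: d_def)
    qed
    finally show ?thesis .
  qed
  show ?thesis
    by (subst Henstock_Kurzweil_Integration.integral_diff[symmetric])
       (auto intro!: inner Henstock_Kurzweil_Integration.integral_cong integrable_continuous_interval continuous_on_inner_integral c)
qed

text \<open>Multiply the equation by \<open>2 u\<close>; the transport term is the derivative of the periodic function \<open>2 u\<^sup>3 / 3\<close>.\<close>

lemma energy_identity:
  "energy T = energy 0 + 2 * integral {0..T} (\<lambda>t. integral {0..L} (\<lambda>x. u t x * \<eta> t x))"
proof -
  have i: "(\<lambda>x. (u t x)\<^sup>2) integrable_on {0..L}" if "t \<in> {0..T}" for t
    using that by (intro integrable_continuous_interval continuous_intros continuous_compose_u) auto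
  have "integral {0..L} (\<lambda>x. (u T x)\<^sup>2 - (u 0 x)\<^sup>2)
    = integral {0..T} (\<lambda>t. integral {0..L} (\<lambda>x. 2 * u t x * ut t x + 2 * (u t x)\<^sup>2 * ux t x))"
  proof (rule balance_law[where Q="\<lambda>t x. (2/3) * u t x ^ 3"])
    show "((\<lambda>\<tau>. (u \<tau> x)\<^sup>2) has_real_derivative 2 * u t x * ut t x) (at t within {0..T})" if "t \<in> {0..T}" for t x
      by (rule derivative_eq_intros dt[OF that] refl)+ simp
    show "((\<lambda>x. 2/3 * u t x ^ 3) has_real_derivative 2 * (u t x)\<^sup>2 * ux t x) (at x)" if "t \<in> {0..T}" for t x
      by (rule derivative_eq_intros dx[OF that] refl)+ (simp add: power2_eq_square)
    show "continuous_on ({0..T} \<times> {0..L}) (\<lambda>(t, x). 2 * u t x * ut t x)"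
      unfolding case_prod_beta' by (intro continuous_intros continuous_compose_u) auto
  qed (use T L per[of _ 0] in auto)
  also have "\<dots> = integral {0..T} (\<lambda>t. integral {0..L} (\<lambda>x. 2 * (u t x * \<eta> t x)))"
    by (simp add: \<eta>_def power2_eq_square algebra_simps)
  also have "\<dots> = 2 * integral {0..T} (\<lambda>t. integral {0..L} (\<lambda>x. u t x * \<eta> t x))" by simp
  finally show ?thesis using i T by (simp add: energy_def Henstock_Kurzweil_Integration.integral_diff)
qed

text \<open>Multiply the difference of the equations at \<open>x + h\<close> and \<open>x\<close> by \<open>\<bar>w\<bar>\<close>, where \<open>w = d h\<close>. The choice of \<open>\<bar>w\<bar>\<close>
instead of \<open>w\<close> is what produces \<open>\<bar>w\<bar>\<^sup>3\<close>, which has a sign, in place of \<open>w\<^sup>3\<close>. The nonlinearity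
contributes \<open>\<bar>w\<bar> w \<partial>\<^sub>x u(x + h) / 2\<close>, one sixth of the derivative of \<open>\<bar>w\<bar>\<^sup>3\<close> in \<open>h\<close>, plus the derivative in
\<open>x\<close> of the periodic function \<open>\<bar>w\<bar>\<^sup>3 / 6 + u w \<bar>w\<bar> / 2\<close>.\<close>

lemma Karman_Howarth_Monin_fixed_increment:
  "integral {0..L} (\<lambda>x. d h T x * \<bar>d h T x\<bar> / 2 - d h 0 x * \<bar>d h 0 x\<bar> / 2)
    = integral {0..T} (\<lambda>t. integral {0..L} (\<lambda>x. \<bar>d h t x\<bar> * (\<eta> t (x + h) - \<eta> t x) - d h t x * \<bar>d h t x\<bar> * ux t (x + h) / 2))"
proof -
  let ?w = "d h"
  let ?wt = "\<lambda>t x. ut t (x + h) - ut t x" and ?wx = "\<lambda>t x. ux t (x + h) - ux t x"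
  have dwt: "((\<lambda>\<tau>. ?w \<tau> x) has_real_derivative ?wt t x) (at t within {0..T})" if "t \<in> {0..T}" for t x
    unfolding d_def by (rule derivative_eq_intros dt[OF that] refl)+
  have dwx: "(?w t has_real_derivative ?wx t x) (at x)" if "t \<in> {0..T}" for t x
    unfolding d_def[abs_def] by (rule derivative_eq_intros u_shift_derivative(1)[OF that] dx[OF that] refl)+
  have "integral {0..L} (\<lambda>x. ?w T x * \<bar>?w T x\<bar> / 2 - ?w 0 x * \<bar>?w 0 x\<bar> / 2)
    = integral {0..T} (\<lambda>t. integral {0..L} (\<lambda>x. \<bar>?w t x\<bar> * ?wt t x
       + (?w t x * \<bar>?w t x\<bar> * ?wx t x / 2 + (ux t x * (?w t x * \<bar>?w t x\<bar> / 2) + u t x * (\<bar>?w t x\<bar> * ?wx t x)))))"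
  proof (rule balance_law[where Q="\<lambda>t x. \<bar>?w t x\<bar> ^ 3 / 6 + u t x * (?w t x * \<bar>?w t x\<bar> / 2)"])
    fix t x assume t: "t \<in> {0..T}"
    show "((\<lambda>\<tau>. ?w \<tau> x * \<bar>?w \<tau> x\<bar> / 2) has_real_derivative \<bar>?w t x\<bar> * ?wt t x) (at t within {0..T})"
      using DERIV_chain2[OF has_real_derivative_abs_mult_self[of "?w t x" UNIV] dwt[OF t], THEN DERIV_cdivide, of 2]
      by simp
    have 1: "((\<lambda>x. ?w t x * \<bar>?w t x\<bar>) has_real_derivative 2 * \<bar>?w t x\<bar> * ?wx t x) (at x)"
      using DERIV_chain2[OF has_real_derivative_abs_mult_self[of "?w t x" UNIV] dwx[OF t]] .
    have 2: "((\<lambda>x. \<bar>?w t x\<bar> ^ 3) has_real_derivative 3 * (?w t x * \<bar>?w t x\<bar>) * ?wx t x) (at x)"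
      using DERIV_chain2[OF has_real_derivative_abs_cube[of "?w t x" UNIV] dwx[OF t]] .
    show "((\<lambda>x. \<bar>?w t x\<bar> ^ 3 / 6 + u t x * (?w t x * \<bar>?w t x\<bar> / 2)) has_real_derivative
       ?w t x * \<bar>?w t x\<bar> * ?wx t x / 2 + (ux t x * (?w t x * \<bar>?w t x\<bar> / 2) + u t x * (\<bar>?w t x\<bar> * ?wx t x))) (at x)"
      by (rule DERIV_cong[OF DERIV_add[OF DERIV_cdivide[OF 2] DERIV_mult[OF dx[OF t] DERIV_cdivide[OF 1]]]])
         (simp add: field_simps)
  next
    fix t assume t: "t \<in> {0..T}"
    have "?w t L = ?w t 0" using per[OF t, of 0] per[OF t, of h] by (simp add: d_def add.commute)
    then show "\<bar>?w t L\<bar> ^ 3 / 6 + u t L * (?w t L * \<bar>?w t L\<bar> / 2) = \<bar>?w t 0\<bar> ^ 3 / 6 + u t 0 * (?w t 0 * \<bar>?w t 0\<bar> / 2)"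
      using per[OF t, of 0] by simp
  next
    show "continuous_on ({0..T} \<times> {0..L}) (\<lambda>(t, x). \<bar>?w t x\<bar> * ?wt t x)"
      unfolding case_prod_beta' d_def by (intro continuous_intros continuous_compose_u) auto
  qed (use T L in auto)
  also have "(\<lambda>t. integral {0..L} (\<lambda>x. \<bar>?w t x\<bar> * ?wt t x
       + (?w t x * \<bar>?w t x\<bar> * ?wx t x / 2 + (ux t x * (?w t x * \<bar>?w t x\<bar> / 2) + u t x * (\<bar>?w t x\<bar> * ?wx t x)))))
    = (\<lambda>t. integral {0..L} (\<lambda>x. \<bar>?w t x\<bar> * (\<eta> t (x + h) - \<eta> t x) - ?w t x * \<bar>?w t x\<bar> * ux t (x + h) / 2))"
  proof -
    have "\<bar>?w t x\<bar> * ?wt t x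
       + (?w t x * \<bar>?w t x\<bar> * ?wx t x / 2 + (ux t x * (?w t x * \<bar>?w t x\<bar> / 2) + u t x * (\<bar>?w t x\<bar> * ?wx t x)))
      = \<bar>?w t x\<bar> * (\<eta> t (x + h) - \<eta> t x) - ?w t x * \<bar>?w t x\<bar> * ux t (x + h) / 2" for t x
    proof -
      have "u t (x + h) = u t x + ?w t x" by (simp add: d_def)
      then show ?thesis by (simp add: \<eta>_def field_simps)
    qed
    then show ?thesis by simp
  qed
  finally show ?thesis .
qed

lemma d_cube_eq_integral:
  assumes "0 \<le> H" "t \<in> {0..T}"
  shows "\<bar>d H t x\<bar> ^ 3 = integral {0..H} (\<lambda>h. 3 * (d h t x * \<bar>d h t x\<bar>) * ux t (x + h))"
proof -
  have "((\<lambda>h. \<bar>d h t x\<bar> ^ 3) has_real_derivative 3 * (d h t x * \<bar>d h t x\<bar>) * ux t (x + h)) (at h within {0..H})" for h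
  proof -
    have "((\<lambda>h. d h t x) has_real_derivative ux t (x + h)) (at h)"
      unfolding d_def using DERIV_diff[OF u_shift_derivative(2)[OF assms(2), of x h] DERIV_const[of "u t x"]] by simp
    from DERIV_chain2[OF has_real_derivative_abs_cube[of "d h t x" UNIV] this]
    show ?thesis by (rule DERIV_subset) simp
  qed
  from integral_FTC(1)[OF assms(1) this] show ?thesis by (simp add: d_def)
qed

text \<open>Integrate the identity for fixed \<open>h\<close> over \<open>0 \<le> h \<le> H\<close>. As \<open>w\<close> vanishes for \<open>h = 0\<close>, the left-hand side
becomes the full cubic structure function at \<open>H\<close>. The boundary terms in time are quadratic in \<open>w\<close> and
hence bounded by twice the energy.\<close>

lemma Karman_Howarth_Monin_bound:
  assumes "0 \<le> H"
    and R: "\<And>h. h \<in> {0..H} \<Longrightarrow> integral {0..T} (\<lambda>t. integral {0..L} (\<lambda>x. \<bar>d h t x\<bar> * (\<eta> t (x + h) - \<eta> t x))) \<le> R"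
  shows "integral {0..T} (\<lambda>t. integral {0..L} (\<lambda>x. \<bar>d H t x\<bar> ^ 3)) \<le> H * (6 * (R + 2 * energy 0 + 2 * energy T))"
proof -
  have E: "integral {0..L} (\<lambda>x. (u t (x + h))\<^sup>2) = energy t" if "t \<in> {0, T}" for h t
  proof -
    have t: "t \<in> {0..T}" using that T by auto
    show ?thesis unfolding energy_def
      by (rule integral_period_shift[of "\<lambda>x. (u t x)\<^sup>2" L h])
         (use per[OF t] L t in \<open>auto intro!: continuous_intros continuous_compose_u\<close>)
  qed
  define k where "k h t x = d h t x * \<bar>d h t x\<bar> * ux t (x + h)" for h t x
  have ck: "continuous_on ({0..H} \<times> {0..T} \<times> {0..L}) (\<lambda>z. k (fst z) (fst (snd z)) (snd (snd z)))"
    unfolding k_def d_def by (intro continuous_intros continuous_compose_u) auto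
  have ck': "continuous_on (A \<times> B) (\<lambda>(a, b). k (f a b) (g a b) (e a b))"
    if "continuous_on (A \<times> B) (\<lambda>z. f (fst z) (snd z))" "continuous_on (A \<times> B) (\<lambda>z. g (fst z) (snd z))"
      "continuous_on (A \<times> B) (\<lambda>z. e (fst z) (snd z))" "\<And>a b. a \<in> A \<Longrightarrow> b \<in> B \<Longrightarrow> g a b \<in> {0..T}"
    for A :: "'b::topological_space set" and B :: "'c::topological_space set" and f g e
    unfolding k_def d_def case_prod_beta' using that by (intro continuous_intros continuous_compose_u) auto
  have cX: "continuous_on ({0..T} \<times> {0..H}) (\<lambda>(t, h). integral {0..L} (k h t))"
  proof -
    have "continuous_on (({0..T} \<times> {0..H}) \<times> {0..L}) (\<lambda>(z, x). k (snd z) (fst z) x)"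
      by (rule ck') (auto intro!: continuous_intros)
    from integral_continuous_on_param[of "{0..T} \<times> {0..H}" 0 L "\<lambda>z x. k (snd z) (fst z) x"] this
    show ?thesis by (simp add: case_prod_beta')
  qed
  have "integral {0..T} (\<lambda>t. integral {0..L} (\<lambda>x. \<bar>d H t x\<bar> ^ 3))
    = integral {0..T} (\<lambda>t. integral {0..L} (\<lambda>x. 3 * integral {0..H} (\<lambda>h. k h t x)))"
    by (intro Henstock_Kurzweil_Integration.integral_cong)
       (simp add: d_cube_eq_integral[OF assms(1)] k_def mult.assoc)
  also have "\<dots> = 3 * integral {0..T} (\<lambda>t. integral {0..L} (\<lambda>x. integral {0..H} (\<lambda>h. k h t x)))" by simp
  also have "integral {0..T} (\<lambda>t. integral {0..L} (\<lambda>x. integral {0..H} (\<lambda>h. k h t x)))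
    = integral {0..T} (\<lambda>t. integral {0..H} (\<lambda>h. integral {0..L} (k h t)))"
  proof (rule Henstock_Kurzweil_Integration.integral_cong)
    fix t assume t: "t \<in> {0..T}"
    have "continuous_on ({0..L} \<times> {0..H}) (\<lambda>(x, h). k h t x)"
      by (rule ck') (use t in \<open>auto intro!: continuous_intros\<close>)
    from integral_swap[OF this]
    show "integral {0..L} (\<lambda>x. integral {0..H} (\<lambda>h. k h t x)) = integral {0..H} (\<lambda>h. integral {0..L} (k h t))" by simp
  qed
  also have "\<dots> = integral {0..H} (\<lambda>h. integral {0..T} (\<lambda>t. integral {0..L} (k h t)))"
    by (rule integral_swap[OF cX])
  also have "3 * \<dots> \<le> 3 * integral {0..H} (\<lambda>h. 2 * (R + 2 * energy 0 + 2 * energy T))"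
  proof (intro mult_left_mono integral_le)
    have "prod.swap ` ({0..H} \<times> {0..T}) \<subseteq> {0..T} \<times> {0..H}" by auto
    from continuous_on_compose2[OF cX continuous_on_swap this]
    have "continuous_on ({0..H} \<times> {0..T}) (\<lambda>(h, t). integral {0..L} (k h t))"
      by (simp add: case_prod_beta')
    then show "(\<lambda>h. integral {0..T} (\<lambda>t. integral {0..L} (k h t))) integrable_on {0..H}"
      by (intro integrable_continuous_interval continuous_on_inner_integral)
    fix h assume h: "h \<in> {0..H}"
    have ci: "continuous_on ({0..T} \<times> {0..L}) (\<lambda>(t, x). \<bar>d h t x\<bar> * (\<eta> t (x + h) - \<eta> t x))"
      "continuous_on ({0..T} \<times> {0..L}) (\<lambda>(t, x). k h t x / 2)"
      unfolding case_prod_beta' d_def \<eta>_def k_def by (intro continuous_intros continuous_compose_u; auto)+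
    have id: "integral {0..L} (\<lambda>x. d h T x * \<bar>d h T x\<bar> / 2 - d h 0 x * \<bar>d h 0 x\<bar> / 2)
      = integral {0..T} (\<lambda>t. integral {0..L} (\<lambda>x. \<bar>d h t x\<bar> * (\<eta> t (x + h) - \<eta> t x)))
        - integral {0..T} (\<lambda>t. integral {0..L} (\<lambda>x. k h t x)) / 2"
    proof -
      have "integral {0..T} (\<lambda>t. integral {0..L} (\<lambda>x. \<bar>d h t x\<bar> * (\<eta> t (x + h) - \<eta> t x) - k h t x / 2))
        = integral {0..T} (\<lambda>t. integral {0..L} (\<lambda>x. \<bar>d h t x\<bar> * (\<eta> t (x + h) - \<eta> t x)) - integral {0..L} (\<lambda>x. k h t x / 2))"
        by (intro Henstock_Kurzweil_Integration.integral_cong Henstock_Kurzweil_Integration.integral_diff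
             integrable_continuous_interval continuous_on_section(1)[OF ci(1)] continuous_on_section(1)[OF ci(2)])
      also have "\<dots> = integral {0..T} (\<lambda>t. integral {0..L} (\<lambda>x. \<bar>d h t x\<bar> * (\<eta> t (x + h) - \<eta> t x)))
          - integral {0..T} (\<lambda>t. integral {0..L} (\<lambda>x. k h t x / 2))"
        by (intro Henstock_Kurzweil_Integration.integral_diff integrable_continuous_interval
             continuous_on_inner_integral ci)
      finally show ?thesis
        using Karman_Howarth_Monin_fixed_increment[of h] by (simp add: k_def)
    qed
    have quad: "integral {0..L} (\<lambda>x. \<bar>d h t x * \<bar>d h t x\<bar> / 2\<bar>) \<le> 2 * energy t"
      and quadi: "(\<lambda>x. d h t x * \<bar>d h t x\<bar> / 2) integrable_on {0..L}" "(\<lambda>x. \<bar>d h t x * \<bar>d h t x\<bar> / 2\<bar>) integrable_on {0..L}"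
      if t: "t \<in> {0, T}" for t
    proof -
      have tT: "t \<in> {0..T}" using t T by auto
      have c: "continuous_on {0..L} (\<lambda>x. d h t x * \<bar>d h t x\<bar> / 2)" "continuous_on {0..L} (\<lambda>x. (u t (x + h))\<^sup>2)" "continuous_on {0..L} (\<lambda>x. (u t x)\<^sup>2)"
        unfolding d_def by (intro continuous_intros continuous_compose_u; use tT in auto)+
      show i: "(\<lambda>x. d h t x * \<bar>d h t x\<bar> / 2) integrable_on {0..L}" "(\<lambda>x. \<bar>d h t x * \<bar>d h t x\<bar> / 2\<bar>) integrable_on {0..L}"
        by (rule integrable_continuous_interval[OF c(1)], rule integrable_continuous_interval[OF continuous_on_rabs[OF c(1)]])
      have "integral {0..L} (\<lambda>x. \<bar>d h t x * \<bar>d h t x\<bar> / 2\<bar>) \<le> integral {0..L} (\<lambda>x. (u t (x + h))\<^sup>2 + (u t x)\<^sup>2)"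
      proof (rule integral_le[OF i(2)])
        show "(\<lambda>x. (u t (x + h))\<^sup>2 + (u t x)\<^sup>2) integrable_on {0..L}"
          by (intro integrable_continuous_interval continuous_on_add c)
        show "\<bar>d h t x * \<bar>d h t x\<bar> / 2\<bar> \<le> (u t (x + h))\<^sup>2 + (u t x)\<^sup>2" for x
        proof -
          have "\<bar>d h t x * \<bar>d h t x\<bar> / 2\<bar> = (u t (x + h) - u t x)\<^sup>2 / 2" by (simp add: d_def abs_mult power2_eq_square)
          moreover have "0 \<le> (u t (x + h) + u t x)\<^sup>2" by simp
          ultimately show ?thesis by (simp add: power2_eq_square algebra_simps)
        qed
      qed
      also have "\<dots> = energy t + energy t"
        using c E[OF t] by (subst Henstock_Kurzweil_Integration.integral_add)
          (auto simp: energy_def intro!: integrable_continuous_interval)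
      finally show "integral {0..L} (\<lambda>x. \<bar>d h t x * \<bar>d h t x\<bar> / 2\<bar>) \<le> 2 * energy t" by simp
    qed
    have "\<bar>integral {0..L} (\<lambda>x. d h t x * \<bar>d h t x\<bar> / 2)\<bar> \<le> 2 * energy t" if "t \<in> {0, T}" for t
    proof -
      have "norm (integral {0..L} (\<lambda>x. d h t x * \<bar>d h t x\<bar> / 2)) \<le> integral {0..L} (\<lambda>x. \<bar>d h t x * \<bar>d h t x\<bar> / 2\<bar>)"
        by (rule integral_norm_bound_integral[OF quadi(1)[OF that] quadi(2)[OF that]]) simp
      then show ?thesis using quad[OF that] unfolding real_norm_def by (rule order_trans)
    qed
    from this[of 0] this[of T]
    have "- (integral {0..L} (\<lambda>x. d h T x * \<bar>d h T x\<bar> / 2 - d h 0 x * \<bar>d h 0 x\<bar> / 2)) \<le> 2 * energy 0 + 2 * energy T"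
      using quadi(1)[of 0] quadi(1)[of T] by (subst Henstock_Kurzweil_Integration.integral_diff) auto
    then show "integral {0..T} (\<lambda>t. integral {0..L} (k h t)) \<le> 2 * (R + 2 * energy 0 + 2 * energy T)"
      using R[OF h] id by simp
  qed (use assms(1) in auto)
  also have "\<dots> = H * (6 * (R + 2 * energy 0 + 2 * energy T))" using assms(1) by simp
  finally show ?thesis .
qed

end

section \<open>From increments to the Besov norm\<close>

lemma ennreal_SUP_cube_le:
  fixes x :: "'a \<Rightarrow> ennreal"
  assumes "\<And>k. x k ^ 3 \<le> B"
  shows "(SUP k. x k) ^ 3 \<le> B"
proof -
  have cube: "enn_powr (y ^ 3) (1/3) = y" "enn_powr y (1/3) ^ 3 = y" for y
    by (simp_all add: enn_powr_powr flip: enn_powr_numeral)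
  have "x k \<le> enn_powr B (1/3)" for k
    using enn_powr_mono[OF assms[of k], of "1/3"] by (simp add: cube)
  then have "(SUP k. x k) \<le> enn_powr B (1/3)" by (rule SUP_least)
  from power_mono[OF this, of 3] show ?thesis by (simp add: cube)
qed

context LP_family
begin

text \<open>The \<open>k\<close>-th piece averages increments of \<open>u\<close> against an \<open>L\<^sup>1\<close> kernel that lives at scale \<open>2 powi (-k)\<close>: its
first moment is \<open>2 powi (-k)\<close> times that of \<open>\<phi>\<^sub>0\<close>. With Jensen for the cube, a linear bound on the cubic
increments therefore gives \<open>2 powi k\<close> times the cubed norm of the piece bounded uniformly in \<open>k\<close>.\<close>

lemma besov_le_cubic_increments:
  obtains C :: real where "0 < C" "\<And>L T u A. 0 < L \<Longrightarrow> admissible L u \<Longrightarrow>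
    (\<And>h. 0 < h \<Longrightarrow> (\<integral>\<^sup>+z. ennreal (\<bar>u (fst z) (snd z + h) - u (fst z) (snd z)\<bar> ^ 3) \<partial>strip T L) \<le> ennreal h * A) \<Longrightarrow>
    besov_norm \<phi> L T (1/3) 3 \<infinity> u ^ 3 \<le> ennreal C * A"
proof -
  have "schwartz (\<phi> 0)" using LP unfolding littlewood_paley_def by blast
  then have xi: "integrable lborel (\<lambda>x. x *\<^sub>R \<phi> 0 x)" by (rule schwartz_facts) blast
  define a where "a = (LINT x|lborel. norm (\<phi> 0 x))"
  define b where "b = (LINT x|lborel. norm (x *\<^sub>R \<phi> 0 x))"
  have ab: "0 \<le> a" "0 \<le> b" by (auto simp: a_def b_def)
  have I0: "(\<integral>\<^sup>+x. ennreal (norm (dilate (\<phi> 0) k x)) \<partial>lborel) = ennreal a" for k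
    using nn_integral_dilate[of "\<phi> 0" "\<lambda>_. 1" k] nn_integral_eq_integral[of lborel "\<lambda>x. norm (\<phi> 0 x)"] integrable_family[of 0]
    by (simp add: a_def)
  have I1: "ennreal (2 powi k) * (\<integral>\<^sup>+x. ennreal (norm (dilate (\<phi> 0) k x)) * ennreal \<bar>x\<bar> \<partial>lborel) = ennreal b" for k
  proof -
    have "ennreal (2 powi k) * (\<integral>\<^sup>+x. ennreal (norm (dilate (\<phi> 0) k x)) * ennreal \<bar>x\<bar> \<partial>lborel)
      = (\<integral>\<^sup>+x. ennreal (norm (dilate (\<phi> 0) k x)) * ennreal \<bar>2 powi k * x\<bar> \<partial>lborel)"
      by (subst nn_integral_cmult[symmetric]) (auto simp: abs_mult ennreal_mult mult_ac)
    also have "\<dots> = (\<integral>\<^sup>+x. ennreal (norm (\<phi> 0 x)) * ennreal \<bar>x\<bar> \<partial>lborel)"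
      by (rule nn_integral_dilate) auto
    also have "\<dots> = (\<integral>\<^sup>+x. ennreal (norm (x *\<^sub>R \<phi> 0 x)) \<partial>lborel)"
      by (intro nn_integral_cong) (simp add: ennreal_mult mult.commute)
    also have "\<dots> = ennreal b" unfolding b_def by (rule nn_integral_eq_integral[OF integrable_norm[OF xi]]) simp
    finally show ?thesis .
  qed
  define C where "C = a\<^sup>2 * b + 1"
  have C: "0 < C" using ab by (simp add: C_def add_nonneg_pos)
  have "besov_norm \<phi> L T (1/3) 3 \<infinity> u ^ 3 \<le> ennreal C * A"
    if L: "0 < L" and u: "admissible L u"
      and A: "\<And>h. 0 < h \<Longrightarrow> (\<integral>\<^sup>+z. ennreal (\<bar>u (fst z) (snd z + h) - u (fst z) (snd z)\<bar> ^ 3) \<partial>strip T L) \<le> ennreal h * A"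
    for L T u A
  proof -
    define \<delta> where "\<delta> y z = ennreal \<bar>u (fst z) (snd z - y) - u (fst z) (snd z)\<bar>" for y and z :: "real \<times> real"
    have \<delta>m: "(\<lambda>q. \<delta> (f q) (g q, h q)) \<in> borel_measurable M"
      if "f \<in> borel_measurable M" "g \<in> borel_measurable M" "h \<in> borel_measurable M" for f g h and M :: "'b measure"
      unfolding \<delta>_def fst_conv snd_conv using that
      by (intro measurable_compose[OF _ measurable_ennreal] borel_measurable_abs borel_measurable_diff admissible_measurable[OF u])
    have shift: "(\<integral>\<^sup>+z. \<delta> y z ^ 3 \<partial>strip T L) \<le> ennreal \<bar>y\<bar> * A" for y
    proof -
      have m: "(\<lambda>z. ennreal (\<bar>u (fst z) (snd z + h) - u (fst z) (snd z)\<bar> ^ 3)) \<in> borel_measurable (borel \<Otimes>\<^sub>M borel)" for h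
        by (intro measurable_compose[OF _ measurable_ennreal] borel_measurable_power borel_measurable_abs borel_measurable_diff
            admissible_measurable[OF u] borel_measurable_add measurable_fst measurable_snd borel_measurable_const)
      consider "y < 0" | "y = 0" | "0 < y" by linarith
      then show ?thesis
      proof cases
        case 1
        then show ?thesis using A[of "- y"] by (simp add: \<delta>_def ennreal_power)
      next
        case 2
        then show ?thesis by (simp add: \<delta>_def)
      next
        case 3
        have per: "u t (x + L + c) = u t (x + c)" for t x c
          using admissible_period[OF u, of t "x + c"] L by (simp add: algebra_simps)
        have "(\<integral>\<^sup>+z. ennreal (\<bar>u (fst z) (snd z + y) - u (fst z) (snd z)\<bar> ^ 3) \<partial>strip T L)
          = (\<integral>\<^sup>+z. ennreal (\<bar>u (fst z) (snd z + - y + y) - u (fst z) (snd z + - y)\<bar> ^ 3) \<partial>strip T L)"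
          using nn_integral_strip_shift[where a="- y" and T=T and L=L, OF m[of y]] L per[of _ _ 0] by (simp add: per)
        also have "\<dots> = (\<integral>\<^sup>+z. \<delta> y z ^ 3 \<partial>strip T L)"
          by (simp add: \<delta>_def ennreal_power abs_minus_commute)
        finally show ?thesis using A[OF 3] 3 by simp
      qed
    qed
    have one: "(ennreal (2 powr (1/3 * of_int k)) * lp_piece_norm \<phi> L T 3 k u) ^ 3 \<le> ennreal C * A" for k
    proof -
      define \<omega> where "\<omega> y = ennreal (norm (dilate (\<phi> 0) k y))" for y
      have [measurable]: "\<omega> \<in> borel_measurable borel" unfolding \<omega>_def by measurable
      have "lp_piece_norm \<phi> L T 3 k u ^ 3 = (\<integral>\<^sup>+z. ennreal (norm (lp_piece \<phi> k u (fst z) (snd z))) ^ 3 \<partial>strip T L)"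
        by (simp add: lp_piece_norm_eq Lp_ennreal_def enn_powr_powr enn_powr_numeral[symmetric])
      also have "\<dots> \<le> (\<integral>\<^sup>+z. (\<integral>\<^sup>+y. \<omega> y * \<delta> y z \<partial>lborel) ^ 3 \<partial>strip T L)"
        unfolding \<omega>_def \<delta>_def
        using norm_lp_piece_le[where u=u and L=L] u by (intro nn_integral_mono power_mono) (auto simp: admissible_def)
      also have "\<dots> \<le> (\<integral>\<^sup>+z. ennreal (a\<^sup>2) * (\<integral>\<^sup>+y. \<omega> y * \<delta> y z ^ 3 \<partial>lborel) \<partial>strip T L)"
      proof (intro nn_integral_mono)
        fix z :: "real \<times> real"
        have "(\<lambda>y. \<delta> y z) \<in> borel_measurable lborel" using \<delta>m[of "\<lambda>y. y" lborel "\<lambda>_. fst z" "\<lambda>_. snd z"] by simp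
        then show "(\<integral>\<^sup>+y. \<omega> y * \<delta> y z \<partial>lborel) ^ 3 \<le> ennreal (a\<^sup>2) * (\<integral>\<^sup>+y. \<omega> y * \<delta> y z ^ 3 \<partial>lborel)"
          using Jensen_cube[of \<omega> lborel "\<lambda>y. \<delta> y z"] I0[of k] ab by (simp add: \<omega>_def ennreal_power)
      qed
      also have "\<dots> = ennreal (a\<^sup>2) * (\<integral>\<^sup>+z. \<integral>\<^sup>+y. \<omega> y * \<delta> y z ^ 3 \<partial>lborel \<partial>strip T L)"
      proof (rule nn_integral_cmult)
        have [measurable]: "(\<lambda>p. \<delta> (snd p) (fst (fst p), snd (fst p))) \<in> borel_measurable (strip T L \<Otimes>\<^sub>M lborel)"
          by (rule \<delta>m) measurable
        have "(\<lambda>p. \<omega> (snd p) * \<delta> (snd p) (fst (fst p), snd (fst p)) ^ 3) \<in> borel_measurable (strip T L \<Otimes>\<^sub>M lborel)"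
          by measurable
        from lborel.borel_measurable_nn_integral_fst[OF this]
        show "(\<lambda>z. \<integral>\<^sup>+y. \<omega> y * \<delta> y z ^ 3 \<partial>lborel) \<in> borel_measurable (strip T L)" by simp
      qed
      also have "(\<integral>\<^sup>+z. \<integral>\<^sup>+y. \<omega> y * \<delta> y z ^ 3 \<partial>lborel \<partial>strip T L) = (\<integral>\<^sup>+y. \<integral>\<^sup>+z. \<omega> y * \<delta> y z ^ 3 \<partial>strip T L \<partial>lborel)"
      proof -
        interpret pair_sigma_finite "strip T L" lborel
          by (intro pair_sigma_finite.intro sigma_finite_strip sigma_finite_lborel)
        have [measurable]: "(\<lambda>p. \<delta> (snd p) (fst (fst p), snd (fst p))) \<in> borel_measurable (strip T L \<Otimes>\<^sub>M lborel)"
          by (rule \<delta>m) measurable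
        have "(\<lambda>p. \<omega> (snd p) * \<delta> (snd p) (fst (fst p), snd (fst p)) ^ 3) \<in> borel_measurable (strip T L \<Otimes>\<^sub>M lborel)"
          by measurable
        from Fubini[OF this] show ?thesis by simp
      qed
      finally have 1: "lp_piece_norm \<phi> L T 3 k u ^ 3 \<le> ennreal (a\<^sup>2) * (\<integral>\<^sup>+y. \<integral>\<^sup>+z. \<omega> y * \<delta> y z ^ 3 \<partial>strip T L \<partial>lborel)" .
      have 2: "(\<integral>\<^sup>+y. \<integral>\<^sup>+z. \<omega> y * \<delta> y z ^ 3 \<partial>strip T L \<partial>lborel) \<le> (\<integral>\<^sup>+y. \<omega> y * ennreal \<bar>y\<bar> \<partial>lborel) * A"
      proof -
        have "(\<integral>\<^sup>+z. \<omega> y * \<delta> y z ^ 3 \<partial>strip T L) \<le> \<omega> y * ennreal \<bar>y\<bar> * A" for y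
        proof -
          have [measurable]: "(\<lambda>z. \<delta> y (fst z, snd z)) \<in> borel_measurable (strip T L)" by (rule \<delta>m) measurable
          have "(\<integral>\<^sup>+z. \<omega> y * \<delta> y (fst z, snd z) ^ 3 \<partial>strip T L) = \<omega> y * (\<integral>\<^sup>+z. \<delta> y (fst z, snd z) ^ 3 \<partial>strip T L)"
            by (rule nn_integral_cmult) measurable
          also have "\<dots> \<le> \<omega> y * (ennreal \<bar>y\<bar> * A)" using shift[of y] by (intro mult_left_mono) auto
          finally show ?thesis by (simp add: mult.assoc)
        qed
        then have "(\<integral>\<^sup>+y. \<integral>\<^sup>+z. \<omega> y * \<delta> y z ^ 3 \<partial>strip T L \<partial>lborel) \<le> (\<integral>\<^sup>+y. \<omega> y * ennreal \<bar>y\<bar> * A \<partial>lborel)"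
          by (intro nn_integral_mono)
        then show ?thesis by (simp add: nn_integral_multc)
      qed
      have pw: "ennreal (2 powr (1/3 * of_int k)) ^ 3 = ennreal (2 powi k)"
        by (simp add: ennreal_power powr_power powr_real_of_int')
      have "(ennreal (2 powr (1/3 * of_int k)) * lp_piece_norm \<phi> L T 3 k u) ^ 3 = ennreal (2 powi k) * lp_piece_norm \<phi> L T 3 k u ^ 3"
        by (simp only: power_mult_distrib pw)
      also have "\<dots> \<le> ennreal (2 powi k) * (ennreal (a\<^sup>2) * ((\<integral>\<^sup>+y. \<omega> y * ennreal \<bar>y\<bar> \<partial>lborel) * A))"
        by (intro mult_left_mono order_trans[OF 1] 2) simp_all
      also have "\<dots> = ennreal (a\<^sup>2) * (ennreal (2 powi k) * (\<integral>\<^sup>+y. \<omega> y * ennreal \<bar>y\<bar> \<partial>lborel)) * A" by (simp only: mult_ac)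
      also have "\<dots> = ennreal (a\<^sup>2 * b) * A" using ab unfolding \<omega>_def I1 by (simp add: ennreal_mult)
      also have "\<dots> \<le> ennreal C * A" by (intro mult_right_mono ennreal_leI) (auto simp: C_def)
      finally show ?thesis .
    qed
    show ?thesis unfolding besov_norm_def if_P[OF refl] by (rule ennreal_SUP_cube_le) (rule one)
  qed
  then show thesis using that C by blast
qed

end

section \<open>Truncation in time\<close>

text \<open>The norms on \<open>[0,T]\<close> do not see values at other times, and the zero function is as good as any other
periodic function, so nothing is lost and global measurability is gained.\<close>

definition restrict_time :: "real \<Rightarrow> (real \<Rightarrow> real \<Rightarrow> real) \<Rightarrow> real \<Rightarrow> real \<Rightarrow> real" where
  "restrict_time T u t x = (if t \<in> {0..T} then u t x else 0)"

lemma esssup_cong: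
  assumes "\<And>x. x \<in> space M \<Longrightarrow> f x = g x"
  shows "esssup M f = esssup M g"
  unfolding esssup_def using measurable_cong[of M f g borel] assms
  by (auto intro!: Limsup_eq AE_I2)

lemma besov_norm_restrict_time: "besov_norm \<phi> L T s p r (restrict_time T u) = besov_norm \<phi> L T s p r u"
proof -
  have e: "lp_piece \<phi> k (restrict_time T u) (fst z) (snd z) = lp_piece \<phi> k u (fst z) (snd z)" if "z \<in> space (strip T L)" for k z
    using that by (auto simp: lp_piece_def restrict_time_def space_restrict_space)
  have "lp_piece_norm \<phi> L T p k (restrict_time T u) = lp_piece_norm \<phi> L T p k u" for k
    unfolding lp_piece_norm_def Lp_norm_def case_prod_beta'
    by (intro if_cong refl esssup_cong arg_cong2[of _ _ _ _ enn_powr] nn_integral_cong) (simp_all add: e)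
  then show ?thesis by (simp add: besov_norm_def)
qed

text \<open>Periodicity is included, and \<open>u\<close> is identified with \<open>D 0 0\<close> as a function of \<open>x\<close>, so that derivatives of \<open>u\<close>
in \<open>x\<close> at the times in \<open>I\<close> are literally entries of the table.\<close>

definition derivative_table ::
  "real \<Rightarrow> real set \<Rightarrow> (real \<Rightarrow> real \<Rightarrow> real) \<Rightarrow> (nat \<Rightarrow> nat \<Rightarrow> real \<Rightarrow> real \<Rightarrow> real) \<Rightarrow> bool" where
  "derivative_table L I u D \<longleftrightarrow> (\<forall>t\<in>I. u t = D 0 0 t \<and> (\<forall>x. u t (x + L) = u t x)) \<and>
     (\<forall>i j. continuous_on (I \<times> UNIV) (\<lambda>(t, x). D i j t x)) \<and>
     (\<forall>i j. \<forall>t\<in>I. \<forall>x. ((\<lambda>\<tau>. D i j \<tau> x) has_real_derivative D (Suc i) j t x) (at t within I)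
       \<and> (D i j t has_real_derivative D i (Suc j) t x) (at x))"

lemma smooth_periodic_iff_derivative_table: "smooth_periodic L I u \<longleftrightarrow> (\<exists>D. derivative_table L I u D)"
proof -
  have "(\<forall>t\<in>I. u t = D 0 0 t \<and> (\<forall>x. u t (x + L) = u t x)) \<longleftrightarrow>
    (\<forall>t\<in>I. \<forall>x. D 0 0 t x = u t x) \<and> (\<forall>t\<in>I. \<forall>x. u t (x + L) = u t x)" for D :: "nat \<Rightarrow> nat \<Rightarrow> real \<Rightarrow> real \<Rightarrow> real"
    by (auto simp: fun_eq_iff)
  note split = this
  show ?thesis
    unfolding smooth_periodic_def smooth_strip_def derivative_table_def periodic_fun_simple_def split
    by (iprover intro: iffI conjI exI elim: conjE exE)
qed

lemma derivative_tableD: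
  assumes "derivative_table L I u D"
  shows "t \<in> I \<Longrightarrow> u t = D 0 0 t"
    and "continuous_on (I \<times> UNIV) (\<lambda>(t, x). D i j t x)"
    and "t \<in> I \<Longrightarrow> ((\<lambda>\<tau>. D i j \<tau> x) has_real_derivative D (Suc i) j t x) (at t within I)"
    and "t \<in> I \<Longrightarrow> (D i j t has_real_derivative D i (Suc j) t x) (at x)"
    and "t \<in> I \<Longrightarrow> ((\<lambda>\<tau>. u \<tau> x) has_real_derivative D 1 0 t x) (at t within I)"
    and "t \<in> I \<Longrightarrow> u t (x + L) = u t x"
proof -
  show dt: "((\<lambda>\<tau>. D i j \<tau> x) has_real_derivative D (Suc i) j t x) (at t within I)" if "t \<in> I" for i j t x
    using assms that unfolding derivative_table_def by blast
  show u: "u t = D 0 0 t" if "t \<in> I" for t using assms that unfolding derivative_table_def by blast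
  show "((\<lambda>\<tau>. u \<tau> x) has_real_derivative D 1 0 t x) (at t within I)" if "t \<in> I"
  proof -
    have "((\<lambda>\<tau>. D 0 0 \<tau> x) has_real_derivative D 1 0 t x) (at t within I)" using dt[OF that, of 0 0 x] by simp
    then show ?thesis
      by (rule has_field_derivative_transform_within[OF _ zero_less_one that]) (simp add: u)
  qed
qed (use assms in \<open>auto simp: derivative_table_def\<close>)

lemma smooth_periodic_admissible:
  assumes "0 < L" "smooth_periodic L {0..T} u"
  shows "admissible L (restrict_time T u)"
  unfolding admissible_def
proof (intro conjI allI)
  obtain D where "derivative_table L {0..T} u D"
    using assms(2) smooth_periodic_iff_derivative_table by blast
  note D = derivative_tableD[OF this]
  have c: "continuous_on ({0..T} \<times> UNIV) (\<lambda>p. u (fst p) (snd p))"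
    using D(2)[of 0 0] by (rule continuous_on_eq) (auto simp: D(1))
  have "closed ({0..T} \<times> (UNIV :: real set))" by (intro closed_Times) auto
  then have "(\<lambda>p. indicator ({0..T} \<times> UNIV) p *\<^sub>R u (fst p) (snd p)) \<in> borel_measurable borel"
    by (intro borel_measurable_continuous_on_indicator c borel_closed)
  moreover have "indicator ({0..T} \<times> UNIV) p *\<^sub>R u (fst p) (snd p) = restrict_time T u (fst p) (snd p)" for p
    by (cases p) (auto simp: restrict_time_def split: split_indicator)
  ultimately show "(\<lambda>p. restrict_time T u (fst p) (snd p)) \<in> borel_measurable (borel \<Otimes>\<^sub>M borel)"
    by (simp add: borel_prod)
  fix t
  show "wiener L (restrict_time T u t)"
  proof (cases "t \<in> {0..T}")
    case True
    have f: "restrict_time T u t = D 0 0 t" using True D(1) by (simp add: restrict_time_def[abs_def])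
    have per': "D 0 0 t (x + L) = D 0 0 t x" for x using D(6)[OF True, of x] D(1)[OF True] by simp
    have c3: "continuous_on UNIV (D 0 (Suc (Suc (Suc 0))) t)" by (rule continuous_on_section(1)[OF D(2) True])
    note F = smooth_periodic_fourier[OF assms(1) D(4)[OF True] D(4)[OF True] D(4)[OF True] c3 per']
    have "continuous_on UNIV (D 0 0 t)" by (rule continuous_on_section(1)[OF D(2) True])
    then show ?thesis unfolding f wiener_def using F by blast
  next
    case False
    then have f: "restrict_time T u t = (\<lambda>_. 0)" by (auto simp: restrict_time_def)
    have d0: "((\<lambda>_. 0) has_real_derivative 0) (at x)" for x :: real by simp
    have c0: "continuous_on UNIV (\<lambda>_::real. 0::real)" by simp
    note F = smooth_periodic_fourier[OF assms(1) d0 d0 d0 c0 refl]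
    show ?thesis unfolding f wiener_def using F c0 by blast
  qed
qed

section \<open>The estimate on a finite time interval\<close>

lemma nn_integral_interval_eq_integral:
  fixes f :: "real \<Rightarrow> real"
  assumes "continuous_on {a..b} f" "\<And>x. x \<in> {a..b} \<Longrightarrow> 0 \<le> f x"
  shows "(\<integral>\<^sup>+x. ennreal (f x) * indicator {a..b} x \<partial>lborel) = ennreal (integral {a..b} f)"
proof -
  have "(\<integral>\<^sup>+x. ennreal (f x) * indicator {a..b} x \<partial>lborel) = (\<integral>\<^sup>+x. ennreal (indicat_real {a..b} x *\<^sub>R f x) \<partial>lborel)"
    by (intro nn_integral_cong) (auto split: split_indicator)
  also have "\<dots> = ennreal (LINT x|lborel. indicat_real {a..b} x *\<^sub>R f x)"
  proof (rule nn_integral_eq_integral)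
    show "integrable lborel (\<lambda>x. indicat_real {a..b} x *\<^sub>R f x)"
      using set_integrable_continuous[OF assms(1)] by (simp add: set_integrable_def)
    show "AE x in lborel. 0 \<le> indicat_real {a..b} x *\<^sub>R f x"
      using assms(2) by (intro AE_I2) (simp split: split_indicator)
  qed
  finally show ?thesis
    using set_integral_eq_integral[OF assms(1)] by (simp add: set_lebesgue_integral_def)
qed

lemma set_integrable_mult_abs_dx:
  assumes "wiener L f" "continuous_on {0..L} v"
  shows "set_integrable lborel {0..L} (\<lambda>x. v x * Re (abs_dx L f x))"
proof -
  define b where "b n = of_real (2 * pi / L) * (of_int \<bar>n\<bar> * fourier_coeff L f n)" for n
  have nb: "integrable CS (\<lambda>n. of_int \<bar>n\<bar> * fourier_coeff L f n)" using assms(1) by (simp add: wiener_def)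
  have e: "abs_dx L f = trig L b" unfolding b_def by (rule ext) (rule abs_dx_eq_trig[OF nb])
  have b: "integrable CS b" unfolding b_def using nb by simp
  have "set_integrable lborel {0..L} (\<lambda>x. (LINT n|CS. norm (b n)) * v x)"
    by (intro set_integrable_continuous continuous_intros assms(2))
  then show ?thesis
    unfolding set_integrable_def
  proof (rule Bochner_Integration.integrable_bound)
    have "(\<lambda>x. indicat_real {0..L} x *\<^sub>R v x) \<in> borel_measurable borel"
      by (rule borel_measurable_continuous_on_indicator[OF _ assms(2)]) simp
    moreover have [measurable]: "(\<lambda>x. Re (abs_dx L f x)) \<in> borel_measurable borel"
      unfolding e by measurable
    ultimately have "(\<lambda>x. (indicat_real {0..L} x *\<^sub>R v x) * Re (abs_dx L f x)) \<in> borel_measurable lborel" by measurable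
    then show "(\<lambda>x. indicat_real {0..L} x *\<^sub>R (v x * Re (abs_dx L f x))) \<in> borel_measurable lborel"
      by (simp add: mult.assoc)
    have "\<bar>v x * Re (trig L b x)\<bar> \<le> \<bar>(LINT n|CS. norm (b n)) * v x\<bar>" for x
    proof -
      have "\<bar>Re (trig L b x)\<bar> \<le> (LINT n|CS. norm (b n))"
        using norm_trig_le[OF b] abs_Re_le_cmod order_trans by blast
      then show ?thesis using mult_right_mono[of "\<bar>Re (trig L b x)\<bar>" "\<bar>LINT n|CS. norm (b n)\<bar>" "\<bar>v x\<bar>"]
        by (simp add: abs_mult mult.commute)
    qed
    then show "AE x in lborel. norm (indicat_real {0..L} x *\<^sub>R (v x * Re (abs_dx L f x)))
      \<le> norm (indicat_real {0..L} x *\<^sub>R ((LINT n|CS. norm (b n)) * v x))"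
      unfolding e by (auto split: split_indicator)
  qed
qed

text \<open>The equation holds between complex numbers; taking real parts gives a continuous real forcing.\<close>

lemma burgers_solution_strip:
  assumes "0 < T" "0 < L" and u: "smooth_periodic L {0..T} u" and sol: "burgers_solution L {0..T} u g \<xi>"
  obtains ut ux where "burgers_strip T L u ut ux"
    "\<And>t x. t \<in> {0..T} \<Longrightarrow> ut t x + u t x * ux t x = Re (abs_dx L (g t) x) + Re (abs_dx L (\<xi> t) x)"
proof -
  obtain D where "derivative_table L {0..T} u D"
    using u smooth_periodic_iff_derivative_table by blast
  note D = derivative_tableD[OF this]
  have dx: "(u t has_real_derivative D 0 1 t x) (at x)" if "t \<in> {0..T}" for t x
    using D(4)[OF that, of 0 0 x] D(1)[OF that] by simp
  have "burgers_strip T L u (D 1 0) (D 0 1)"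
  proof
    show "continuous_on ({0..T} \<times> UNIV) (\<lambda>(t, x). u t x)"
      using D(2)[of 0 0] by (rule continuous_on_eq) (auto simp: D(1))
  qed (use assms(1,2) D(2,5,6) dx in auto)
  moreover have "D 1 0 t x + u t x * D 0 1 t x = Re (abs_dx L (g t) x) + Re (abs_dx L (\<xi> t) x)" if t: "t \<in> {0..T}" for t x
  proof -
    have "vector_derivative (\<lambda>\<tau>. u \<tau> x) (at t within {0..T}) = D 1 0 t x"
      using vector_derivative_within_cbox[OF assms(1), of t "\<lambda>\<tau>. u \<tau> x" "D 1 0 t x"] D(5)[OF t] t
      by (simp add: has_real_derivative_iff_has_vector_derivative)
    moreover have "deriv (u t) x = D 0 1 t x" by (rule DERIV_imp_deriv[OF dx[OF t]])
    ultimately have "complex_of_real (D 1 0 t x + u t x * D 0 1 t x) = abs_dx L (g t) x + abs_dx L (\<xi> t) x"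
      using sol t unfolding burgers_solution_def by metis
    from arg_cong[OF this, of Re] show ?thesis by simp
  qed
  ultimately show thesis using that by blast
qed

lemma Lp_norm_2_sq_eq_integral:
  fixes f :: "real \<Rightarrow> real"
  assumes "continuous_on {0..L} f"
  shows "Lp_norm 2 (restrict_space lborel {0..L}) f ^ 2 = ennreal (integral {0..L} (\<lambda>x. (f x)\<^sup>2))"
proof -
  have "Lp_norm 2 (restrict_space lborel {0..L}) f ^ 2 = (\<integral>\<^sup>+x. ennreal (norm (f x) powr 2) \<partial>restrict_space lborel {0..L})"
    by (simp add: Lp_norm_def enn_powr_powr flip: enn_powr_numeral)
  also have "\<dots> = (\<integral>\<^sup>+x. ennreal ((f x)\<^sup>2) * indicator {0..L} x \<partial>lborel)"
    by (subst nn_integral_restrict_space) (auto simp: powr_numeral)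
  also have "\<dots> = ennreal (integral {0..L} (\<lambda>x. (f x)\<^sup>2))"
    by (intro nn_integral_interval_eq_integral continuous_intros assms) simp
  finally show ?thesis .
qed

lemma one_third_ennreal: "(1 :: ennreal) / 3 = ennreal (1 / 3)"
  using divide_ennreal[of 1 3] by simp

lemma two_thirds_ennreal: "(1 :: ennreal) / (3 / 2) = ennreal (2 / 3)"
proof -
  have "(3 / 2 :: ennreal) = ennreal (3 / 2)" using divide_ennreal[of 3 2] by simp
  then show ?thesis using divide_ennreal[of 1 "3 / 2"] by simp
qed

text \<open>The pairing with the full forcing is continuous in time. It is split into the two contributions for each
fixed time, and their measurable majorants are integrated separately.\<close>

lemma forcing_pairing_le:
  fixes w g f \<eta> :: "real \<Rightarrow> real \<Rightarrow> real"
  assumes "0 < L" and g: "smooth_periodic L {0..T} g" and f: "smooth_periodic L {0..T} f"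
    and \<eta>: "\<And>t x. t \<in> {0..T} \<Longrightarrow> \<eta> t x = Re (abs_dx L (g t) x) + Re (abs_dx L (f t) x)"
    and cont: "continuous_on ({0..T} \<times> {0..L}) (\<lambda>(t, x). w t x * \<eta> t x)" and w: "\<And>t. continuous_on UNIV (w t)"
    and bg: "abs_dx_pairing_bounded L T w (restrict_time T g) Bg"
    and bf: "abs_dx_pairing_bounded L T w (restrict_time T f) Bf"
  shows "ennreal \<bar>integral {0..T} (\<lambda>t. integral {0..L} (\<lambda>x. w t x * \<eta> t x))\<bar> \<le> Bg + Bf"
proof -
  obtain \<Phi>1 where \<Phi>1[measurable]: "\<Phi>1 \<in> borel_measurable borel"
    and b1: "\<And>t. ennreal \<bar>LINT x:{0..L}|lborel. w t x * Re (abs_dx L (restrict_time T g t) x)\<bar> \<le> \<Phi>1 t"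
    and i1: "(\<integral>\<^sup>+t. \<Phi>1 t * indicator {0..T} t \<partial>lborel) \<le> Bg"
    using bg unfolding abs_dx_pairing_bounded_def by blast
  obtain \<Phi>2 where \<Phi>2[measurable]: "\<Phi>2 \<in> borel_measurable borel"
    and b2: "\<And>t. ennreal \<bar>LINT x:{0..L}|lborel. w t x * Re (abs_dx L (restrict_time T f t) x)\<bar> \<le> \<Phi>2 t"
    and i2: "(\<integral>\<^sup>+t. \<Phi>2 t * indicator {0..T} t \<partial>lborel) \<le> Bf"
    using bf unfolding abs_dx_pairing_bounded_def by blast
  define I where "I t = integral {0..L} (\<lambda>x. w t x * \<eta> t x)" for t
  have pt: "ennreal \<bar>I t\<bar> \<le> \<Phi>1 t + \<Phi>2 t" if t: "t \<in> {0..T}" for t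
  proof -
    have rg: "restrict_time T g t = g t" "restrict_time T f t = f t" using t by (auto simp: restrict_time_def)
    have wg: "wiener L (g t)" "wiener L (f t)"
      using smooth_periodic_admissible[OF \<open>0 < L\<close> g] smooth_periodic_admissible[OF \<open>0 < L\<close> f] rg
      unfolding admissible_def by metis+
    have i: "set_integrable lborel {0..L} (\<lambda>x. w t x * Re (abs_dx L (g t) x))"
      "set_integrable lborel {0..L} (\<lambda>x. w t x * Re (abs_dx L (f t) x))"
      by (intro set_integrable_mult_abs_dx wg continuous_on_subset[OF w] subset_UNIV)+
    have "I t = (LINT x:{0..L}|lborel. w t x * \<eta> t x)"
      unfolding I_def by (rule set_integral_eq_integral[symmetric]) (rule continuous_on_section(1)[OF cont t])
    also have "\<dots> = (LINT x:{0..L}|lborel. w t x * Re (abs_dx L (g t) x) + w t x * Re (abs_dx L (f t) x))"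
      by (simp add: \<eta>[OF t] distrib_left)
    also have "\<dots> = (LINT x:{0..L}|lborel. w t x * Re (abs_dx L (g t) x)) + (LINT x:{0..L}|lborel. w t x * Re (abs_dx L (f t) x))"
      by (rule set_integral_add(2)[OF i])
    finally have "ennreal \<bar>I t\<bar> \<le> ennreal \<bar>LINT x:{0..L}|lborel. w t x * Re (abs_dx L (g t) x)\<bar> + ennreal \<bar>LINT x:{0..L}|lborel. w t x * Re (abs_dx L (f t) x)\<bar>"
      by (simp add: ennreal_plus[symmetric] ennreal_leI abs_triangle_ineq del: ennreal_plus)
    also have "\<dots> \<le> \<Phi>1 t + \<Phi>2 t" using b1[of t] b2[of t] by (intro add_mono) (simp_all add: rg)
    finally show ?thesis .
  qed
  have "continuous_on {0..T} I" unfolding I_def[abs_def] by (rule continuous_on_inner_integral[OF cont])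
  then have "ennreal \<bar>integral {0..T} I\<bar> = ennreal \<bar>LINT t:{0..T}|lborel. I t\<bar>"
    by (simp only: set_integral_eq_integral)
  also have "\<dots> \<le> (\<integral>\<^sup>+t. ennreal \<bar>I t\<bar> * indicator {0..T} t \<partial>lborel)"
    by (rule ennreal_abs_set_integral_le)
  also have "\<dots> \<le> (\<integral>\<^sup>+t. \<Phi>1 t * indicator {0..T} t + \<Phi>2 t * indicator {0..T} t \<partial>lborel)"
    using pt by (intro nn_integral_mono) (simp split: split_indicator)
  also have "\<dots> = (\<integral>\<^sup>+t. \<Phi>1 t * indicator {0..T} t \<partial>lborel) + (\<integral>\<^sup>+t. \<Phi>2 t * indicator {0..T} t \<partial>lborel)"
    by (rule nn_integral_add) measurable
  also have "\<dots> \<le> Bg + Bf" by (intro add_mono i1 i2)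
  finally show ?thesis by (simp only: I_def[abs_def])
qed

lemma (in burgers_strip) nn_integral_cubic_increment:
  assumes "admissible L (restrict_time T u)"
  shows "(\<integral>\<^sup>+z. ennreal (\<bar>restrict_time T u (fst z) (snd z + h) - restrict_time T u (fst z) (snd z)\<bar> ^ 3) \<partial>strip T L)
    = ennreal (integral {0..T} (\<lambda>t. integral {0..L} (\<lambda>x. \<bar>d h t x\<bar> ^ 3)))"
proof -
  let ?v = "restrict_time T u"
  have dj: "continuous_on ({0..T} \<times> {0..L}) (\<lambda>(t, x). \<bar>d h t x\<bar> ^ 3)"
    unfolding case_prod_beta' d_def by (intro continuous_intros continuous_compose_u) auto
  have vm: "(\<lambda>z. ennreal (\<bar>?v (fst z) (snd z + h) - ?v (fst z) (snd z)\<bar> ^ 3)) \<in> borel_measurable (borel \<Otimes>\<^sub>M borel)"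
    by (intro measurable_compose[OF _ measurable_ennreal] borel_measurable_power borel_measurable_abs borel_measurable_diff
        admissible_measurable[OF assms] borel_measurable_add measurable_fst measurable_snd borel_measurable_const)
  have "(\<integral>\<^sup>+z. ennreal (\<bar>?v (fst z) (snd z + h) - ?v (fst z) (snd z)\<bar> ^ 3) \<partial>strip T L)
    = (\<integral>\<^sup>+t. (\<integral>\<^sup>+x. ennreal (\<bar>?v t (x + h) - ?v t x\<bar> ^ 3) * indicator {0..L} x \<partial>lborel) * indicator {0..T} t \<partial>lborel)"
    using nn_integral_strip[OF vm, of T L] by simp
  also have "\<dots> = (\<integral>\<^sup>+t. ennreal (integral {0..L} (\<lambda>x. \<bar>d h t x\<bar> ^ 3)) * indicator {0..T} t \<partial>lborel)"
  proof (rule nn_integral_cong)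
    fix t
    show "(\<integral>\<^sup>+x. ennreal (\<bar>?v t (x + h) - ?v t x\<bar> ^ 3) * indicator {0..L} x \<partial>lborel) * indicator {0..T} t
      = ennreal (integral {0..L} (\<lambda>x. \<bar>d h t x\<bar> ^ 3)) * indicator {0..T} t"
    proof (cases "t \<in> {0..T}")
      case t: True
      then have "?v t = u t" by (auto simp: restrict_time_def)
      then show ?thesis
        using nn_integral_interval_eq_integral[OF continuous_on_section(1)[OF dj t]] by (simp add: d_def)
    qed simp
  qed
  also have "\<dots> = ennreal (integral {0..T} (\<lambda>t. integral {0..L} (\<lambda>x. \<bar>d h t x\<bar> ^ 3)))"
    by (rule nn_integral_interval_eq_integral[OF continuous_on_inner_integral[OF dj]])
       (auto intro!: Henstock_Kurzweil_Integration.integral_nonneg integrable_continuous_interval continuous_on_section(1)[OF dj])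
  finally show ?thesis .
qed

context LP_family
begin

text \<open>Let \<open>Q\<close> be the sum of the two products of Besov norms. Up to constants \<open>Q\<close> bounds the pairing of the
forcing with \<open>u\<close>, hence the energy at time \<open>T\<close>, and its pairing with \<open>\<bar>d h\<bar>\<close> and its translates, hence the
right-hand side of the Karman-Howarth-Monin identity. So the cubic increments are at most linear in \<open>H\<close>,
which is the Besov bound.\<close>

lemma finite_time_estimate:
  assumes s: "0 < s" "s < 1"
    and r: "1 \<le> r" "1 \<le> r'" "1 / r + 1 / r' = 1" and p: "1 \<le> p" "1 \<le> p'" "1 / p + 1 / p' = 1"
  obtains c :: real where "0 < c" "\<And>L T u g \<xi>. 0 < L \<Longrightarrow> 0 < T \<Longrightarrow>
    smooth_periodic L {0..T} u \<Longrightarrow> smooth_periodic L {0..T} g \<Longrightarrow> smooth_periodic L {0..T} \<xi> \<Longrightarrow>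
    burgers_solution L {0..T} u g \<xi> \<Longrightarrow>
    besov_norm \<phi> L T (1/3) 3 \<infinity> u ^ 3 \<le> ennreal c *
      (besov_norm \<phi> L T (1/3) 3 \<infinity> u * besov_norm \<phi> L T (2/3) (3/2) 1 g
       + besov_norm \<phi> L T s p r u * besov_norm \<phi> L T (1 - s) p' r' \<xi>
       + Lp_norm 2 (restrict_space lborel {0..L}) (u 0) ^ 2)"
proof -
  have e32: "1 / 3 + 1 / (3 / 2) = (1 :: ennreal)" "1 \<le> (3 / 2 :: ennreal)" "1 \<le> (3 :: ennreal)"
  proof -
    show "1 / 3 + 1 / (3 / 2) = (1 :: ennreal)"
      unfolding one_third_ennreal two_thirds_ennreal by (simp add: ennreal_plus[symmetric] del: ennreal_plus)
    have "(3 / 2 :: ennreal) = ennreal (3 / 2)" using divide_ennreal[of 3 2] by simp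
    then show "1 \<le> (3 / 2 :: ennreal)" "1 \<le> (3 :: ennreal)" by simp_all
  qed
  have s13: "0 < (1/3 :: real)" "(1/3 :: real) < 1" by simp_all
  have r1: "1 \<le> (\<infinity> :: ennreal)" "1 \<le> (1 :: ennreal)" "1 / \<infinity> + 1 / 1 = (1 :: ennreal)" by simp_all
  obtain c1 where c1: "0 < c1" "\<And>L T u \<xi> w. 0 < L \<Longrightarrow> admissible L u \<Longrightarrow> admissible L \<xi> \<Longrightarrow> controlled_by L u w \<Longrightarrow>
    abs_dx_pairing_bounded L T w \<xi> (ennreal c1 * (besov_norm \<phi> L T (1/3) 3 \<infinity> u * besov_norm \<phi> L T (1 - 1/3) (3/2) 1 \<xi>))"
    using abs_dx_bilinear[OF s13 r1 e32(3,2,1)] by blast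
  obtain c2 where c2: "0 < c2" "\<And>L T u \<xi> w. 0 < L \<Longrightarrow> admissible L u \<Longrightarrow> admissible L \<xi> \<Longrightarrow> controlled_by L u w \<Longrightarrow>
    abs_dx_pairing_bounded L T w \<xi> (ennreal c2 * (besov_norm \<phi> L T s p r u * besov_norm \<phi> L T (1 - s) p' r' \<xi>))"
    using abs_dx_bilinear[OF s r p] by blast
  obtain C where C: "0 < C" "\<And>L T u A. 0 < L \<Longrightarrow> admissible L u \<Longrightarrow>
    (\<And>h. 0 < h \<Longrightarrow> (\<integral>\<^sup>+z. ennreal (\<bar>u (fst z) (snd z + h) - u (fst z) (snd z)\<bar> ^ 3) \<partial>strip T L) \<le> ennreal h * A) \<Longrightarrow>
    besov_norm \<phi> L T (1/3) 3 \<infinity> u ^ 3 \<le> ennreal C * A"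
    using besov_le_cubic_increments by blast
  define K where "K = 36 * (c1 + c2) + 24"
  have K: "0 < C * K" using C(1) c1(1) c2(1) by (simp add: K_def)
  have "besov_norm \<phi> L T (1/3) 3 \<infinity> u ^ 3 \<le> ennreal (C * K) *
      (besov_norm \<phi> L T (1/3) 3 \<infinity> u * besov_norm \<phi> L T (2/3) (3/2) 1 g
       + besov_norm \<phi> L T s p r u * besov_norm \<phi> L T (1 - s) p' r' \<xi>
       + Lp_norm 2 (restrict_space lborel {0..L}) (u 0) ^ 2)"
    if L: "0 < L" and T: "0 < T" and su: "smooth_periodic L {0..T} u" and sg: "smooth_periodic L {0..T} g"
      and s\<xi>: "smooth_periodic L {0..T} \<xi>" and sol: "burgers_solution L {0..T} u g \<xi>" for L T u g \<xi>
  proof -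
    obtain ut ux where B: "burgers_strip T L u ut ux"
      and eq: "\<And>t x. t \<in> {0..T} \<Longrightarrow> ut t x + u t x * ux t x = Re (abs_dx L (g t) x) + Re (abs_dx L (\<xi> t) x)"
      using burgers_solution_strip[OF T L su sol] by blast
    interpret B: burgers_strip T L u ut ux by (rule B)
    define v where "v = restrict_time T u"
    have v: "admissible L v" unfolding v_def by (rule smooth_periodic_admissible[OF L su])
    have v_eq: "v t x = u t x" if "t \<in> {0..T}" for t x using that by (simp add: v_def restrict_time_def)
    have vc: "continuous_on UNIV (\<lambda>x. v t (x + a))" for t a
    proof -
      have "continuous_on UNIV (v t)" using v by (simp add: admissible_def wiener_def)
      then show ?thesis by (rule continuous_on_compose2) (auto intro!: continuous_intros)
    qed
    have vp: "v t (x + L + a) = v t (x + a)" for t x a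
      using admissible_period[OF v, of t "x + a"] L by (simp add: algebra_simps)
    define G where "G = besov_norm \<phi> L T (1/3) 3 \<infinity> u * besov_norm \<phi> L T (2/3) (3/2) 1 g"
    define X where "X = besov_norm \<phi> L T s p r u * besov_norm \<phi> L T (1 - s) p' r' \<xi>"
    define Q where "Q = ennreal c1 * G + ennreal c2 * X"
    have pairing: "ennreal \<bar>integral {0..T} (\<lambda>t. integral {0..L} (\<lambda>x. w t x * B.\<eta> t x))\<bar> \<le> Q"
      if w: "controlled_by L v w" and wj: "continuous_on ({0..T} \<times> {0..L}) (\<lambda>z. w (fst z) (snd z))" for w
      unfolding Q_def
    proof (rule forcing_pairing_le[OF L sg s\<xi>])
      show "B.\<eta> t x = Re (abs_dx L (g t) x) + Re (abs_dx L (\<xi> t) x)" if "t \<in> {0..T}" for t x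
        using eq[OF that] by (simp add: B.\<eta>_def)
      show "continuous_on ({0..T} \<times> {0..L}) (\<lambda>(t, x). w t x * B.\<eta> t x)"
        unfolding case_prod_beta' B.\<eta>_def by (intro continuous_intros wj B.continuous_compose_u) auto
      show "continuous_on UNIV (w t)" for t using w by (simp add: controlled_by_def)
      show "abs_dx_pairing_bounded L T w (restrict_time T g) (ennreal c1 * G)"
        "abs_dx_pairing_bounded L T w (restrict_time T \<xi>) (ennreal c2 * X)"
        using c1(2)[OF L v smooth_periodic_admissible[OF L sg] w, of T] c2(2)[OF L v smooth_periodic_admissible[OF L s\<xi>] w, of T]
        by (simp_all add: besov_norm_restrict_time v_def G_def X_def)
    qed
    \<comment> \<open>\<open>36 = 6 * (2 + 4)\<close> and \<open>24 = 6 * (2 + 2)\<close>, from \<open>6 (2 Q + 2 E(0) + 2 E(T))\<close> with \<open>E(T) \<le> E(0) + 2 Q\<close>.\<close>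
    define A where "A = ennreal 36 * Q + ennreal 24 * ennreal (B.energy 0)"
    have incr: "(\<integral>\<^sup>+z. ennreal (\<bar>v (fst z) (snd z + H) - v (fst z) (snd z)\<bar> ^ 3) \<partial>strip T L) \<le> ennreal H * A" if H: "0 < H" for H
    proof (cases "Q = \<infinity>")
      case True
      then show ?thesis using H by (simp add: A_def ennreal_mult_top)
    next
      case False
      define q where "q = enn2real Q"
      have Q: "Q = ennreal q" "0 \<le> q" using False by (simp_all add: q_def less_top)
      have w: "\<bar>integral {0..T} (\<lambda>t. integral {0..L} (\<lambda>x. w t x * B.\<eta> t x))\<bar> \<le> q"
        if "controlled_by L v w'" "continuous_on ({0..T} \<times> {0..L}) (\<lambda>z. w' (fst z) (snd z))"
          "\<And>t x. t \<in> {0..T} \<Longrightarrow> w' t x = w t x" for w w'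
      proof -
        have "integral {0..T} (\<lambda>t. integral {0..L} (\<lambda>x. w' t x * B.\<eta> t x)) = integral {0..T} (\<lambda>t. integral {0..L} (\<lambda>x. w t x * B.\<eta> t x))"
          using that(3) by (intro Henstock_Kurzweil_Integration.integral_cong) simp
        then show ?thesis using pairing[OF that(1,2)] Q by simp
      qed
      have vj: "continuous_on ({0..T} \<times> {0..L}) (\<lambda>z. v (fst z) (snd z + a))" for a
      proof -
        have "continuous_on ({0..T} \<times> {0..L}) (\<lambda>z. u (fst z) (snd z + a))"
          by (intro B.continuous_compose_u continuous_intros) auto
        then show ?thesis by (rule continuous_on_eq) (auto simp: v_eq)
      qed
      have "controlled_by L v v"
        using vc[of _ 0] vp[of _ _ 0] unfolding controlled_by_def by (auto intro!: exI[of _ 0])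
      then have "\<bar>integral {0..T} (\<lambda>t. integral {0..L} (\<lambda>x. u t x * B.\<eta> t x))\<bar> \<le> q"
        using vj[of 0] v_eq by (intro w[of v]) simp_all
      then have en: "B.energy T \<le> B.energy 0 + 2 * q" using B.energy_identity by linarith
      have diff: "\<bar>integral {0..T} (\<lambda>t. integral {0..L} (\<lambda>x. \<bar>B.d h t (x + a)\<bar> * B.\<eta> t x))\<bar> \<le> q" for h a
      proof (rule w[of "\<lambda>t x. \<bar>v t (x + (a + h)) - v t (x + a)\<bar>"])
        show "controlled_by L v (\<lambda>t x. \<bar>v t (x + (a + h)) - v t (x + a)\<bar>)"
          unfolding controlled_by_def
        proof (intro conjI allI)
          show "\<exists>a' b'. \<forall>t x y. \<bar>\<bar>v t (x + (a + h)) - v t (x + a)\<bar> - \<bar>v t (y + (a + h)) - v t (y + a)\<bar>\<bar>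
            \<le> \<bar>v t (x + a') - v t (y + a')\<bar> + \<bar>v t (x + b') - v t (y + b')\<bar>"
            by (rule exI[of _ "a + h"], rule exI[of _ a], intro allI, linarith)
        qed (auto simp: vp intro!: continuous_intros vc)
        show "continuous_on ({0..T} \<times> {0..L}) (\<lambda>z. \<bar>v (fst z) (snd z + (a + h)) - v (fst z) (snd z + a)\<bar>)"
          by (intro continuous_intros vj)
      qed (simp add: v_eq B.d_def add.assoc)
      have "integral {0..T} (\<lambda>t. integral {0..L} (\<lambda>x. \<bar>B.d H t x\<bar> ^ 3)) \<le> H * (6 * (2 * q + 2 * B.energy 0 + 2 * B.energy T))"
      proof (rule B.Karman_Howarth_Monin_bound)
        show "integral {0..T} (\<lambda>t. integral {0..L} (\<lambda>x. \<bar>B.d h t x\<bar> * (B.\<eta> t (x + h) - B.\<eta> t x))) \<le> 2 * q" for h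
          using diff[of h "- h"] diff[of h 0] unfolding B.increment_pairing_shift by simp
      qed (use H in simp)
      also have "\<dots> \<le> H * (36 * q + 24 * B.energy 0)" using H en by (intro mult_left_mono) auto
      finally have real_bound: "integral {0..T} (\<lambda>t. integral {0..L} (\<lambda>x. \<bar>B.d H t x\<bar> ^ 3)) \<le> H * (36 * q + 24 * B.energy 0)" .
      have e0: "0 \<le> B.energy 0" unfolding B.energy_def
        by (rule Henstock_Kurzweil_Integration.integral_nonneg)
           (use T in \<open>auto intro!: integrable_continuous_interval continuous_intros B.continuous_compose_u\<close>)
      have "(\<integral>\<^sup>+z. ennreal (\<bar>v (fst z) (snd z + H) - v (fst z) (snd z)\<bar> ^ 3) \<partial>strip T L) \<le> ennreal (H * (36 * q + 24 * B.energy 0))"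
        unfolding v_def B.nn_integral_cubic_increment[OF v[unfolded v_def]] by (rule ennreal_leI[OF real_bound])
      also have "\<dots> = ennreal H * A"
        using H Q(2) e0 by (simp add: A_def Q(1) ennreal_mult)
      finally show ?thesis .
    qed
    have E: "Lp_norm 2 (restrict_space lborel {0..L}) (u 0) ^ 2 = ennreal (B.energy 0)"
      unfolding B.energy_def by (rule Lp_norm_2_sq_eq_integral) (use T in \<open>auto intro!: B.continuous_compose_u continuous_intros\<close>)
    have "A \<le> ennreal K * (G + X + ennreal (B.energy 0))"
    proof -
      have "A = ennreal (36 * c1) * G + ennreal (36 * c2) * X + ennreal 24 * ennreal (B.energy 0)"
        using c1(1) c2(1) by (simp add: A_def Q_def distrib_left ennreal_mult mult.assoc)
      also have "\<dots> \<le> ennreal K * G + ennreal K * X + ennreal K * ennreal (B.energy 0)"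
        using c1(1) c2(1) by (intro add_mono mult_right_mono ennreal_leI) (auto simp: K_def)
      finally show ?thesis by (simp add: distrib_left)
    qed
    then have "ennreal C * A \<le> ennreal (C * K) * (G + X + ennreal (B.energy 0))"
      using C(1) c1(1) c2(1) by (simp add: ennreal_mult K_def mult.assoc mult_left_mono)
    moreover have "besov_norm \<phi> L T (1/3) 3 \<infinity> v ^ 3 \<le> ennreal C * A" by (rule C(2)[OF L v incr])
    ultimately show ?thesis unfolding E G_def X_def v_def besov_norm_restrict_time by (rule order_trans[rotated])
  qed
  then show thesis using that[OF K] by blast
qed

end

section \<open>Time-space averages\<close>

lemma Limsup_finite_bound:
  fixes f :: "real \<Rightarrow> ennreal"
  assumes "Limsup at_top f = ennreal l" "0 \<le> l" "0 < \<epsilon>"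
  shows "\<forall>\<^sub>F T in at_top. f T \<le> ennreal (l + \<epsilon>)"
proof -
  have "Limsup at_top f < ennreal (l + \<epsilon>)" unfolding assms(1) using assms(2,3) by (simp add: ennreal_lessI)
  from Limsup_lessD[OF this] show ?thesis by eventually_elim simp
qed

text \<open>If all upper limits are finite, replace each function by its upper limit plus \<open>\<epsilon>\<close>, solve for \<open>a\<close> by a cube
root, pass to the upper limit on the left only, and let \<open>\<epsilon>\<close> tend to zero. If one of them is infinite, so is
the right-hand side by the convention \<open>0 \<cdot> \<infinity> = \<infinity>\<close>.\<close>

lemma Limsup_cubic_inequality:
  fixes a \<gamma> \<upsilon> \<rho> e :: "real \<Rightarrow> ennreal"
  assumes "0 < c" and le: "\<forall>\<^sub>F T in at_top. a T ^ 3 \<le> ennreal c * (a T * \<gamma> T + \<upsilon> T * \<rho> T + e T)"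
    and e: "(e \<longlongrightarrow> 0) at_top"
  shows "Limsup at_top a ^ 3 \<le> ennreal c *
    (times_top (Limsup at_top a) (Limsup at_top \<gamma>) + times_top (Limsup at_top \<upsilon>) (Limsup at_top \<rho>))"
proof (cases "Limsup at_top a = \<infinity> \<or> Limsup at_top \<gamma> = \<infinity> \<or> Limsup at_top \<upsilon> = \<infinity> \<or> Limsup at_top \<rho> = \<infinity>")
  case True
  then show ?thesis using \<open>0 < c\<close> by (auto simp: times_top_def ennreal_mult_top)
next
  case False
  then obtain A G U X where eq: "Limsup at_top a = ennreal A" "Limsup at_top \<gamma> = ennreal G"
    "Limsup at_top \<upsilon> = ennreal U" "Limsup at_top \<rho> = ennreal X" and nn: "0 \<le> A" "0 \<le> G" "0 \<le> U" "0 \<le> X"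
    by (metis ennreal_cases infinity_ennreal_def)
  define R where "R \<epsilon> = c * ((A + \<epsilon>) * (G + \<epsilon>) + (U + \<epsilon>) * (X + \<epsilon>) + \<epsilon>)" for \<epsilon>
  have bound: "A ^ 3 \<le> R \<epsilon>" if \<epsilon>: "0 < \<epsilon>" for \<epsilon>
  proof -
    have R0: "0 \<le> R \<epsilon>" using nn \<epsilon> \<open>0 < c\<close> by (simp add: R_def)
    have "\<forall>\<^sub>F T in at_top. e T < ennreal \<epsilon>"
      using order_tendstoD(2)[OF e, of "ennreal \<epsilon>"] \<epsilon> by simp
    with le Limsup_finite_bound[OF eq(1) nn(1) \<epsilon>] Limsup_finite_bound[OF eq(2) nn(2) \<epsilon>]
      Limsup_finite_bound[OF eq(3) nn(3) \<epsilon>] Limsup_finite_bound[OF eq(4) nn(4) \<epsilon>]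
    have "\<forall>\<^sub>F T in at_top. a T \<le> enn_powr (ennreal (R \<epsilon>)) (1/3)"
    proof eventually_elim
      case (elim T)
      have "a T ^ 3 \<le> ennreal c * (ennreal (A + \<epsilon>) * ennreal (G + \<epsilon>) + ennreal (U + \<epsilon>) * ennreal (X + \<epsilon>) + ennreal \<epsilon>)"
        using elim by (intro order_trans[OF elim(1)] mult_left_mono add_mono mult_mono) auto
      also have "\<dots> = ennreal (R \<epsilon>)"
        using nn \<epsilon> \<open>0 < c\<close> by (simp add: R_def ennreal_mult[symmetric] ennreal_plus[symmetric] del: ennreal_plus)
      finally have "enn_powr (a T ^ 3) (1/3) \<le> enn_powr (ennreal (R \<epsilon>)) (1/3)" by (rule enn_powr_mono) simp
      then show ?case by (simp add: enn_powr_powr flip: enn_powr_numeral)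
    qed
    then have "ennreal A \<le> enn_powr (ennreal (R \<epsilon>)) (1/3)"
      unfolding eq(1)[symmetric] by (rule Limsup_bounded)
    from power_mono[OF this, of 3] have "ennreal A ^ 3 \<le> ennreal (R \<epsilon>)"
      by (simp add: enn_powr_powr flip: enn_powr_numeral)
    then show ?thesis using nn(1) R0 by (simp add: ennreal_power)
  qed
  have "(R \<longlongrightarrow> R 0) (at_right 0)" unfolding R_def by (intro tendsto_intros)
  then have "A ^ 3 \<le> R 0"
    by (rule tendsto_lowerbound) (auto simp: eventually_at_filter bound)
  then have "ennreal (A ^ 3) \<le> ennreal (R 0)" by (rule ennreal_leI)
  then show ?thesis
    using nn \<open>0 < c\<close> unfolding eq
    by (simp add: R_def times_top_def ennreal_power ennreal_mult)
qed

lemma smooth_periodic_subset: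
  assumes "smooth_periodic L I u" "I' \<subseteq> I"
  shows "smooth_periodic L I' u"
proof -
  obtain D where "derivative_table L I u D"
    using assms(1) smooth_periodic_iff_derivative_table by blast
  then have "derivative_table L I' u D"
    using assms(2) unfolding derivative_table_def
    by (blast intro: DERIV_subset continuous_on_subset[OF _ Sigma_mono])
  then show ?thesis using smooth_periodic_iff_derivative_table by blast
qed

text \<open>The time derivative in the equation is taken within the time interval; at the interior end \<open>T\<close> the
one-sided derivative within \<open>[0,T]\<close> agrees with the two-sided one because the latter exists.\<close>

lemma burgers_solution_finite_time:
  assumes "smooth_periodic L {0..} u" "burgers_solution L {0..} u g \<xi>" "0 < T"
  shows "burgers_solution L {0..T} u g \<xi>"
  unfolding burgers_solution_def
proof (intro ballI allI)
  fix t x assume t: "t \<in> {0..T}"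
  obtain D where "derivative_table L {0..} u D"
    using assms(1) smooth_periodic_iff_derivative_table by blast
  note d = derivative_tableD(5)[OF this]
  have t0: "t \<in> {0..}" using t by simp
  have "((\<lambda>\<tau>. u \<tau> x) has_real_derivative D 1 0 t x) (at t within {0..T})"
    using d[OF t0] by (rule DERIV_subset) auto
  then have 1: "vector_derivative (\<lambda>\<tau>. u \<tau> x) (at t within {0..T}) = D 1 0 t x"
    using vector_derivative_within_cbox[OF assms(3), of t "\<lambda>\<tau>. u \<tau> x"] t
    by (simp add: has_real_derivative_iff_has_vector_derivative)
  have "t islimpt {0..}"
  proof (rule connected_imp_perfect)
    show "{0..} \<noteq> {a}" for a :: real
    proof
      assume "{0..} = {a}"
      moreover have "t \<in> {0..}" "t + 1 \<in> {0..}" using t by auto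
      ultimately show False by auto
    qed
  qed (use t0 in \<open>auto intro: convex_connected\<close>)
  then have "at t within {0..} \<noteq> bot" using trivial_limit_within[of t "{0..}"] by simp
  then have 2: "vector_derivative (\<lambda>\<tau>. u \<tau> x) (at t within {0..}) = D 1 0 t x"
    using d[OF t0] by (intro vector_derivative_within) (simp_all add: has_real_derivative_iff_has_vector_derivative)
  show "complex_of_real (vector_derivative (\<lambda>\<tau>. u \<tau> x) (at t within {0..T}) + u t x * deriv (u t) x)
    = abs_dx L (g t) x + abs_dx L (\<xi> t) x"
    using assms(2) t0 unfolding burgers_solution_def 1 2[symmetric] by blast
qed

lemma conjugate_exponents_real:
  fixes p q :: ennreal
  assumes "1 / p + 1 / q = 1"
  shows "enn2real (1 / p) + enn2real (1 / q) = 1"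
proof -
  have "1 / p \<le> 1" "1 / q \<le> 1" using assms by (metis add_increasing2 add_increasing order_refl zero_le)+
  then have "1 / p < top" "1 / q < top" using le_less_trans ennreal_one_less_top by blast+
  from enn2real_plus[OF this] show ?thesis by (simp add: assms)
qed

text \<open>Since the exponents are conjugate, the normalisations of the two factors multiply to the normalisation
of the cube of the norm on the left.\<close>

lemma average_weights:
  fixes x y :: ennreal
  assumes "0 < m" "\<alpha> + \<beta> = 1"
  shows "(1 / ennreal (m powr \<alpha>) * x) * (1 / ennreal (m powr \<beta>) * y) = ennreal (1 / m) * (x * y)"
proof -
  have "1 / ennreal (m powr \<alpha>) = ennreal (1 / m powr \<alpha>)" "1 / ennreal (m powr \<beta>) = ennreal (1 / m powr \<beta>)"
    using assms(1) divide_ennreal[of 1] by simp_all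
  moreover have "1 / m powr \<alpha> * (1 / m powr \<beta>) = 1 / m"
    using assms by (simp add: powr_add[symmetric])
  then have "ennreal (1 / m powr \<alpha>) * ennreal (1 / m powr \<beta>) = ennreal (1 / m)"
    by (simp add: ennreal_mult[symmetric])
  ultimately show ?thesis by (metis (no_types, lifting) mult.assoc mult.commute)
qed

theorem proposition2p3:
  fixes \<phi> :: "int \<Rightarrow> real \<Rightarrow> complex" and s :: real and r r' p p' :: ennreal
  assumes "littlewood_paley \<phi>"
    and "0 < s" and "s < 1"
    and "1 \<le> r" and "1 \<le> r'" and "1 \<le> p" and "1 \<le> p'"
    and "1 / r + 1 / r' = 1" and "1 / p + 1 / p' = 1"
  shows "\<exists>c::real. c > 0 \<and> (\<forall>L>0.
    (\<forall>T>0. \<forall>u g \<xi>.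
       smooth_periodic L {0..T} u \<longrightarrow> smooth_periodic L {0..T} g \<longrightarrow> smooth_periodic L {0..T} \<xi> \<longrightarrow>
       burgers_solution L {0..T} u g \<xi> \<longrightarrow>
       besov_norm \<phi> L T (1/3) 3 \<infinity> u ^ 3
       \<le> ennreal c *
          (besov_norm \<phi> L T (1/3) 3 \<infinity> u * besov_norm \<phi> L T (2/3) (3/2) 1 g
           + besov_norm \<phi> L T s p r u * besov_norm \<phi> L T (1 - s) p' r' \<xi>
           + Lp_norm 2 (restrict_space lborel {0..L}) (u 0) ^ 2)) \<and>
    (\<forall>u g \<xi>.
       smooth_periodic L {0..} u \<longrightarrow> smooth_periodic L {0..} g \<longrightarrow> smooth_periodic L {0..} \<xi> \<longrightarrow>
       burgers_solution L {0..} u g \<xi> \<longrightarrow>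
       besov_norm_avg \<phi> L (1/3) 3 \<infinity> u ^ 3
       \<le> ennreal c *
          (times_top (besov_norm_avg \<phi> L (1/3) 3 \<infinity> u) (besov_norm_avg \<phi> L (2/3) (3/2) 1 g)
           + times_top (besov_norm_avg \<phi> L s p r u) (besov_norm_avg \<phi> L (1 - s) p' r' \<xi>))))"
proof -
  interpret LP_family \<phi> by standard (rule assms(1))
  \<comment> \<open>One constant serves both parts: the second is the limit of the first, divided by \<open>L T\<close>.\<close>
  obtain c where c: "0 < c" and fin: "\<And>L T u g \<xi>. 0 < L \<Longrightarrow> 0 < T \<Longrightarrow>
    smooth_periodic L {0..T} u \<Longrightarrow> smooth_periodic L {0..T} g \<Longrightarrow> smooth_periodic L {0..T} \<xi> \<Longrightarrow>
    burgers_solution L {0..T} u g \<xi> \<Longrightarrow>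
    besov_norm \<phi> L T (1/3) 3 \<infinity> u ^ 3 \<le> ennreal c *
      (besov_norm \<phi> L T (1/3) 3 \<infinity> u * besov_norm \<phi> L T (2/3) (3/2) 1 g
       + besov_norm \<phi> L T s p r u * besov_norm \<phi> L T (1 - s) p' r' \<xi>
       + Lp_norm 2 (restrict_space lborel {0..L}) (u 0) ^ 2)"
    using finite_time_estimate[OF assms(2,3,4,5,8,6,7,9)] by blast
  have avg: "besov_norm_avg \<phi> L (1/3) 3 \<infinity> u ^ 3 \<le> ennreal c *
          (times_top (besov_norm_avg \<phi> L (1/3) 3 \<infinity> u) (besov_norm_avg \<phi> L (2/3) (3/2) 1 g)
           + times_top (besov_norm_avg \<phi> L s p r u) (besov_norm_avg \<phi> L (1 - s) p' r' \<xi>))"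
    if L: "0 < L" and u: "smooth_periodic L {0..} u" and g: "smooth_periodic L {0..} g"
      and \<xi>: "smooth_periodic L {0..} \<xi>" and sol: "burgers_solution L {0..} u g \<xi>" for L u g \<xi>
    unfolding besov_norm_avg_def
  proof (rule Limsup_cubic_inequality[OF c, where e="\<lambda>T. ennreal (1 / (L * T)) * Lp_norm 2 (restrict_space lborel {0..L}) (u 0) ^ 2"])
    have third: "enn2real (1 / 3) = 1 / 3" "enn2real (1 / (3 / 2)) = 2 / 3"
      by (simp_all add: one_third_ennreal two_thirds_ennreal)
    show "((\<lambda>T. ennreal (1 / (L * T)) * Lp_norm 2 (restrict_space lborel {0..L}) (u 0) ^ 2) \<longlongrightarrow> 0) at_top"
    proof -
      have "wiener L (restrict_time 0 u 0)"
        using smooth_periodic_admissible[OF L smooth_periodic_subset[OF u, of "{0..0}"]] by (simp add: admissible_def)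
      then have "continuous_on {0..L} (u 0)"
        by (auto simp: wiener_def restrict_time_def[abs_def] intro: continuous_on_subset)
      from Lp_norm_2_sq_eq_integral[OF this] obtain E where E: "Lp_norm 2 (restrict_space lborel {0..L}) (u 0) ^ 2 = ennreal E" "0 \<le> E"
        by (metis ennreal_cases ennreal_neq_top infinity_ennreal_def)
      have "((\<lambda>T. ennreal (E * inverse (L * T))) \<longlongrightarrow> ennreal (E * 0)) at_top"
        using L by (intro tendsto_ennrealI tendsto_mult tendsto_const tendsto_inverse_0_at_top
            filterlim_tendsto_pos_mult_at_top[OF tendsto_const] filterlim_ident)
      moreover have "\<forall>\<^sub>F T in at_top. ennreal (E * inverse (L * T)) = ennreal (1 / (L * T)) * ennreal E"
        using eventually_gt_at_top[of 0]
        by eventually_elim (use L E(2) in \<open>simp add: ennreal_mult[symmetric] divide_inverse mult_ac\<close>)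
      ultimately show ?thesis unfolding E(1) by (simp add: Lim_transform_eventually)
    qed
    show "\<forall>\<^sub>F T in at_top. (1 / ennreal ((L * T) powr enn2real (1 / 3)) * besov_norm \<phi> L T (1 / 3) 3 \<infinity> u) ^ 3
      \<le> ennreal c * ((1 / ennreal ((L * T) powr enn2real (1 / 3)) * besov_norm \<phi> L T (1 / 3) 3 \<infinity> u)
           * (1 / ennreal ((L * T) powr enn2real (1 / (3 / 2))) * besov_norm \<phi> L T (2 / 3) (3 / 2) 1 g)
         + (1 / ennreal ((L * T) powr enn2real (1 / p)) * besov_norm \<phi> L T s p r u)
           * (1 / ennreal ((L * T) powr enn2real (1 / p')) * besov_norm \<phi> L T (1 - s) p' r' \<xi>)
         + ennreal (1 / (L * T)) * Lp_norm 2 (restrict_space lborel {0..L}) (u 0) ^ 2)"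
      using eventually_gt_at_top[of 0]
    proof eventually_elim
      case (elim T)
      have m: "0 < L * T" using L elim by simp
      let ?X = "besov_norm \<phi> L T (1 / 3) 3 \<infinity> u"
      have "(1 / ennreal ((L * T) powr (1 / 3)) * ?X) ^ 3 = ennreal (1 / (L * T)) * ?X ^ 3"
      proof -
        have "1 / ennreal ((L * T) powr (1 / 3)) = ennreal (1 / (L * T) powr (1 / 3))"
          using L elim divide_ennreal[of 1] by simp
        moreover have "(1 / (L * T) powr (1 / 3)) ^ 3 = 1 / (L * T)"
          using L elim by (simp add: power_divide powr_power)
        ultimately show ?thesis by (simp add: power_mult_distrib ennreal_power)
      qed
      also have "\<dots> \<le> ennreal (1 / (L * T)) * (ennreal c *
        (?X * besov_norm \<phi> L T (2/3) (3/2) 1 g + besov_norm \<phi> L T s p r u * besov_norm \<phi> L T (1 - s) p' r' \<xi>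
         + Lp_norm 2 (restrict_space lborel {0..L}) (u 0) ^ 2))"
        using fin[OF L elim] smooth_periodic_subset[of L "{0..}" _ "{0..T}"] u g \<xi>
          burgers_solution_finite_time[OF u sol elim] by (intro mult_left_mono) auto
      also have "\<dots> = ennreal c * (ennreal (1 / (L * T)) * (?X * besov_norm \<phi> L T (2/3) (3/2) 1 g)
         + ennreal (1 / (L * T)) * (besov_norm \<phi> L T s p r u * besov_norm \<phi> L T (1 - s) p' r' \<xi>)
         + ennreal (1 / (L * T)) * Lp_norm 2 (restrict_space lborel {0..L}) (u 0) ^ 2)"
        by (simp only: distrib_left mult_ac)
      finally show ?case
        by (simp only: third average_weights[OF m] average_weights[OF m conjugate_exponents_real[OF assms(9)]])
    qed
  qed
  show ?thesis
    by (intro exI[of _ c] conjI allI impI c fin avg)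
qed

end
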